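(* Let $G$ be a signed graph on $[n]$ with at least one edge or half-edge, and write its chromatic polynomial as \[ \chi_G(\lambda)=\lambda^n+\sum_{j=0}^{n-1}(-1)^{n-j}c_j\lambda^j \, . \] Then $\dim H_{n-2}^{(j)}(\Delta_G)=c_j$ for each $j$. Equivalently, \[ (-1)^n\left[ \chi_G(-\lambda)-(-\lambda)^n\right] =\sum_{j=0}^nc_j\lambda^j=\sum_{j=0}^n\dim H_{n-2}^{(j)}(\Delta_G)\,\lambda^j \, . \]
   Context: A signed graph $G$ on $[n]=\{1,\dots,n\}$ is a multiset $E(G)$ of one-element subsets $\{i\}$ of $[n]$ (half-edges) and two-element subsets $\{i,j\}$ (edges), with a sign map $\sigma$ from the edges to $\{1,-1\}$ such that the positive edges form the edge set of a simple graph and the negative edges form the edge set of a simple graph. A $c$-coloring is a map $\phi:[n]\to\{-c,\dots,c\}$; it is proper if $\phi(i)\neq\phi(j)$ for positive edges $\{i,j\}$, $\phi(i)\neq-\phi(j)$ for negative edges $\{i,j\}$, and $\phi(i)\neq 0$ for half-edges $\{i\}$. The number of proper $c$-colorings equals $\chi_G(2c+1)$ for a polynomial $\chi_G(\lambda)$ of degree $n$ (the chromatic polynomial). Coloring complex: the signed graphic arrangement $\mathcal B_G$ in $\mathbb R^n$ consists of the hyperplanes $x_i=x_j$ for positive edges $\{i,j\}$, $x_i=-x_j$ for negative edges $\{i,j\}$, and $x_i=0$ for half-edges $\{i\}$. Call a nonempty $Q\subseteq[n]\cup-[n]$ (where $-[n]=\{-1,\dots,-n\}$) admissible if it contains no pair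 $\{i,-i\}$; its vertex $v_Q\in\partial[-1,1]^n$ has $i$-th coordinate $1$ if $i\in Q$, $-1$ if $-i\in Q$, $0$ otherwise. The simplices $\mathrm{conv}(v_{Q_1},\dots,v_{Q_{r+1}})$ for chains $Q_1\subsetneq\cdots\subsetneq Q_{r+1}$ of admissible sets triangulate $\partial[-1,1]^n$; such an $r$-simplex is encoded as the ordered set partition $(P_1|\cdots|P_{r+2})$ of $[n]\cup-[n]$ with $P_1=Q_1$, $P_k=Q_k\setminus Q_{k-1}$ for $2\le k\le r+1$, and $P_{r+2}=([n]\cup-[n])\setminus Q_{r+1}$. The coloring complex $\Delta_G$ is the subcomplex of simplices contained in the union of the hyperplanes of $\mathcal B_G$. For $r\ge0$, $C_r(\Delta_G)$ is the complex vector space with basis the $r$-simplices of $\Delta_G$ (ordered partitions with $r+2$ blocks); $C_{-1}(\Delta_G)$ is spanned by the one-block partition (empty face). For $1\le i\le r+1$, $d_i(P_1|\cdots|P_{r+2})=(P_1|\cdots|P_{i-1}|P_i\cup P_{i+1}|P_{i+2}|\cdots|P_{r+2})$, and $\partial_r=\sum_{i=1}^{r+1}(-1)^{i-1}d_i$. Homology of this (augmented) complex is reduced homology. Hyperoctahedral group: $B_m$ is the group of permutations $\pi$ of $\{-m,\dots,m\}$ with $\pi(-i)=-\pi(i)$ (so $\pi(0)=0$); $B_0$ is trivial. $\mathrm{sgn}(\pi)=(-1)^{\ell(\pi)}$ where $\ell$ is Coxeter length with respect to the generators $s_0$ (exchanging $1,-1$) and $s_i=(i,i+1)(-i,-i-1)$,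 $1\le i\le m-1$. $\mathrm{des}(\pi)=\#\{i\in\{0,\dots,m-1\}:\pi(i)>\pi(i+1)\}$. $B_{r+1}$ acts linearly on $C_r(\Delta_G)$ by $\pi(P_1|\cdots|P_{r+2})=(P_{\pi^{-1}(1)}|\cdots|P_{\pi^{-1}(r+1)}|P')$, where $P_{-i}:=-P_i=\{-x:x\in P_i\}$ and $P'$ is the complement in $[n]\cup-[n]$ of the union of the first $r+1$ blocks. Type B Eulerian idempotents: $\tilde\rho_m^{(j)}\in\mathbb C[B_m]$ are defined by $\sum_{j=0}^m x^j\tilde\rho_m^{(j)}=\sum_{\pi\in B_m}\Big[\frac{\prod_{k=1}^m(x-2\mathrm{des}(\pi)+2k-1)}{2^m m!}\Big]\mathrm{sgn}(\pi)\pi$. Set $C_r^{(j)}(\Delta_G)=\tilde\rho_{r+1}^{(j)}C_r(\Delta_G)$; these form subcomplexes of $(C_*(\Delta_G),\partial_* )$, and $H_r^{(j)}(\Delta_G)$ denotes the homology of $(C_*^{(j)}(\Delta_G),\partial_* )$. *)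

theory Defs
  imports
    Complex_Main
    "HOL-Library.Multiset"
    "HOL-Library.FuncSet"
    "HOL-Library.Function_Algebras"
    "HOL-Combinatorics.Permutations"
    "HOL-Computational_Algebra.Polynomial"
begin

section \<open>Signed graphs and their chromatic polynomial\<close>

text \<open>
  The multiset of edges and half-edges is stored in three parts. Half-edges may be repeated. The
  edges of each sign are the edge set of a simple graph, hence are stored as a set, so that a pair
  \<open>{i, j}\<close> occurs at most twice, once with each sign.
\<close>

record signed_graph =
  half_edges :: "nat set multiset"
  pos_edges :: "nat set set"
  neg_edges :: "nat set set"

definition signed_graph_on :: "nat \<Rightarrow> signed_graph \<Rightarrow> bool" where
  "signed_graph_on n G \<longleftrightarrow>
     (\<forall>e\<in>#half_edges G. e \<subseteq> {1..n} \<and> card e = 1) \<and>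
     (\<forall>e\<in>pos_edges G. e \<subseteq> {1..n} \<and> card e = 2) \<and>
     (\<forall>e\<in>neg_edges G. e \<subseteq> {1..n} \<and> card e = 2)"

definition edge_multiset :: "signed_graph \<Rightarrow> nat set multiset" where
  "edge_multiset G = half_edges G + mset_set (pos_edges G) + mset_set (neg_edges G)"

definition proper_colorings :: "nat \<Rightarrow> signed_graph \<Rightarrow> nat \<Rightarrow> (nat \<Rightarrow> int) set" where
  "proper_colorings n G c =
     {\<phi> \<in> {1..n} \<rightarrow>\<^sub>E {- int c..int c}.
        (\<forall>i j. {i, j} \<in> pos_edges G \<longrightarrow> \<phi> i \<noteq> \<phi> j) \<and>
        (\<forall>i j. {i, j} \<in> neg_edges G \<longrightarrow> \<phi> i \<noteq> - \<phi> j) \<and>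
        (\<forall>i. {i} \<in># half_edges G \<longrightarrow> \<phi> i \<noteq> 0)}"

definition chromatic_poly :: "nat \<Rightarrow> signed_graph \<Rightarrow> real poly" where
  "chromatic_poly n G =
     (THE p. \<forall>c::nat. poly p (2 * real c + 1) = real (card (proper_colorings n G c)))"


section \<open>The coloring complex\<close>

text \<open>Points of \<open>\<real>\<^sup>n\<close> are functions that vanish outside \<open>{1..n}\<close>.\<close>

definition euclidean :: "nat \<Rightarrow> (nat \<Rightarrow> real) set" where
  "euclidean n = {x. \<forall>i. i \<notin> {1..n} \<longrightarrow> x i = 0}"

definition arrangement :: "nat \<Rightarrow> signed_graph \<Rightarrow> (nat \<Rightarrow> real) set set" where
  "arrangement n G =
     {{x \<in> euclidean n. x i = x j} | i j. {i, j} \<in> pos_edges G} \<union>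
     {{x \<in> euclidean n. x i = - x j} | i j. {i, j} \<in> neg_edges G} \<union>
     {{x \<in> euclidean n. x i = 0} | i. {i} \<in># half_edges G}"

definition ground :: "nat \<Rightarrow> int set" where
  "ground n = {- int n..int n} - {0}"

definition admissible :: "nat \<Rightarrow> int set \<Rightarrow> bool" where
  "admissible n Q \<longleftrightarrow> Q \<noteq> {} \<and> Q \<subseteq> ground n \<and> (\<forall>i\<in>Q. - i \<notin> Q)"

definition cube_vertex :: "int set \<Rightarrow> nat \<Rightarrow> real" where
  "cube_vertex Q i = (if int i \<in> Q then 1 else if - int i \<in> Q then - 1 else 0)"

definition flag :: "nat \<Rightarrow> int set list \<Rightarrow> bool" where
  "flag n Qs \<longleftrightarrow> (\<forall>Q\<in>set Qs. admissible n Q) \<and> sorted_wrt (\<subset>) Qs"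

text \<open>The convex hull of the vertices of a flag; it is empty for the empty flag.\<close>

definition flag_simplex :: "int set list \<Rightarrow> (nat \<Rightarrow> real) set" where
  "flag_simplex Qs =
     {\<lambda>i. \<Sum>k<length Qs. t k * cube_vertex (Qs ! k) i | t.
        (\<forall>k<length Qs. 0 \<le> t k) \<and> (\<Sum>k<length Qs. t k) = 1}"

text \<open>
  For \<open>Qs = [Q\<^sub>1, \<dots>, Q\<^sub>m]\<close> this is \<open>[Q\<^sub>1, Q\<^sub>2 - Q\<^sub>1, \<dots>, Q\<^sub>m - Q\<^sub>m\<^sub>-\<^sub>1, ground n - Q\<^sub>m]\<close>, and
  \<open>[ground n]\<close> for the empty flag.
\<close>

definition flag_partition :: "nat \<Rightarrow> int set list \<Rightarrow> int set list" where
  "flag_partition n Qs = map2 (\<lambda>A B. B - A) ({} # Qs) (Qs @ [ground n])"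

text \<open>
  The \<open>r\<close>-simplices of the coloring complex as ordered partitions with \<open>r + 2\<close> blocks. The degree
  \<open>r\<close> is an integer; \<open>r = -1\<close> gives the empty face, and there is nothing below.
\<close>

definition faces :: "nat \<Rightarrow> signed_graph \<Rightarrow> int \<Rightarrow> int set list set" where
  "faces n G r =
     {flag_partition n Qs | Qs.
        flag n Qs \<and> int (length Qs) = r + 1 \<and> flag_simplex Qs \<subseteq> \<Union> (arrangement n G)}"


section \<open>Chains\<close>

type_synonym chain = "int set list \<Rightarrow> complex"

definition basis_chain :: "int set list \<Rightarrow> chain" where
  "basis_chain P = (\<lambda>Q. if Q = P then 1 else 0)"

definition linear_extension :: "(int set list \<Rightarrow> chain) \<Rightarrow> chain \<Rightarrow> chain" where
  "linear_extension T f = (\<lambda>Q. \<Sum>P | f P \<noteq> 0. f P * T P Q)"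

definition chain_space :: "nat \<Rightarrow> signed_graph \<Rightarrow> int \<Rightarrow> chain set" where
  "chain_space n G r = {f. \<forall>P. f P \<noteq> 0 \<longrightarrow> P \<in> faces n G r}"

definition merge_blocks :: "nat \<Rightarrow> int set list \<Rightarrow> int set list" where
  "merge_blocks i P = take (i - 1) P @ [P ! (i - 1) \<union> P ! i] @ drop (i + 1) P"

definition boundary :: "chain \<Rightarrow> chain" where
  "boundary =
     linear_extension
       (\<lambda>P Q. \<Sum>i=1..length P - 1. (- 1) ^ (i - 1) * basis_chain (merge_blocks i P) Q)"


section \<open>The hyperoctahedral group and the Eulerian idempotents\<close>

definition hyperoctahedral :: "nat \<Rightarrow> (int \<Rightarrow> int) set" where
  "hyperoctahedral m =
     {\<pi>. \<pi> permutes {- int m..int m} \<and> (\<forall>i\<in>{- int m..int m}. \<pi> (- i) = - \<pi> i)}"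

definition coxeter_generator :: "nat \<Rightarrow> int \<Rightarrow> int" where
  "coxeter_generator i =
     (if i = 0 then transpose 1 (- 1)
      else transpose (int i) (int i + 1) \<circ> transpose (- int i) (- int i - 1))"

definition coxeter_length :: "nat \<Rightarrow> (int \<Rightarrow> int) \<Rightarrow> nat" where
  "coxeter_length m \<pi> =
     (LEAST l. \<exists>w. length w = l \<and> set w \<subseteq> {..<m} \<and>
        foldr (\<lambda>i \<rho>. coxeter_generator i \<circ> \<rho>) w id = \<pi>)"

definition descents :: "nat \<Rightarrow> (int \<Rightarrow> int) \<Rightarrow> nat" where
  "descents m \<pi> = card {i \<in> {0..<int m}. \<pi> i > \<pi> (i + 1)}"

text \<open>
  The coefficient of \<open>\<pi>\<close> in the \<open>j\<close>-th idempotent of the group algebra of \<open>hyperoctahedral m\<close>. It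
  vanishes for \<open>j > m\<close>, where the generating polynomial has no term.
\<close>

definition eulerian_coeff :: "nat \<Rightarrow> nat \<Rightarrow> (int \<Rightarrow> int) \<Rightarrow> complex" where
  "eulerian_coeff m j \<pi> =
     coeff (smult (1 / (2 ^ m * fact m))
       (\<Prod>k=1..m. [:- 2 * of_nat (descents m \<pi>) + 2 * of_nat k - 1, 1:])) j
     * (- 1) ^ coxeter_length m \<pi>"

definition signed_block :: "int set list \<Rightarrow> int \<Rightarrow> int set" where
  "signed_block P k = (if k > 0 then P ! (nat k - 1) else uminus ` (P ! (nat (- k) - 1)))"

definition act_partition :: "nat \<Rightarrow> (int \<Rightarrow> int) \<Rightarrow> int set list \<Rightarrow> int set list" where
  "act_partition n \<pi> P =
     (let Bs = map (\<lambda>k. signed_block P (inv \<pi> k)) [1..int (length P) - 1]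
      in Bs @ [ground n - \<Union> (set Bs)])"

definition eulerian_action :: "nat \<Rightarrow> nat \<Rightarrow> nat \<Rightarrow> chain \<Rightarrow> chain" where
  "eulerian_action n m j f =
     (\<lambda>Q. \<Sum>\<pi>\<in>hyperoctahedral m.
        eulerian_coeff m j \<pi> * linear_extension (\<lambda>P. basis_chain (act_partition n \<pi> P)) f Q)"

definition eulerian_chains :: "nat \<Rightarrow> signed_graph \<Rightarrow> nat \<Rightarrow> int \<Rightarrow> chain set" where
  "eulerian_chains n G j r = eulerian_action n (nat (r + 1)) j ` chain_space n G r"


section \<open>Homology\<close>

text \<open>
  A basis of a quotient space \<open>V / W\<close> is given by representatives: each class in \<open>V / W\<close> is a
  unique linear combination of the classes of the elements of \<open>S\<close>.
\<close>

locale quotient_vector_space = vector_space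
begin

definition quotient_basis :: "'b set \<Rightarrow> 'b set \<Rightarrow> 'b set \<Rightarrow> bool" where
  "quotient_basis V W S \<longleftrightarrow>
     finite S \<and> S \<subseteq> V \<and> (\<forall>v\<in>V. \<exists>!a. a \<in> extensional S \<and> v - (\<Sum>s\<in>S. a s *s s) \<in> W)"

definition quotient_dim :: "'b set \<Rightarrow> 'b set \<Rightarrow> nat" where
  "quotient_dim V W = (THE d. \<exists>S. quotient_basis V W S \<and> card S = d)"

lemma quotient_basis_card:
  assumes V: "subspace V" and W: "subspace W" "W \<subseteq> V"
    and F: "finite F" "V \<subseteq> span F" and S: "quotient_basis V W S"
  shows "card S + dim W = dim V"
proof -
  obtain A where A: "A \<subseteq> W" "independent A" "W \<subseteq> span A" "card A = dim W"
    by (rule basis_exists)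
  have finA: "finite A"
    using independent_span_bound[OF F(1) A(2)] A(1) W(2) F(2) by blast
  have spanA: "span A = W"
    using A(1,3) W(1) by (simp add: span_subspace)
  have finS: "finite S" and SV: "S \<subseteq> V"
    and ex: "\<And>v. v \<in> V \<Longrightarrow> \<exists>!a. a \<in> extensional S \<and> v - (\<Sum>s\<in>S. a s *s s) \<in> W"
    using S unfolding quotient_basis_def by auto
  have zero: "b s = 0" if b: "(\<Sum>s\<in>S. b s *s s) \<in> W" and s: "s \<in> S" for b s
  proof -
    have "restrict b S \<in> extensional S \<and> 0 - (\<Sum>s\<in>S. restrict b S s *s s) \<in> W"
      using subspace_neg[OF W(1) b] by (simp cong: sum.cong)
    moreover have "restrict (\<lambda>_. 0) S \<in> extensional S \<and>
        0 - (\<Sum>s\<in>S. restrict (\<lambda>_. 0) S s *s s) \<in> W"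
      using subspace_0[OF W(1)] by (simp cong: sum.cong)
    ultimately have "restrict b S = restrict (\<lambda>_. 0) S"
      using ex[OF subspace_0[OF V]] by blast
    then have "restrict b S s = restrict (\<lambda>_. 0) S s" by simp
    then show ?thesis using s by simp
  qed
  have disj: "A \<inter> S = {}"
  proof (rule ccontr)
    assume "A \<inter> S \<noteq> {}"
    then obtain x where x: "x \<in> A" "x \<in> S" by blast
    have "(\<Sum>s\<in>S. (if s = x then 1 else 0) *s s) = (\<Sum>s\<in>S. if s = x then s else 0)"
      by (rule sum.cong) auto
    also have "\<dots> = x" using finS x(2) by simp
    finally have "(\<Sum>s\<in>S. (if s = x then 1 else 0) *s s) \<in> W" using x A(1) by auto
    from zero[OF this x(2)] show False by simp
  qed
  have ind: "independent (A \<union> S)"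
  proof (rule independent_if_scalars_zero)
    show "finite (A \<union> S)" using finA finS by simp
  next
    fix f x
    assume eq: "(\<Sum>x\<in>A \<union> S. f x *s x) = 0" and x: "x \<in> A \<union> S"
    have split: "(\<Sum>x\<in>A. f x *s x) + (\<Sum>x\<in>S. f x *s x) = 0"
      using eq finA finS disj by (simp add: sum.union_disjoint)
    have "(\<Sum>x\<in>A. f x *s x) \<in> W"
      using A(1) W(1) by (intro subspace_sum subspace_scale) auto
    moreover have "(\<Sum>x\<in>S. f x *s x) = - (\<Sum>x\<in>A. f x *s x)"
      using split by (simp add: add.commute eq_neg_iff_add_eq_0)
    ultimately have "(\<Sum>x\<in>S. f x *s x) \<in> W"
      using subspace_neg[OF W(1)] by metis
    then have S0: "\<And>s. s \<in> S \<Longrightarrow> f s = 0" using zero by blast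
    then have "(\<Sum>x\<in>A. f x *s x) = 0" using split by (simp cong: sum.cong)
    then have "\<And>s. s \<in> A \<Longrightarrow> f s = 0"
      using independentD[OF A(2) finA subset_refl] by blast
    then show "f x = 0" using S0 x by blast
  qed
  have "V \<subseteq> span (A \<union> S)"
  proof
    fix v assume "v \<in> V"
    then obtain a where a: "v - (\<Sum>s\<in>S. a s *s s) \<in> W" using ex by blast
    have "v - (\<Sum>s\<in>S. a s *s s) \<in> span (A \<union> S)"
      using a spanA span_mono[of A "A \<union> S"] by auto
    moreover have "(\<Sum>s\<in>S. a s *s s) \<in> span (A \<union> S)"
      by (intro span_sum span_scale span_base) auto
    ultimately have "(v - (\<Sum>s\<in>S. a s *s s)) + (\<Sum>s\<in>S. a s *s s) \<in> span (A \<union> S)"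
      by (rule span_add)
    then show "v \<in> span (A \<union> S)" by simp
  qed
  moreover have "A \<union> S \<subseteq> V" using A(1) W(2) SV by blast
  ultimately have "card (A \<union> S) = dim V" using ind by (intro basis_card_eq_dim)
  then show ?thesis using A(4) card_Un_disjoint[OF finA finS disj] by simp
qed

lemma quotient_basis_exists:
  assumes V: "subspace V" and W: "subspace W" "W \<subseteq> V" and F: "finite F" "V \<subseteq> span F"
  shows "\<exists>S. quotient_basis V W S"
proof -
  obtain A where A: "A \<subseteq> W" "independent A" "W \<subseteq> span A"
    by (rule maximal_independent_subset)
  have "A \<subseteq> V" using A(1) W(2) by blast
  then obtain B where B: "A \<subseteq> B" "B \<subseteq> V" "independent B" "V \<subseteq> span B"
    using maximal_independent_subset_extend[OF _ A(2)] by metis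
  have finB: "finite B"
    using independent_span_bound[OF F(1) B(3)] B(2) F(2) by blast
  have finA: "finite A" using finite_subset[OF B(1) finB] .
  have spanA: "span A = W" using A(1,3) W(1) by (simp add: span_subspace)
  have spanB: "span B = V" using B(2,4) V by (simp add: span_subspace)
  have "quotient_basis V W (B - A)"
    unfolding quotient_basis_def
  proof (intro conjI ballI)
    show "finite (B - A)" "B - A \<subseteq> V" using finB B(2) by auto
  next
    fix v assume "v \<in> V"
    then obtain u where u: "v = (\<Sum>b\<in>B. u b *s b)"
      using spanB span_finite[OF finB] by auto
    have split: "(\<Sum>b\<in>B. g b *s b) = (\<Sum>b\<in>B - A. g b *s b) + (\<Sum>b\<in>A. g b *s b)" for g
      using sum.subset_diff[OF B(1) finB] .
    have inW: "(\<Sum>b\<in>A. g b *s b) \<in> W" for g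
      using A(1) W(1) by (intro subspace_sum subspace_scale) auto
    show "\<exists>!a. a \<in> extensional (B - A) \<and> v - (\<Sum>s\<in>B - A. a s *s s) \<in> W"
    proof (rule ex1I[of _ "restrict u (B - A)"])
      have "(\<Sum>s\<in>B - A. restrict u (B - A) s *s s) = (\<Sum>s\<in>B - A. u s *s s)"
        by (rule sum.cong) auto
      then show "restrict u (B - A) \<in> extensional (B - A) \<and>
          v - (\<Sum>s\<in>B - A. restrict u (B - A) s *s s) \<in> W"
        using split[of u] u inW[of u] by (simp del: restrict_apply)
    next
      fix a assume a: "a \<in> extensional (B - A) \<and> v - (\<Sum>s\<in>B - A. a s *s s) \<in> W"
      then obtain w where w: "v - (\<Sum>s\<in>B - A. a s *s s) = (\<Sum>b\<in>A. w b *s b)"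
        using spanA span_finite[OF finA] by auto
      define g where "g b = (if b \<in> A then w b else a b)" for b
      have "(\<Sum>b\<in>B. g b *s b) = (\<Sum>b\<in>B - A. a b *s b) + (\<Sum>b\<in>A. w b *s b)"
        unfolding split[of g] by (intro arg_cong2[of _ _ _ _ "(+)"] sum.cong) (auto simp: g_def)
      also have "\<dots> = v" using w by (metis add.commute diff_add_cancel)
      finally have "(\<Sum>b\<in>B. (g b - u b) *s b) = 0"
        using u by (simp add: scale_left_diff_distrib sum_subtractf)
      then have "\<And>b. b \<in> B \<Longrightarrow> g b - u b = 0"
        using independentD[OF B(3) finB subset_refl, of "\<lambda>b. g b - u b"] by blast
      then have "\<And>b. b \<in> B - A \<Longrightarrow> a b = u b" by (force simp: g_def)
      then show "a = restrict u (B - A)"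
        using a by (intro ext) (auto simp: extensional_def)
    qed
  qed
  then show ?thesis ..
qed

lemma quotient_dim_eq:
  assumes "subspace V" "subspace W" "W \<subseteq> V" "finite F" "V \<subseteq> span F"
  shows "quotient_dim V W = dim V - dim W"
proof -
  obtain S where S: "quotient_basis V W S" using quotient_basis_exists[OF assms] by blast
  show ?thesis
    unfolding quotient_dim_def
  proof (rule the_equality)
    show "\<exists>S. quotient_basis V W S \<and> card S = dim V - dim W"
      using S quotient_basis_card[OF assms S] by (intro exI[of _ S]) simp
  next
    fix d assume "\<exists>S. quotient_basis V W S \<and> card S = d"
    then obtain T where "quotient_basis V W T" "card T = d" by blast
    then show "d = dim V - dim W" using quotient_basis_card[OF assms] by force
  qed
qed

end

definition chain_scale :: "complex \<Rightarrow> chain \<Rightarrow> chain" where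
  "chain_scale a f = (\<lambda>P. a * f P)"

global_interpretation chain: quotient_vector_space chain_scale
  by unfold_locales (auto simp: chain_scale_def fun_eq_iff algebra_simps)

definition eulerian_cycles :: "nat \<Rightarrow> signed_graph \<Rightarrow> nat \<Rightarrow> int \<Rightarrow> chain set" where
  "eulerian_cycles n G j r = {f \<in> eulerian_chains n G j r. boundary f = 0}"

definition eulerian_boundaries :: "nat \<Rightarrow> signed_graph \<Rightarrow> nat \<Rightarrow> int \<Rightarrow> chain set" where
  "eulerian_boundaries n G j r = boundary ` eulerian_chains n G j (r + 1)"

definition homology_dim :: "nat \<Rightarrow> signed_graph \<Rightarrow> nat \<Rightarrow> int \<Rightarrow> nat" where
  "homology_dim n G j r = chain.quotient_dim (eulerian_cycles n G j r) (eulerian_boundaries n G j r)"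

end

theory Submission
  imports Defs "HOL-Library.Product_Lexorder"
begin

text \<open>
  Evaluated at an odd number \<open>2 c + 1\<close>, the generating polynomial of the type B Eulerian idempotents
  becomes an Adams operation: it sums, over all labellings of the blocks of a face by
  \<open>{- c, \<dots>, c}\<close>, the signed rearrangement that sorts the blocks by label. Insertion sort shows that
  Adams operations commute with the boundary, and comparing digits in base \<open>2 a + 1\<close> shows that
  they compose multiplicatively; hence the coefficients are orthogonal idempotents that split the
  chain complex. The hyperoctahedral group acts freely on faces, so the rank of an idempotent, being
  its trace, is the number of faces times its coefficient at the identity.

  The coloring complex is a union of spheres cut out by hyperplanes; by Mayer-Vietoris its
  reduced homology vanishes below the top degree. The dimensions of the top Eulerian homology are
  therefore Euler characteristics, and the resulting polynomial in the face numbers is, at negative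
  odd arguments, the count of improper colorings: a face with \<open>m\<close> blocks is the level set
  partition of exactly \<open>c choose m\<close> colorings.
\<close>

section \<open>Order complexes\<close>

text \<open>The idempotents of different degrees live in different groups and mix descent numbers
  with Coxeter signs, which hides both their products and their relation to the boundary. A range of
  labels, by contrast, serves words of all lengths, so both become identities between sums over
  labellings. They hold at every odd number 2c+1 and therefore coefficient by coefficient. Splitting
  a block commutes with sorting when both halves carry the same label; all other labellings cancel
  in pairs, since exchanging adjacent letters with distinct labels reverses the sign. The final
  count rests on reciprocity: the coefficient at the identity is (x+1)(x+3)...(x+2m-1)/(2^m m!),
  whose value at -(2c+1) is (-1)^m times c choose m, and this sign cancels the alternation of the
  Euler characteristic. No face has n blocks before its last one, because these would be singletons
  that separate the ends of every edge; so the top homology consists of all top cycles.\<close>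

definition order_complex :: "'a::order set \<Rightarrow> 'a set set" where
  "order_complex F = {Y. finite Y \<and> Y \<subseteq> F \<and> (\<forall>x\<in>Y. \<forall>y\<in>Y. x \<le> y \<or> y \<le> x)}"

text \<open>The sign of the face map that deletes \<open>q\<close> again: its exponent is the place
  of \<open>q\<close> in the chain, counted from 0.\<close>

definition insert_sign :: "'a::order \<Rightarrow> 'a set \<Rightarrow> complex" where
  "insert_sign q Y = (- 1) ^ card {y\<in>Y. y < q}"

text \<open>Chains are functions on simplices, so the boundary is given by its coefficients, as a
  sum over cofaces. The vertex set \<open>U\<close> stays fixed, so that one operator serves every
  subcomplex.\<close>

definition bdry :: "'a::order set \<Rightarrow> ('a set \<Rightarrow> complex) \<Rightarrow> 'a set \<Rightarrow> complex" where
  "bdry U f Y = (\<Sum>q\<in>U - Y. insert_sign q Y * f (insert q Y))"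

definition supp_on :: "'a set set \<Rightarrow> nat \<Rightarrow> ('a set \<Rightarrow> complex) \<Rightarrow> bool" where
  "supp_on K k f \<longleftrightarrow> (\<forall>Y. f Y \<noteq> 0 \<longrightarrow> Y \<in> K \<and> card Y = k)"

text \<open>Here \<open>k\<close> counts vertices, so the homological degree is
  \<open>k - 1\<close>. The empty simplex belongs to every order complex, which makes the homology
  reduced.\<close>

definition acyclic_at :: "'a::order set \<Rightarrow> 'a set set \<Rightarrow> nat \<Rightarrow> bool" where
  "acyclic_at U K k \<longleftrightarrow>
     (\<forall>f. supp_on K k f \<and> bdry U f = (\<lambda>_. 0) \<longrightarrow> (\<exists>g. supp_on K (Suc k) g \<and> bdry U g = f))"

lemma insert_sign_square [simp]: "insert_sign q Y * insert_sign q Y = 1"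
  by (simp add: insert_sign_def flip: power_add mult_2)

lemma insert_sign_insert:
  assumes "finite Y" "q \<notin> Y"
  shows "insert_sign p (insert q Y) = (if q < p then - insert_sign p Y else insert_sign p Y)"
proof (cases "q < p")
  case True
  then have "{y \<in> insert q Y. y < p} = insert q {y \<in> Y. y < p}" by auto
  then show ?thesis using True assms by (simp add: insert_sign_def)
next
  case False
  then have "{y \<in> insert q Y. y < p} = {y \<in> Y. y < p}" by auto
  then show ?thesis using False by (simp add: insert_sign_def)
qed

lemma order_complex_subset: "Y \<in> order_complex F \<Longrightarrow> X \<subseteq> Y \<Longrightarrow> X \<in> order_complex F"
  by (auto simp: order_complex_def intro: finite_subset)

lemma order_complex_mono: "F \<subseteq> F' \<Longrightarrow> order_complex F \<subseteq> order_complex F'"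
  by (auto simp: order_complex_def)

lemma order_complex_Int: "order_complex F \<inter> order_complex F' = order_complex (F \<inter> F')"
  by (auto simp: order_complex_def)

lemma bdry_add: "bdry U (\<lambda>Y. f Y + g Y) = (\<lambda>Y. bdry U f Y + bdry U g Y)"
  by (rule ext) (simp add: bdry_def sum.distrib algebra_simps)

lemma bdry_diff: "bdry U (\<lambda>Y. f Y - g Y) = (\<lambda>Y. bdry U f Y - bdry U g Y)"
  by (rule ext) (simp add: bdry_def sum_subtractf algebra_simps)

text \<open>The two orders of adding vertices \<open>p\<close> and \<open>q\<close> differ in sign,
  since exactly one of \<open>p\<close> and \<open>q\<close> counts the other among its
  predecessors.\<close>

lemma bdry_bdry:
  assumes U: "finite U" and f: "supp_on (order_complex U) k f"
  shows "bdry U (bdry U f) = (\<lambda>_. 0)"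
proof
  fix Y
  show "bdry U (bdry U f) Y = 0"
  proof (cases "Y \<subseteq> U")
    case False
    then have "insert p (insert q Y) \<notin> order_complex U" for p q by (auto simp: order_complex_def)
    then have "f (insert p (insert q Y)) = 0" for p q using f by (auto simp: supp_on_def)
    then show ?thesis by (simp add: bdry_def)
  next
    case True
    then have fin: "finite Y" using U finite_subset by blast
    define t where "t p q = insert_sign p Y * (insert_sign q (insert p Y) * f (insert q (insert p Y)))"
      for p q
    have eq: "bdry U (bdry U f) Y = (\<Sum>p\<in>U - Y. \<Sum>q\<in>U - Y. if p = q then 0 else t p q)"
      unfolding bdry_def sum_distrib_left t_def
    proof (rule sum.cong[OF refl], rule sum.mono_neutral_cong_left)
    qed (use U in auto)
    have anti: "t p q = - t q p" if "p \<in> U - Y" "q \<in> U - Y" "p \<noteq> q" for p q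
    proof (cases "f (insert q (insert p Y)) = 0")
      case True then show ?thesis by (simp add: t_def insert_commute)
    next
      case False
      \<comment> \<open>A nonzero term makes \<open>p\<close> and \<open>q\<close> comparable, which
        the partial order alone does not give.\<close>
      then have "insert q (insert p Y) \<in> order_complex U" using f by (auto simp: supp_on_def)
      then have "p < q \<or> q < p" using that by (auto simp: order_complex_def order_less_le)
      then show ?thesis using that fin
        by (auto simp: t_def insert_sign_insert insert_commute dest: order.asym)
    qed
    have "(\<Sum>p\<in>U - Y. \<Sum>q\<in>U - Y. if p = q then 0 else t p q)
        = (\<Sum>p\<in>U - Y. \<Sum>q\<in>U - Y. if q = p then 0 else t q p)"
      by (rule sum.swap)
    also have "\<dots> = (\<Sum>p\<in>U - Y. \<Sum>q\<in>U - Y. - (if p = q then 0 else t p q))"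
    proof (intro sum.cong refl)
      fix p q assume "p \<in> U - Y" "q \<in> U - Y"
      then show "(if q = p then 0 else t q p) = - (if p = q then 0 else t p q)"
        using anti[of q p] by (cases "p = q") auto
    qed
    also have "\<dots> = - (\<Sum>p\<in>U - Y. \<Sum>q\<in>U - Y. if p = q then 0 else t p q)"
      by (simp add: sum_negf)
    finally show ?thesis using eq by simp
  qed
qed

lemma supp_on_bdry:
  assumes "supp_on K (Suc k) f" "\<And>X Y. Y \<in> K \<Longrightarrow> X \<subseteq> Y \<Longrightarrow> X \<in> K" "\<And>Y. Y \<in> K \<Longrightarrow> finite Y"
  shows "supp_on K k (bdry U f)"
  unfolding supp_on_def
proof (intro allI impI)
  fix Y assume "bdry U f Y \<noteq> 0"
  then obtain q where q: "q \<in> U - Y" "f (insert q Y) \<noteq> 0"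
    unfolding bdry_def by (auto elim: sum.not_neutral_contains_not_neutral)
  then have "insert q Y \<in> K" "card (insert q Y) = Suc k" using assms(1) by (auto simp: supp_on_def)
  moreover from this have "finite Y" using assms(3) by fastforce
  ultimately show "Y \<in> K \<and> card Y = k" using assms(2)[of "insert q Y" Y] q by auto
qed

lemma supp_on_add: "supp_on K k f \<Longrightarrow> supp_on K k g \<Longrightarrow> supp_on K k (\<lambda>Y. f Y + g Y)"
  unfolding supp_on_def by (metis add.right_neutral)

lemma supp_on_diff: "supp_on K k f \<Longrightarrow> supp_on K k g \<Longrightarrow> supp_on K k (\<lambda>Y. f Y - g Y)"
  unfolding supp_on_def by (metis diff_zero)

lemma supp_on_mono: "supp_on K k f \<Longrightarrow> K \<subseteq> L \<Longrightarrow> supp_on L k f"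
  unfolding supp_on_def by blast

text \<open>The Mayer-Vietoris argument on chains. The cycle is cut into a part in \<open>K\<close>
  and a rest in \<open>L\<close>; their boundaries agree up to sign, so they lie in the intersection
  and can be filled there by \<open>w\<close>, which corrects both parts to cycles.\<close>

lemma acyclic_at_Un:
  assumes U: "finite U" and K: "K \<subseteq> order_complex U" "L \<subseteq> order_complex U"
    and down: "\<And>X Y. Y \<in> K \<Longrightarrow> X \<subseteq> Y \<Longrightarrow> X \<in> K" "\<And>X Y. Y \<in> L \<Longrightarrow> X \<subseteq> Y \<Longrightarrow> X \<in> L"
    and ac: "acyclic_at U K k" "acyclic_at U L k"
    and ne: "K \<noteq> {}" and int: "\<And>l. k = Suc l \<Longrightarrow> acyclic_at U (K \<inter> L) l"
  shows "acyclic_at U (K \<union> L) k"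
  unfolding acyclic_at_def
proof (intro allI impI, elim conjE)
  fix f assume f: "supp_on (K \<union> L) k f" and cyc: "bdry U f = (\<lambda>_. 0)"
  have fin: "finite Y" if "Y \<in> K \<union> L" for Y using that K by (auto simp: order_complex_def)
  show "\<exists>g. supp_on (K \<union> L) (Suc k) g \<and> bdry U g = f"
  proof (cases k)
    \<comment> \<open>With no vertices the only simplex is the empty one, which already lies in
      \<open>K\<close>, and there is no lower degree of the intersection to appeal to.\<close>
    case 0
    have "{} \<in> K" using ne down(1) by blast
    then have "supp_on K k f" using f 0 fin by (auto simp: supp_on_def)
    then obtain g where "supp_on K (Suc k) g" "bdry U g = f"
      using ac(1) cyc by (auto simp: acyclic_at_def)
    then show ?thesis by (auto simp: supp_on_def)
  next
    case (Suc l)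
    define f1 where "f1 Y = (if Y \<in> K then f Y else 0)" for Y
    define f2 where "f2 Y = (if Y \<in> K then 0 else f Y)" for Y
    have f12: "f = (\<lambda>Y. f1 Y + f2 Y)" by (auto simp: f1_def f2_def)
    have s1: "supp_on K k f1" and s2: "supp_on L k f2"
      using f by (auto simp: supp_on_def f1_def f2_def)
    have b12: "bdry U f1 Y = - bdry U f2 Y" for Y
      using fun_cong[OF cyc, of Y] unfolding f12 bdry_add by (simp add: eq_neg_iff_add_eq_0)
    have "supp_on K l (bdry U f1)" "supp_on L l (bdry U f2)"
      using s1 s2 Suc down fin by (auto intro!: supp_on_bdry)
    then have "supp_on (K \<inter> L) l (bdry U f1)" using b12 by (auto simp: supp_on_def)
    moreover have "bdry U (bdry U f1) = (\<lambda>_. 0)"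
      using bdry_bdry[OF U, of k f1] s1 K by (auto simp: supp_on_def)
    ultimately obtain w where w: "supp_on (K \<inter> L) k w" "bdry U w = bdry U f1"
      using int[OF Suc] Suc by (auto simp: acyclic_at_def)
    have "supp_on K k (\<lambda>Y. f1 Y - w Y)" "bdry U (\<lambda>Y. f1 Y - w Y) = (\<lambda>_. 0)"
      using s1 w by (auto simp: bdry_diff intro!: supp_on_diff intro: supp_on_mono)
    then obtain g1 where g1: "supp_on K (Suc k) g1" "bdry U g1 = (\<lambda>Y. f1 Y - w Y)"
      using ac(1) unfolding acyclic_at_def by blast
    have "supp_on L k (\<lambda>Y. f2 Y + w Y)" "bdry U (\<lambda>Y. f2 Y + w Y) = (\<lambda>_. 0)"
      using s2 w b12 by (auto simp: bdry_add intro!: supp_on_add intro: supp_on_mono)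
    then obtain g2 where g2: "supp_on L (Suc k) g2" "bdry U g2 = (\<lambda>Y. f2 Y + w Y)"
      using ac(2) unfolding acyclic_at_def by blast
    show ?thesis
    proof (intro exI conjI)
      show "supp_on (K \<union> L) (Suc k) (\<lambda>Y. g1 Y + g2 Y)"
        using g1(1) g2(1) by (auto intro!: supp_on_add intro: supp_on_mono)
      show "bdry U (\<lambda>Y. g1 Y + g2 Y) = f" by (simp add: bdry_add g1 g2 f12)
    qed
  qed
qed

text \<open>An element comparable to all others is a cone apex, and coning a cycle with it gives a
  filling.\<close>

lemma acyclic_at_cone:
  assumes U: "finite U" "F \<subseteq> U" and x: "x \<in> F" "\<And>y. y \<in> F \<Longrightarrow> x \<le> y \<or> y \<le> x"
  shows "acyclic_at U (order_complex F) k"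
  unfolding acyclic_at_def
proof (intro allI impI, elim conjE)
  fix f assume f: "supp_on (order_complex F) k f" and cyc: "bdry U f = (\<lambda>_. 0)"
  define g where "g Y = (if x \<in> Y then insert_sign x (Y - {x}) * f (Y - {x}) else 0)" for Y
  have f0: "f Y = 0" if "Y \<notin> order_complex F" for Y using f that by (auto simp: supp_on_def)
  show "\<exists>g. supp_on (order_complex F) (Suc k) g \<and> bdry U g = f"
  proof (intro exI conjI)
    show "supp_on (order_complex F) (Suc k) g"
      unfolding supp_on_def
    proof (intro allI impI)
      fix Y assume "g Y \<noteq> 0"
      then have xY: "x \<in> Y" and "f (Y - {x}) \<noteq> 0" by (auto simp: g_def split: if_splits)
      then have Y: "Y - {x} \<in> order_complex F" "card (Y - {x}) = k" using f by (auto simp: supp_on_def)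
      then have "finite Y" by (auto simp: order_complex_def)
      moreover have "Y \<in> order_complex F"
      proof -
        have "Y \<subseteq> F" using Y x(1) by (auto simp: order_complex_def)
        moreover have "a \<le> b \<or> b \<le> a" if "a \<in> Y" "b \<in> Y" for a b
          using that Y x(2) \<open>Y \<subseteq> F\<close> by (cases "a = x"; cases "b = x") (auto simp: order_complex_def)
        ultimately show ?thesis using \<open>finite Y\<close> by (auto simp: order_complex_def)
      qed
      ultimately show "Y \<in> order_complex F \<and> card Y = Suc k"
        using Y xY by (metis card.remove)
    qed
    show "bdry U g = f"
    proof
      fix Y
      show "bdry U g Y = f Y"
      proof (cases "x \<in> Y")
        case False
        have "bdry U g Y = (\<Sum>q\<in>U - Y. if q = x then f Y else 0)"
          unfolding bdry_def
        proof (rule sum.cong[OF refl])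
          fix q assume "q \<in> U - Y"
          then show "insert_sign q Y * g (insert q Y) = (if q = x then f Y else 0)"
            using False by (auto simp: g_def mult.assoc[symmetric])
        qed
        also have "\<dots> = f Y" using U x(1) False by auto
        finally show ?thesis .
      next
        case True
        \<comment> \<open>On a simplex that contains the apex, the value of \<open>f\<close> is
          recovered from the cycle condition at the face opposite to the apex.\<close>
        define Z where "Z = Y - {x}"
        have Y: "Y = insert x Z" "x \<notin> Z" using True by (auto simp: Z_def)
        have xU: "x \<in> U - Z" using x U Y by auto
        have "(\<Sum>q\<in>U - Z. insert_sign q Z * f (insert q Z)) = 0"
          using fun_cong[OF cyc, of Z] by (simp add: bdry_def)
        then have z: "insert_sign x Z * f Y + (\<Sum>q\<in>U - Y. insert_sign q Z * f (insert q Z)) = 0"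
          using sum.remove[OF _ xU, of "\<lambda>q. insert_sign q Z * f (insert q Z)"] U(1)
          by (simp add: Y Diff_insert[of U x Z])
        have "bdry U g Y = (\<Sum>q\<in>U - Y. - (insert_sign x Z * (insert_sign q Z * f (insert q Z))))"
          unfolding bdry_def
        proof (rule sum.cong[OF refl])
          fix q assume q: "q \<in> U - Y"
          have g: "g (insert q Y) = insert_sign x (insert q Z) * f (insert q Z)"
            using q Y by (auto simp: g_def insert_Diff_if)
          show "insert_sign q Y * g (insert q Y) = - (insert_sign x Z * (insert_sign q Z * f (insert q Z)))"
          proof (cases "f (insert q Z) = 0")
            case False
            then have "insert q Z \<in> order_complex F" using f0 by blast
            then have "q \<in> F" "finite Z" by (auto simp: order_complex_def)
            then have "x < q \<or> q < x" using x(2) q Y by (auto simp: order_less_le)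
            then show ?thesis using q Y \<open>finite Z\<close> unfolding g
              by (auto simp: insert_sign_insert dest: order.asym)
          qed (simp add: g)
        qed
        also have "\<dots> = - insert_sign x Z * (\<Sum>q\<in>U - Y. insert_sign q Z * f (insert q Z))"
          by (simp add: sum_distrib_left sum_negf)
        also have "\<dots> = - insert_sign x Z * - (insert_sign x Z * f Y)"
          using z by (metis add_eq_0_iff)
        also have "\<dots> = f Y" by (simp add: mult.assoc[symmetric])
        finally show ?thesis .
      qed
    qed
  qed
qed

text \<open>A new vertex attaches its star along its link. The link is a cone with apex
  \<open>z\<close>, so Mayer-Vietoris keeps the complex acyclic.\<close>

lemma acyclic_at_insert:
  assumes U: "finite U" "F \<subseteq> U" "q \<in> U" and ac: "\<And>k. acyclic_at U (order_complex F) k"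
    and z: "z \<in> F" "q \<le> z \<or> z \<le> q"
      "\<And>y. y \<in> F \<Longrightarrow> y \<le> q \<or> q \<le> y \<Longrightarrow> y \<le> z \<or> z \<le> y"
  shows "acyclic_at U (order_complex (insert q F)) k"
proof -
  let ?S = "{y\<in>F. y \<le> q \<or> q \<le> y}"
  have sub: "order_complex (insert q F) \<subseteq> order_complex F \<union> order_complex (insert q ?S)"
    by (auto simp: order_complex_def)
  have Un: "order_complex (insert q F) = order_complex F \<union> order_complex (insert q ?S)"
    using sub order_complex_mono[of F "insert q F"] order_complex_mono[of "insert q ?S" "insert q F"]
    by blast
  have int: "acyclic_at U (order_complex F \<inter> order_complex (insert q ?S)) l" for l
    unfolding order_complex_Int by (rule acyclic_at_cone[where x = z]) (use U z in auto)
  have star: "acyclic_at U (order_complex (insert q ?S)) k"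
    by (rule acyclic_at_cone[where x = q]) (use U in auto)
  have "insert q ?S \<subseteq> U" using U by auto
  then have sub: "order_complex F \<subseteq> order_complex U" "order_complex (insert q ?S) \<subseteq> order_complex U"
    using order_complex_mono U(2) by blast+
  have ne: "order_complex F \<noteq> {}" by (auto simp: order_complex_def)
  show ?thesis unfolding Un
    by (rule acyclic_at_Un[OF U(1) sub _ _ ac star ne int])
      (erule (1) order_complex_subset)+
qed

section \<open>Type B arrangements\<close>

text \<open>
  An odd labelling \<open>l\<close> of the ground set encodes the flat on which coordinates with equal labels
  agree; label 0 forces a coordinate to vanish.
\<close>

definition flat_sets :: "nat \<Rightarrow> (int \<Rightarrow> int) \<Rightarrow> int set set" where
  "flat_sets n l = {Q. admissible n Q \<and> (\<forall>x\<in>ground n. \<forall>y\<in>ground n. l x = l y \<longrightarrow> (x \<in> Q \<longleftrightarrow> y \<in> Q))}"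

text \<open>The dimension of the flat: one free coordinate for each pair of opposite nonzero
  labels.\<close>

definition flat_dim :: "nat \<Rightarrow> (int \<Rightarrow> int) \<Rightarrow> nat" where
  "flat_dim n l = card {a. 0 < a \<and> a \<in> l ` ground n}"

definition odd_map :: "(int \<Rightarrow> int) \<Rightarrow> bool" where
  "odd_map l \<longleftrightarrow> (\<forall>x. l (- x) = - l x)"

text \<open>The vertex of \<open>Q\<close> lies on the hyperplane where the coordinates at
  \<open>fst e\<close> and \<open>snd e\<close> agree, with the convention that the coordinate at
  \<open>- i\<close> is minus that at \<open>i\<close>. A half-edge at \<open>i\<close> becomes the
  pair of \<open>i\<close> and \<open>- i\<close>.\<close>

definition collapses :: "int \<times> int \<Rightarrow> int set \<Rightarrow> bool" where
  "collapses e Q \<longleftrightarrow> (fst e \<in> Q \<longleftrightarrow> snd e \<in> Q) \<and> (- fst e \<in> Q \<longleftrightarrow> - snd e \<in> Q)"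

lemma ground_uminus [simp]: "- x \<in> ground n \<longleftrightarrow> x \<in> ground n"
  by (auto simp: ground_def)

lemma finite_ground [simp]: "finite (ground n)"
  by (simp add: ground_def)

lemma finite_admissible [simp]: "finite {Q. admissible n Q}"
  by (rule finite_subset[of _ "Pow (ground n)"]) (auto simp: admissible_def)

lemma flat_sets_admissible: "flat_sets n l \<subseteq> {Q. admissible n Q}"
  by (auto simp: flat_sets_def)

lemma flat_sets_iff:
  "Q \<in> flat_sets n l \<Longrightarrow> x \<in> ground n \<Longrightarrow> y \<in> ground n \<Longrightarrow> l x = l y \<Longrightarrow> x \<in> Q \<longleftrightarrow> y \<in> Q"
  unfolding flat_sets_def by blast

text \<open>A hyperplane either contains the flat or cuts it in a flat of one dimension less. On
  labels, the cut identifies the label of \<open>i\<close> with that of \<open>j\<close>, and the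
  two negatives with each other.\<close>

lemma collapse_flat:
  assumes l: "odd_map l" and e: "i \<in> ground n" "j \<in> ground n"
  shows "\<exists>l'. odd_map l' \<and> flat_sets n l' = flat_sets n l \<inter> {Q. collapses (i, j) Q} \<and>
    flat_dim n l \<le> Suc (flat_dim n l')"
proof -
  have step: "\<exists>l'. odd_map l' \<and> flat_sets n l' = flat_sets n l \<inter> {Q. collapses (i, j) Q} \<and>
      flat_dim n l \<le> Suc (flat_dim n l')"
    if ij: "i \<in> ground n" "j \<in> ground n" and a0: "l i \<noteq> 0" and ne: "l i \<noteq> l j" for i j
  proof -
    \<comment> \<open>If the two labels are opposite, equating them makes each coordinate its own
      negative, so the merged label is 0.\<close>
    define a b where "a = l i" and "b = (if l j = - l i then 0 else l j)"
    define \<phi> where "\<phi> z = (if z = a then b else if z = - a then - b else z)" for z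
    have odd: "l (- x) = - l x" for x using l by (simp add: odd_map_def)
    have a: "a \<noteq> 0" "b \<noteq> a" using a0 ne by (auto simp: a_def b_def)
    have \<phi>odd: "\<phi> (- z) = - \<phi> z" for z using a by (auto simp: \<phi>_def)
    have "odd_map (\<phi> \<circ> l)" by (simp add: odd_map_def odd \<phi>odd)
    moreover have "flat_sets n (\<phi> \<circ> l) = flat_sets n l \<inter> {Q. collapses (i, j) Q}"
    proof (intro equalityI subsetI)
      fix Q assume Q0: "Q \<in> flat_sets n (\<phi> \<circ> l)"
      then have adm: "admissible n Q" by (simp add: flat_sets_def)
      have Q: "x \<in> Q \<longleftrightarrow> y \<in> Q" if "x \<in> ground n" "y \<in> ground n" "\<phi> (l x) = \<phi> (l y)" for x y
        using flat_sets_iff[OF Q0, of x y] that by simp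
      have "\<phi> (l i) = \<phi> (l j)" using a ne by (auto simp: \<phi>_def b_def a_def)
      moreover from this have "\<phi> (l (- i)) = \<phi> (l (- j))" by (simp add: odd \<phi>odd)
      ultimately have "collapses (i, j) Q"
        using ij Q[of i j] Q[of "- i" "- j"] by (simp add: collapses_def)
      moreover have "Q \<in> flat_sets n l"
        unfolding flat_sets_def
      proof (intro CollectI conjI ballI impI adm)
        fix x y assume "x \<in> ground n" "y \<in> ground n" "l x = l y"
        then show "x \<in> Q \<longleftrightarrow> y \<in> Q" using Q[of x y] by simp
      qed
      ultimately show "Q \<in> flat_sets n l \<inter> {Q. collapses (i, j) Q}" by simp
    next
      fix Q assume Q0: "Q \<in> flat_sets n l \<inter> {Q. collapses (i, j) Q}"
      then have adm: "admissible n Q" and col: "collapses (i, j) Q" by (auto simp: flat_sets_def)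
      have Q: "x \<in> Q \<longleftrightarrow> y \<in> Q" if "x \<in> ground n" "y \<in> ground n" "l x = l y" for x y
        using flat_sets_iff[of Q n l x y] Q0 that by simp
      have neg: "x \<in> Q \<Longrightarrow> - x \<notin> Q" for x using adm by (auto simp: admissible_def)
      have zero: "x \<notin> Q" if "x \<in> ground n" "l x = 0" for x
        using Q[of x "- x"] that neg[of x] by (auto simp: odd)
      \<comment> \<open>Membership of an element of any of the four affected classes reduces to that
        of \<open>j\<close> or \<open>- j\<close>; an element with label 0 is never a
        member.\<close>
      have mem: "x \<in> Q \<longleftrightarrow> b \<noteq> 0 \<and> j \<in> Q" if "x \<in> ground n" "l x = a" for x
        using Q[of x i] Q[of x "- j"] Q[of i "- j"] that ij col zero[OF ij(2)] neg[of j] neg[of i]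
        by (auto simp: a_def b_def odd collapses_def split: if_splits)
      have mem': "x \<in> Q \<longleftrightarrow> b \<noteq> 0 \<and> - j \<in> Q" if "x \<in> ground n" "l x = - a" for x
        using Q[of x "- i"] Q[of x "j"] that ij col zero[OF ij(2)] zero[of "- j"] neg[of j] neg[of i]
        by (auto simp: a_def b_def odd collapses_def split: if_splits)
      have memb: "x \<in> Q \<longleftrightarrow> b \<noteq> 0 \<and> j \<in> Q" if "x \<in> ground n" "l x = b" for x
        using Q[of x j] zero[of x] that ij by (auto simp: b_def split: if_splits)
      have memb': "x \<in> Q \<longleftrightarrow> b \<noteq> 0 \<and> - j \<in> Q" if "x \<in> ground n" "l x = - b" for x
        using Q[of x "- j"] zero[of x] that ij by (auto simp: b_def odd split: if_splits)
      have "x \<in> Q \<longleftrightarrow> y \<in> Q" if xy: "x \<in> ground n" "y \<in> ground n" "\<phi> (l x) = \<phi> (l y)" for x y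
      proof (cases "l x = l y")
        case False
        have "l x = a \<or> l x = - a \<or> l y = a \<or> l y = - a"
          using xy(3) False by (auto simp: \<phi>_def split: if_splits)
        then show ?thesis
          using xy False mem[of x] mem'[of x] memb[of x] memb'[of x]
            mem[of y] mem'[of y] memb[of y] memb'[of y]
          unfolding \<phi>_def by (elim disjE) (auto split: if_splits)
      qed (use Q[of x y] xy in auto)
      then show "Q \<in> flat_sets n (\<phi> \<circ> l)" unfolding flat_sets_def comp_def using adm by blast
    qed
    moreover have "flat_dim n l \<le> Suc (flat_dim n (\<phi> \<circ> l))"
    proof -
      let ?A = "{a. 0 < a \<and> a \<in> (\<phi> \<circ> l) ` ground n}"
      have fin: "finite ?A" by simp
      have "z \<in> insert \<bar>a\<bar> ?A" if z: "0 < z" "z \<in> l ` ground n" for z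
      proof (cases "z = \<bar>a\<bar>")
        case False
        then have "\<phi> z = z" using z by (auto simp: \<phi>_def)
        then show ?thesis using z by (auto simp: image_iff intro!: bexI)
      qed simp
      then have "{a. 0 < a \<and> a \<in> l ` ground n} \<subseteq> insert \<bar>a\<bar> ?A" by blast
      then have "flat_dim n l \<le> card (insert \<bar>a\<bar> ?A)"
        unfolding flat_dim_def using fin by (intro card_mono) auto
      also have "\<dots> \<le> Suc (card ?A)" by (rule card_insert_le_m1) simp_all
      finally show ?thesis by (simp add: flat_dim_def)
    qed
    ultimately show ?thesis by blast
  qed
  \<comment> \<open>The construction moves a nonzero label, so the roles of \<open>i\<close> and
    \<open>j\<close> are chosen such that the moved label is not 0.\<close>
  consider "l i = l j" | "l i \<noteq> l j" "l i \<noteq> 0" | "l i \<noteq> l j" "l j \<noteq> 0" by fastforce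
  then show ?thesis
  proof cases
    case 1
    then have "l (- i) = l (- j)" using l by (simp add: odd_map_def)
    then have "flat_sets n l = flat_sets n l \<inter> {Q. collapses (i, j) Q}"
      using 1 e flat_sets_iff[of _ n l i j] flat_sets_iff[of _ n l "- i" "- j"]
      by (auto simp: collapses_def)
    then show ?thesis using l by (intro exI[of _ l]) auto
  next
    case 2 then show ?thesis using step e by blast
  next
    case 3
    have "collapses (i, j) = collapses (j, i)" by (auto simp: collapses_def)
    then show ?thesis using 3 step[OF e(2,1)] by auto
  qed
qed

text \<open>These sets are the vertices of a closed hemisphere of the flat, where the coordinate at
  \<open>i\<close> is nonnegative. Adding the class \<open>S\<close> of \<open>i\<close> is a
  closure operator on them: the sets that contain \<open>i\<close> form a cone with apex
  \<open>S\<close>, and the others are attached to it one by one.\<close>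

lemma hemisphere_acyclic:
  assumes l: "odd_map l" and i: "i \<in> ground n" "l i \<noteq> 0"
  shows "acyclic_at {Q. admissible n Q} (order_complex {Q \<in> flat_sets n l. - i \<notin> Q}) k"
proof -
  define S where "S = {x \<in> ground n. l x = l i}"
  let ?U = "{Q. admissible n Q}" and ?F = "{Q \<in> flat_sets n l. - i \<notin> Q}"
  have odd: "l (- x) = - l x" for x using l by (simp add: odd_map_def)
  have closed: "Q \<union> S \<in> ?F" if "Q \<in> ?F \<or> Q = {}" for Q
  proof -
    have SQ: "- x \<notin> Q" if "x \<in> S" for x
    proof -
      have "l (- x) = l (- i)" "- x \<in> ground n" "- i \<in> ground n" using that i by (auto simp: S_def odd)
      then show ?thesis using \<open>Q \<in> ?F \<or> Q = {}\<close> flat_sets_iff[of Q n l "- x" "- i"] by auto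
    qed
    have SS: "- x \<notin> S" if "x \<in> S" for x using that i by (auto simp: S_def odd)
    have i': "i \<in> S" "- i \<notin> S" using i by (auto simp: S_def odd)
    have Q: "admissible n Q \<or> Q = {}" "- i \<notin> Q" using \<open>Q \<in> ?F \<or> Q = {}\<close>
      by (auto simp: flat_sets_def)
    have "- x \<notin> Q \<union> S" if "x \<in> Q \<union> S" for x
      using that SQ[of x] SQ[of "- x"] SS[of x] Q(1) by (auto simp: admissible_def)
    moreover have "Q \<union> S \<subseteq> ground n" using Q(1) by (auto simp: admissible_def S_def)
    ultimately have "admissible n (Q \<union> S)" using i' by (auto simp: admissible_def)
    moreover have "- i \<notin> Q \<union> S" using i' Q by simp
    moreover have "x \<in> Q \<union> S \<longleftrightarrow> y \<in> Q \<union> S" if "x \<in> ground n" "y \<in> ground n" "l x = l y" for x y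
      using \<open>Q \<in> ?F \<or> Q = {}\<close> flat_sets_iff[of Q n l x y] that by (auto simp: S_def)
    ultimately show ?thesis unfolding flat_sets_def by blast
  qed
  have SQ: "S \<subseteq> Q" if "Q \<in> flat_sets n l" "i \<in> Q" for Q
  proof
    fix x assume "x \<in> S"
    then show "x \<in> Q" using flat_sets_iff[OF that(1) i(1), of x] that(2) by (simp add: S_def)
  qed
  have iS: "i \<in> S" using i by (simp add: S_def)
  have main: "acyclic_at ?U (order_complex ({Q \<in> ?F. i \<in> Q} \<union> D)) k"
    if "finite D" "D \<subseteq> {Q \<in> ?F. i \<notin> Q}" for D k
    using that
  proof (induction "card D" arbitrary: D k)
    case (0 D k)
    then have "D = {}" by simp
    show ?case unfolding \<open>D = {}\<close>
      by (rule acyclic_at_cone[where x = S])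
        (use closed[of "{}"] iS SQ flat_sets_admissible[of n l] in auto)
  next
    case (Suc d D k)
    have "D \<noteq> {}" using Suc.hyps(2) by auto
    have fD: "finite (card ` D)" "card ` D \<noteq> {}" using Suc.prems(1) \<open>D \<noteq> {}\<close> by auto
    obtain q where q: "q \<in> D" "card q = Max (card ` D)" using Max_in[OF fD] by auto
    have max: "card y \<le> card q" if "y \<in> D" for y using q(2) fD that by simp
    have fin: "finite y" if "y \<in> D" for y
      using that Suc.prems(2) flat_sets_admissible[of n l] finite_subset[of y "ground n"]
      by (auto simp: admissible_def)
    let ?E = "{Q \<in> ?F. i \<in> Q} \<union> (D - {q})"
    have "acyclic_at ?U (order_complex (insert q ?E)) k"
    proof (rule acyclic_at_insert[where z = "q \<union> S"])
      show "acyclic_at ?U (order_complex ?E) k" for k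
        using Suc.hyps(2) q(1) Suc.prems by (intro Suc.hyps(1)) auto
      show "q \<union> S \<in> ?E" using closed[of q] q(1) Suc.prems(2) iS by auto
      fix y assume y: "y \<in> ?E" "y \<subseteq> q \<or> q \<subseteq> y"
      show "y \<subseteq> q \<union> S \<or> q \<union> S \<subseteq> y"
      proof (cases "i \<in> y")
        case True
        then have "q \<subseteq> y" using y q(1) Suc.prems(2) by auto
        moreover have "S \<subseteq> y" using True y Suc.prems(2) by (intro SQ) auto
        ultimately show ?thesis by auto
      next
        case False
        then have "y \<in> D" using y by auto
        then have "y \<subseteq> q" using y(2) max[of y] card_seteq[of y q] fin[of y] by auto
        then show ?thesis by auto
      qed
    qed (use Suc.prems q flat_sets_admissible[of n l] in auto)
    moreover have "insert q ?E = {Q \<in> ?F. i \<in> Q} \<union> D" using q(1) by auto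
    ultimately show ?case by simp
  qed
  have "finite {Q \<in> ?F. i \<notin> Q}"
    by (rule finite_subset[OF _ finite_admissible[of n]]) (use flat_sets_admissible[of n l] in auto)
  from main[OF this, of k] show ?thesis
    by (rule back_subst[where P = "\<lambda>X. acyclic_at ?U (order_complex X) k"]) auto
qed

text \<open>A flat meets the boundary of the cube in a sphere, glued from two hemispheres along the
  sphere of the section where coordinate \<open>i\<close> vanishes. The bound on \<open>k\<close>
  says that the degree is below the top one.\<close>

lemma flat_acyclic:
  assumes "odd_map l" "k < flat_dim n l"
  shows "acyclic_at {Q. admissible n Q} (order_complex (flat_sets n l)) k"
  using assms
proof (induction k arbitrary: l rule: less_induct)
  case (less k)
  have "{a. 0 < a \<and> a \<in> l ` ground n} \<noteq> {}"
    using less.prems(2) unfolding flat_dim_def by (metis card.empty not_less_zero)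
  then obtain i where i: "i \<in> ground n" "l i > 0" by auto
  have odd: "l (- x) = - l x" for x using less.prems(1) by (simp add: odd_map_def)
  let ?F = "\<lambda>i. {Q \<in> flat_sets n l. - i \<notin> Q}"
  obtain l' where l': "odd_map l'" "flat_sets n l' = flat_sets n l \<inter> {Q. collapses (i, - i) Q}"
    "flat_dim n l \<le> Suc (flat_dim n l')"
    using collapse_flat[OF less.prems(1) i(1), of "- i"] i(1) by auto
  have adm: "i \<in> Q \<Longrightarrow> - i \<notin> Q" if "Q \<in> flat_sets n l" for Q
    using that by (auto simp: flat_sets_def admissible_def)
  have int: "order_complex (?F i) \<inter> order_complex (?F (- i)) = order_complex (flat_sets n l')"
    unfolding order_complex_Int l'(2) using adm
    by (intro arg_cong[of _ _ order_complex]) (auto simp: collapses_def)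
  have un: "order_complex (flat_sets n l) = order_complex (?F i) \<union> order_complex (?F (- i))"
  proof (intro equalityI subsetI)
    fix Y assume Y: "Y \<in> order_complex (flat_sets n l)"
    \<comment> \<open>Nested sets cannot contain \<open>i\<close> and \<open>- i\<close> separately,
      since the larger one would then contain both.\<close>
    have "(\<forall>Q\<in>Y. - i \<notin> Q) \<or> (\<forall>Q\<in>Y. i \<notin> Q)"
    proof (rule ccontr)
      assume "\<not> ?thesis"
      then obtain P Q where PQ: "P \<in> Y" "Q \<in> Y" "- i \<in> P" "i \<in> Q" by blast
      then have "P \<subseteq> Q \<or> Q \<subseteq> P" "P \<in> flat_sets n l" "Q \<in> flat_sets n l"
        using Y by (auto simp: order_complex_def)
      then show False using PQ adm by blast
    qed
    then show "Y \<in> order_complex (?F i) \<union> order_complex (?F (- i))"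
      using Y by (auto simp: order_complex_def)
  qed (auto simp: order_complex_def)
  show ?case unfolding un
  proof (rule acyclic_at_Un)
    show "acyclic_at {Q. admissible n Q} (order_complex (?F i)) k"
      "acyclic_at {Q. admissible n Q} (order_complex (?F (- i))) k"
      using hemisphere_acyclic[OF less.prems(1), of i] hemisphere_acyclic[OF less.prems(1), of "- i"] i
      by (auto simp: odd)
    show "acyclic_at {Q. admissible n Q} (order_complex (?F i) \<inter> order_complex (?F (- i))) m"
      if "k = Suc m" for m
      unfolding int using that l' less.prems by (intro less.IH) auto
    show "order_complex (?F i) \<subseteq> order_complex {Q. admissible n Q}"
      "order_complex (?F (- i)) \<subseteq> order_complex {Q. admissible n Q}"
      by (auto simp: order_complex_def flat_sets_def)
    show "order_complex (?F i) \<noteq> {}" by (auto simp: order_complex_def)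
  qed (simp, (erule (1) order_complex_subset)+)
qed

text \<open>Hyperplanes are added one at a time. The new one meets the union of the old ones in an
  arrangement inside a smaller flat, whose dimension drops by at most one; this is why the claim is
  made for arbitrary flats.\<close>

theorem arrangement_acyclic:
  assumes "odd_map l" "finite A" "A \<noteq> {}" "A \<subseteq> ground n \<times> ground n" "Suc k < flat_dim n l"
  shows "acyclic_at {Q. admissible n Q}
    (\<Union>e\<in>A. order_complex (flat_sets n l \<inter> {Q. collapses e Q})) k"
  using assms(2,3,1,4,5)
proof (induction A arbitrary: l k rule: finite_ne_induct)
  case (singleton e)
  obtain i j where e: "e = (i, j)" by force
  obtain l' where l': "odd_map l'" "flat_sets n l' = flat_sets n l \<inter> {Q. collapses e Q}"
    "flat_dim n l \<le> Suc (flat_dim n l')"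
    using collapse_flat[OF singleton(1), of i n j] singleton(2) by (auto simp: e)
  then show ?case using flat_acyclic[OF l'(1), of k n] singleton(3) by simp
next
  case (insert e A)
  obtain i j where e: "e = (i, j)" by force
  obtain l' where l': "odd_map l'" "flat_sets n l' = flat_sets n l \<inter> {Q. collapses e Q}"
    "flat_dim n l \<le> Suc (flat_dim n l')"
    using collapse_flat[OF insert.prems(1), of i n j] insert.prems(2) by (auto simp: e)
  let ?N = "\<lambda>l e. order_complex (flat_sets n l \<inter> {Q. collapses e Q})"
  have int: "?N l e \<inter> (\<Union>e\<in>A. ?N l e) = (\<Union>e\<in>A. ?N l' e)"
    unfolding l'(2) by (auto simp: order_complex_def)
  have "acyclic_at {Q. admissible n Q} (?N l e \<union> (\<Union>e\<in>A. ?N l e)) k"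
  proof (rule acyclic_at_Un)
    show "acyclic_at {Q. admissible n Q} (?N l e) k"
      using flat_acyclic[OF l'(1), of k n] insert.prems(3) l' by simp
    show "acyclic_at {Q. admissible n Q} (\<Union>e\<in>A. ?N l e) k"
      using insert by auto
    show "acyclic_at {Q. admissible n Q} (?N l e \<inter> (\<Union>e\<in>A. ?N l e)) m" if "k = Suc m" for m
      unfolding int using that insert.prems l' by (intro insert.IH) auto
    show "?N l e \<subseteq> order_complex {Q. admissible n Q}"
      "(\<Union>e\<in>A. ?N l e) \<subseteq> order_complex {Q. admissible n Q}"
      by (auto simp: order_complex_def flat_sets_def)
    show "?N l e \<noteq> {}" by (auto simp: order_complex_def)
    show "X \<in> (\<Union>e\<in>A. ?N l e)" if "Y \<in> (\<Union>e\<in>A. ?N l e)" "X \<subseteq> Y" for X Y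
      using that order_complex_subset by blast
  qed (simp, erule (1) order_complex_subset)
  then show ?case by simp
qed

section \<open>Adams operations by signed insertion sort\<close>

text \<open>
  A letter with label \<open>t \<ge> 0\<close> is inserted behind all labels \<open>\<le> t\<close>; a letter with label \<open>t < 0\<close> is negated
  and inserted in front of all labels \<open>\<ge> - t\<close>. Both places are cut off by the same kind of threshold.
\<close>

definition cutoff :: "int \<Rightarrow> int" where
  "cutoff t = (if t < 0 then - t else t + 1)"

definition below :: "int \<Rightarrow> (int \<times> 'a) list \<Rightarrow> (int \<times> 'a) list" where
  "below s L = filter (\<lambda>p. fst p < s) L"

definition above :: "int \<Rightarrow> (int \<times> 'a) list \<Rightarrow> (int \<times> 'a) list" where
  "above s L = filter (\<lambda>p. \<not> fst p < s) L"

definition ins :: "('a \<Rightarrow> 'a) \<Rightarrow> int \<times> 'a \<Rightarrow> (int \<times> 'a) list \<Rightarrow> (int \<times> 'a) list" where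
  "ins neg p L = below (cutoff (fst p)) L @ [(\<bar>fst p\<bar>, if fst p < 0 then neg (snd p) else snd p)]
     @ above (cutoff (fst p)) L"

text \<open>The sign of the signed permutation performed by one insertion: a factor for each letter
  passed from the right end, and one for a negation.\<close>

definition ins_sign :: "int \<Rightarrow> (int \<times> 'a) list \<Rightarrow> complex" where
  "ins_sign t L = (if t < 0 then - 1 else 1) * (- 1) ^ length (above (cutoff t) L)"

definition isort :: "('a \<Rightarrow> 'a) \<Rightarrow> (int \<times> 'a) list \<Rightarrow> (int \<times> 'a) list" where
  "isort neg xs = fold (ins neg) xs []"

definition isort_sign :: "('a \<Rightarrow> 'a) \<Rightarrow> (int \<times> 'a) list \<Rightarrow> complex" where
  "isort_sign neg xs = (\<Prod>k<length xs. ins_sign (fst (xs ! k)) (isort neg (take k xs)))"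

text \<open>The sorted word is seen only through an arbitrary \<open>g\<close>, so that the last
  letter can be peeled off and absorbed into \<open>g\<close> in an induction.\<close>

definition sort_val :: "('a \<Rightarrow> 'a) \<Rightarrow> ((int \<times> 'a) list \<Rightarrow> complex) \<Rightarrow> (int \<times> 'a) list \<Rightarrow> complex" where
  "sort_val neg g xs = isort_sign neg xs * g (isort neg xs)"

lemma isort_Nil [simp]: "isort neg [] = []"
  by (simp add: isort_def)

lemma isort_snoc [simp]: "isort neg (xs @ [p]) = ins neg p (isort neg xs)"
  by (simp add: isort_def)

lemma isort_sign_Nil [simp]: "isort_sign neg [] = 1"
  by (simp add: isort_sign_def)

lemma isort_sign_snoc [simp]:
  "isort_sign neg (xs @ [p]) = isort_sign neg xs * ins_sign (fst p) (isort neg xs)"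
  by (simp add: isort_sign_def nth_append)

lemma sort_val_snoc:
  "sort_val neg g (xs @ [p]) = sort_val neg (\<lambda>L. ins_sign (fst p) L * g (ins neg p L)) xs"
  by (simp add: sort_val_def)

lemma length_below_above: "length (below s L) + length (above s L) = length L"
  unfolding below_def above_def by (rule sum_length_filter_compl)

lemma length_ins [simp]: "length (ins neg p L) = Suc (length L)"
  using length_below_above[of "cutoff (fst p)" L] by (simp add: ins_def)

lemma length_isort [simp]: "length (isort neg xs) = length xs"
  by (induction xs rule: rev_induct) auto

lemma below_append_above:
  "sorted (map fst L) \<Longrightarrow> below s L @ above s L = L"
proof (induction L)
  case (Cons p L)
  show ?case
  proof (cases "fst p < s")
    case False
    then have "below s L = []" using Cons.prems by (auto simp: below_def filter_empty_conv)
    moreover have "above s L = L" using Cons.prems False by (auto simp: above_def filter_id_conv)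
    ultimately show ?thesis using False by (simp add: below_def above_def)
  qed (use Cons in \<open>auto simp: below_def above_def\<close>)
qed (simp add: below_def above_def)

lemma sorted_ins: "sorted (map fst L) \<Longrightarrow> sorted (map fst (ins neg p L))"
  unfolding ins_def below_def above_def cutoff_def
  by (auto simp: sorted_append sorted_filter)

lemma sorted_isort: "sorted (map fst (isort neg xs))"
  by (induction xs rule: rev_induct) (auto intro: sorted_ins)

text \<open>Letters with different labels end up in the same places in either order, but the one
  that lands further left passes the other only if it is inserted second. This accounts for the
  single sign.\<close>

lemma ins_commute:
  assumes "t \<noteq> t'"
  shows "ins neg (t, x) (ins neg (t', y) L) = ins neg (t', y) (ins neg (t, x) L)
    \<and> ins_sign t' L * ins_sign t (ins neg (t', y) L) = - (ins_sign t L * ins_sign t' (ins neg (t, x) L))"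
proof -
  have comm: "ins neg (t, x) (ins neg (t', y) L) = ins neg (t', y) (ins neg (t, x) L)
    \<and> ins_sign t' L * ins_sign t (ins neg (t', y) L) = - (ins_sign t L * ins_sign t' (ins neg (t, x) L))"
    if c: "cutoff t \<le> cutoff t'" "\<bar>t\<bar> < cutoff t'" "\<not> \<bar>t'\<bar> < cutoff t" for t t' x y
  proof -
    have 1: "above (cutoff t) (below (cutoff t') L) = below (cutoff t') (above (cutoff t) L)"
      by (simp add: above_def below_def conj_commute)
    have 2: "below (cutoff t) (below (cutoff t') L) = below (cutoff t) L"
      "below (cutoff t) (above (cutoff t') L) = []" "below (cutoff t') (below (cutoff t) L) = below (cutoff t) L"
      "above (cutoff t) (above (cutoff t') L) = above (cutoff t') L" "above (cutoff t') (below (cutoff t) L) = []"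
      "above (cutoff t') (above (cutoff t) L) = above (cutoff t') L"
      using c(1) by (auto simp: below_def above_def filter_empty_conv intro!: filter_cong)
    have app: "below s (L @ M) = below s L @ below s M" "above s (L @ M) = above s L @ above s M"
      "below s (p # L) = (if fst p < s then p # below s L else below s L)"
      "above s (p # L) = (if fst p < s then above s L else p # above s L)" for s M and p :: "int \<times> 'a" and L
      by (auto simp: below_def above_def)
    have len: "length (above (cutoff t) L) = length (below (cutoff t') (above (cutoff t) L)) + length (above (cutoff t') L)"
      using length_below_above[of "cutoff t'" "above (cutoff t) L"] 2 by simp
    show ?thesis using c(2,3)
      by (simp add: ins_def ins_sign_def app 1 2) (simp add: len power_add)
  qed
  show ?thesis
  \<comment> \<open>Two distinct labels can share a threshold \<open>s\<close>, namely
    \<open>s - 1\<close> and \<open>- s\<close>; then the nonnegative one lands first.\<close>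
  proof (cases "cutoff t < cutoff t' \<or> (cutoff t = cutoff t' \<and> t \<ge> 0)")
    case True
    then show ?thesis using assms by (intro comm) (auto simp: cutoff_def split: if_splits)
  next
    case False
    then have "cutoff t' \<le> cutoff t" "\<bar>t'\<bar> < cutoff t" "\<not> \<bar>t\<bar> < cutoff t'"
      using assms by (auto simp: cutoff_def split: if_splits)
    from comm[OF this, of y x] show ?thesis by simp
  qed
qed

lemma sort_val_swap:
  assumes "t \<noteq> t'"
  shows "sort_val neg g (xs @ (t, x) # (t', y) # ys) = - sort_val neg g (xs @ (t', y) # (t, x) # ys)"
proof (induction ys arbitrary: g rule: rev_induct)
  case Nil
  have "sort_val neg g ((xs @ [(t, x)]) @ [(t', y)]) = - sort_val neg g ((xs @ [(t', y)]) @ [(t, x)])"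
    using ins_commute[OF assms, of neg x y "isort neg xs"]
    unfolding sort_val_snoc by (simp add: sort_val_def mult.assoc[symmetric])
  then show ?case by simp
next
  case (snoc p ys)
  have "sort_val neg g ((xs @ (t, x) # (t', y) # ys) @ [p])
      = - sort_val neg g ((xs @ (t', y) # (t, x) # ys) @ [p])"
    unfolding sort_val_snoc by (rule snoc)
  then show ?case by simp
qed

subsection \<open>Splitting a letter\<close>

text \<open>The transpose of merging two adjacent blocks. Splittings with an empty part are
  included; they are left to the support of \<open>f\<close>.\<close>

primrec split_sum :: "(int set list \<Rightarrow> complex) \<Rightarrow> int set list \<Rightarrow> complex" where
  "split_sum f [] = 0"
| "split_sum f (Z # w) = (\<Sum>X\<in>Pow Z. f (X # (Z - X) # w)) - split_sum (\<lambda>M. f (Z # M)) w"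

text \<open>Only splittings whose halves share a label survive the sum over all labellings, so this
  is the version that has to commute with sorting.\<close>

fun lsplit :: "((int \<times> int set) list \<Rightarrow> complex) \<Rightarrow> (int \<times> int set) list \<Rightarrow> complex" where
  "lsplit g [] = 0"
| "lsplit g ((a, Z) # L) =
     (\<Sum>X\<in>Pow Z. g ((a, X) # (a, Z - X) # L)) - lsplit (\<lambda>M. g ((a, Z) # M)) L"

lemma lsplit_map_snd: "lsplit (\<lambda>M. f (map snd M)) xs = split_sum f (map snd xs)"
  by (induction xs arbitrary: f) auto

lemma lsplit_append:
  "lsplit g (L @ M) = lsplit (\<lambda>L'. g (L' @ M)) L + (- 1) ^ length L * lsplit (\<lambda>M'. g (L @ M')) M"
  by (induction L arbitrary: g) (auto simp: algebra_simps)

lemma lsplit_scale: "lsplit (\<lambda>L. c * g L) xs = c * lsplit g xs"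
  by (induction xs arbitrary: g) (auto simp: algebra_simps sum_distrib_left)

text \<open>The labels and the length of a word are all that thresholds and signs of an insertion
  depend on in the comparison made below.\<close>

lemma lsplit_cong:
  assumes "\<And>M. fst ` set M \<subseteq> fst ` set L \<Longrightarrow> length M = Suc (length L) \<Longrightarrow> g M = h M"
  shows "lsplit g L = lsplit h L"
  using assms
proof (induction L arbitrary: g h)
  case (Cons p L)
  obtain a Z where p: "p = (a, Z)" by force
  have "lsplit (\<lambda>M. g ((a, Z) # M)) L = lsplit (\<lambda>M. h ((a, Z) # M)) L"
  proof (rule Cons.IH)
    fix M :: "(int \<times> int set) list"
    assume "fst ` set M \<subseteq> fst ` set L" "length M = Suc (length L)"
    then show "g ((a, Z) # M) = h ((a, Z) # M)" by (intro Cons.prems) (auto simp: p)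
  qed
  moreover have "(\<Sum>X\<in>Pow Z. g ((a, X) # (a, Z - X) # L)) = (\<Sum>X\<in>Pow Z. h ((a, X) # (a, Z - X) # L))"
    by (rule sum.cong[OF refl], rule Cons.prems) (auto simp: p)
  ultimately show ?case by (simp add: p)
qed simp

abbreviation neg_set :: "int set \<Rightarrow> int set" where
  "neg_set \<equiv> image uminus"

lemma neg_set_neg_set [simp]: "neg_set (neg_set X) = X"
  by (simp add: image_image)

lemma sum_Pow_neg_set: "(\<Sum>X\<in>Pow (neg_set Z). f X) = (\<Sum>X\<in>Pow Z. f (neg_set X))"
proof (rule sum.reindex_bij_witness[where i = neg_set and j = neg_set])
qed (auto simp: image_subset_iff)

lemma sum_Pow_diff: "(\<Sum>X\<in>Pow Z. f X (Z - X)) = (\<Sum>X\<in>Pow Z. f (Z - X) X)"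
  by (rule sum.reindex_bij_witness[where i = "\<lambda>X. Z - X" and j = "\<lambda>X. Z - X"]) (auto simp: double_diff)

text \<open>Equal nonnegative labels keep their order and the two insertion signs cancel. Equal
  negative labels are reversed, and the second letter passes the first, which leaves a sign.\<close>

lemma ins_twice_same:
  "ins_sign t L * ins_sign t (ins neg_set (t, X) L) * g (ins neg_set (t, Y) (ins neg_set (t, X) L))
    = (if t < 0 then - g (below (cutoff t) L @ (\<bar>t\<bar>, neg_set Y) # (\<bar>t\<bar>, neg_set X) # above (cutoff t) L)
       else g (below (cutoff t) L @ (t, X) # (t, Y) # above (cutoff t) L))"
proof -
  have b: "below s (below s L) = below s L" "below s (above s L) = []" "above s (above s L) = above s L"
    "above s (below s L) = []" for s
    by (auto simp: below_def above_def filter_empty_conv)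
  have app: "below s (L @ M) = below s L @ below s M" "above s (L @ M) = above s L @ above s M"
    "below s (p # L) = (if fst p < s then p # below s L else below s L)"
    "above s (p # L) = (if fst p < s then above s L else p # above s L)" for s M and p :: "int \<times> int set" and L
    by (auto simp: below_def above_def)
  show ?thesis
    by (auto simp: ins_def ins_sign_def app b cutoff_def power_add[symmetric] mult_2[symmetric] simp flip: power_mult)
qed

text \<open>Splitting after an insertion splits either an old letter or the new one. An old letter
  behind the new one has moved by one place, but splitting it first gives the new letter one more to
  pass, so the signs agree. Splitting the new letter amounts to inserting its two halves in
  succession.\<close>

lemma lsplit_ins:
  assumes sorted: "sorted (map fst L)"
  shows "ins_sign t L * lsplit g (ins neg_set (t, Z) L)
    = lsplit (\<lambda>M. ins_sign t M * g (ins neg_set (t, Z) M)) L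
      + (- 1) ^ length L * (\<Sum>X\<in>Pow Z. ins_sign t L * ins_sign t (ins neg_set (t, X) L) *
           g (ins neg_set (t, Z - X) (ins neg_set (t, X) L)))"
proof -
  define A B where "A = below (cutoff t) L" and "B = above (cutoff t) L"
  define \<sigma> :: complex where "\<sigma> = (if t < 0 then - 1 else 1)"
  define z where "z = (\<bar>t\<bar>, if t < 0 then neg_set Z else Z)"
  have L: "L = A @ B" unfolding A_def B_def using below_append_above[OF sorted] by simp
  have A: "\<forall>p\<in>fst ` set A. p < cutoff t" and B: "\<forall>p\<in>fst ` set B. \<not> p < cutoff t"
    by (auto simp: A_def B_def below_def above_def)
  have bA: "below (cutoff t) M = M" "above (cutoff t) M = []" if "fst ` set M \<subseteq> fst ` set A" for M :: "(int \<times> int set) list"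
  proof -
    have "\<forall>p\<in>set M. fst p < cutoff t" using that A by blast
    then show "below (cutoff t) M = M" "above (cutoff t) M = []"
      by (auto simp: below_def above_def filter_empty_conv filter_id_conv)
  qed
  have bB: "below (cutoff t) M = []" "above (cutoff t) M = M" if "fst ` set M \<subseteq> fst ` set B" for M :: "(int \<times> int set) list"
  proof -
    have "\<forall>p\<in>set M. \<not> fst p < cutoff t" using that B by blast
    then show "below (cutoff t) M = []" "above (cutoff t) M = M"
      by (auto simp: below_def above_def filter_empty_conv filter_id_conv)
  qed
  have app: "below s (L @ M) = below s L @ below s M" "above s (L @ M) = above s L @ above s M"
    for s M and L :: "(int \<times> int set) list"
    by (auto simp: below_def above_def)
  have sL: "ins_sign t L = \<sigma> * (- 1) ^ length B" by (simp add: ins_sign_def \<sigma>_def B_def)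
  have iL: "ins neg_set (t, Z) L = A @ z # B" by (simp add: ins_def A_def B_def z_def)
  have "lsplit (\<lambda>M. ins_sign t M * g (ins neg_set (t, Z) M)) L
      = lsplit (\<lambda>M. \<sigma> * (- 1) ^ length B * g (M @ z # B)) A
        + (- 1) ^ length A * lsplit (\<lambda>M. \<sigma> * (- 1) ^ Suc (length B) * g (A @ z # M)) B"
  proof -
    have "ins_sign t (M @ B) * g (ins neg_set (t, Z) (M @ B)) = \<sigma> * (- 1) ^ length B * g (M @ z # B)"
      if "fst ` set M \<subseteq> fst ` set A" for M
      using that by (simp add: ins_sign_def ins_def \<sigma>_def z_def app bA bB)
    moreover have "ins_sign t (A @ M) * g (ins neg_set (t, Z) (A @ M))
        = \<sigma> * (- 1) ^ Suc (length B) * g (A @ z # M)"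
      if "fst ` set M \<subseteq> fst ` set B" "length M = Suc (length B)" for M
      using that by (simp add: ins_sign_def ins_def \<sigma>_def z_def app bA bB)
    ultimately show ?thesis unfolding L lsplit_append
      by (intro arg_cong2[of _ _ _ _ "(+)"] arg_cong[of _ _ "(*) _"] lsplit_cong)
  qed
  also have "\<dots> = \<sigma> * (- 1) ^ length B * (lsplit (\<lambda>M. g (M @ z # B)) A
      - (- 1) ^ length A * lsplit (\<lambda>M. g (A @ z # M)) B)"
    unfolding lsplit_scale by (simp add: algebra_simps)
  finally have 1: "lsplit (\<lambda>M. ins_sign t M * g (ins neg_set (t, Z) M)) L = \<dots>" .
  define T where "T = (\<Sum>X\<in>Pow (snd z). g (A @ (\<bar>t\<bar>, X) # (\<bar>t\<bar>, snd z - X) # B))"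
  have 2: "lsplit g (A @ z # B) = lsplit (\<lambda>M. g (M @ z # B)) A
      + (- 1) ^ length A * (T - lsplit (\<lambda>M. g (A @ z # M)) B)"
    by (simp add: lsplit_append z_def T_def)
  have 3: "(\<Sum>X\<in>Pow Z. ins_sign t L * ins_sign t (ins neg_set (t, X) L) *
           g (ins neg_set (t, Z - X) (ins neg_set (t, X) L))) = \<sigma> * T"
  proof (cases "t < 0")
    case True
    have "T = (\<Sum>X\<in>Pow Z. g (A @ (\<bar>t\<bar>, neg_set X) # (\<bar>t\<bar>, neg_set (Z - X)) # B))"
      unfolding T_def z_def using True
      by (simp add: sum_Pow_neg_set image_set_diff[OF inj_uminus])
    \<comment> \<open>A negative label reverses the halves, which is undone by exchanging
      \<open>X\<close> with its complement in \<open>Z\<close>.\<close>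
    also have "\<dots> = (\<Sum>X\<in>Pow Z. g (A @ (\<bar>t\<bar>, neg_set (Z - X)) # (\<bar>t\<bar>, neg_set X) # B))"
      by (rule sum_Pow_diff[where f = "\<lambda>X Y. g (A @ (\<bar>t\<bar>, neg_set X) # (\<bar>t\<bar>, neg_set Y) # B)"])
    finally show ?thesis using True
      by (subst ins_twice_same) (auto simp: \<sigma>_def sum_negf A_def B_def)
  next
    case False
    then show ?thesis
      by (subst ins_twice_same) (auto simp: \<sigma>_def A_def B_def T_def z_def)
  qed
  have len: "(- 1 :: complex) ^ length L = (- 1) ^ length A * (- 1) ^ length B" by (simp add: L power_add)
  show ?thesis unfolding 1 3 unfolding 2 iL sL len by (simp add: algebra_simps)
qed

lemma lsplit_sort_val: "lsplit (sort_val neg_set g) xs = sort_val neg_set (lsplit g) xs"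
proof (induction xs arbitrary: g rule: rev_induct)
  case Nil
  show ?case by (simp add: sort_val_def)
next
  case (snoc p xs)
  obtain t Z where p: "p = (t, Z)" by force
  let ?L = "isort neg_set xs"
  have "lsplit (sort_val neg_set g) (xs @ [p])
      = lsplit (sort_val neg_set (\<lambda>L. ins_sign t L * g (ins neg_set (t, Z) L))) xs
        + (- 1) ^ length xs * (\<Sum>X\<in>Pow Z. sort_val neg_set g (xs @ [(t, X), (t, Z - X)]))"
    by (simp add: lsplit_append p sort_val_snoc)
  also have "(\<lambda>X. sort_val neg_set g (xs @ [(t, X), (t, Z - X)])) =
      (\<lambda>X. isort_sign neg_set xs * (ins_sign t ?L * ins_sign t (ins neg_set (t, X) ?L) *
           g (ins neg_set (t, Z - X) (ins neg_set (t, X) ?L))))"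
  proof
    fix X
    have "sort_val neg_set g (xs @ [(t, X), (t, Z - X)]) = sort_val neg_set g ((xs @ [(t, X)]) @ [(t, Z - X)])"
      by simp
    then show "sort_val neg_set g (xs @ [(t, X), (t, Z - X)]) =
        isort_sign neg_set xs * (ins_sign t ?L * ins_sign t (ins neg_set (t, X) ?L) *
           g (ins neg_set (t, Z - X) (ins neg_set (t, X) ?L)))"
      unfolding sort_val_snoc by (simp add: sort_val_def)
  qed
  also have "lsplit (sort_val neg_set (\<lambda>L. ins_sign t L * g (ins neg_set (t, Z) L))) xs
      = isort_sign neg_set xs * lsplit (\<lambda>L. ins_sign t L * g (ins neg_set (t, Z) L)) ?L"
    unfolding snoc by (simp add: sort_val_def)
  finally show ?case
    using lsplit_ins[OF sorted_isort, of t neg_set xs g Z]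
    by (simp add: sort_val_snoc p) (simp add: sort_val_def sum_distrib_left[symmetric] algebra_simps)
qed

subsection \<open>Compatibility with the boundary\<close>

definition labels :: "nat \<Rightarrow> nat \<Rightarrow> int list set" where
  "labels c m = {v. set v \<subseteq> {- int c..int c} \<and> length v = m}"

lemma finite_labels [simp]: "finite (labels c m)"
  unfolding labels_def by (rule finite_lists_length_eq) simp

lemma sum_labels_0 [simp]: "(\<Sum>v\<in>labels c 0. F v) = F []"
proof -
  have "labels c 0 = {[]}" by (auto simp: labels_def)
  then show ?thesis by simp
qed

lemma sum_labels_Cons:
  "(\<Sum>v\<in>labels c (Suc m). F v) = (\<Sum>t\<in>{- int c..int c}. \<Sum>v\<in>labels c m. F (t # v))"
  unfolding sum.cartesian_product
  by (rule sum.reindex_bij_witness[where i = "\<lambda>(t, v). t # v" and j = "\<lambda>v. (hd v, tl v)"])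
    (auto simp: labels_def length_Suc_conv)

lemma sum_labels_snoc:
  "(\<Sum>v\<in>labels c (Suc m). F v) = (\<Sum>t\<in>{- int c..int c}. \<Sum>v\<in>labels c m. F (v @ [t]))"
  unfolding sum.cartesian_product
  by (rule sum.reindex_bij_witness[where i = "\<lambda>(t, v). v @ [t]" and j = "\<lambda>v. (last v, butlast v)"])
    (auto simp: labels_def length_Suc_conv_rev)

definition adams :: "nat \<Rightarrow> (int set list \<Rightarrow> complex) \<Rightarrow> int set list \<Rightarrow> complex" where
  "adams c f w = (\<Sum>v\<in>labels c (length w). sort_val neg_set (\<lambda>L. f (map snd L)) (zip v w))"

text \<open>
  The coefficient of \<open>w\<close> in the boundary of \<open>f\<close>: the sum runs over the words that merge to \<open>w\<close>, so
  no condition on the support of \<open>f\<close> is needed.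
\<close>

definition word_boundary :: "nat \<Rightarrow> (int set list \<Rightarrow> complex) \<Rightarrow> int set list \<Rightarrow> complex" where
  "word_boundary n f w = (- 1) ^ length w * (\<Sum>X\<in>Pow (ground n). f (w @ [X])) + split_sum f w"

lemma split_sum_add: "split_sum (\<lambda>w. f w + g w) w = split_sum f w + split_sum g w"
  by (induction w arbitrary: f g) (auto simp: sum.distrib)

lemma split_sum_scale: "split_sum (\<lambda>w. c * f w) w = c * split_sum f w"
  by (induction w arbitrary: f) (auto simp: algebra_simps sum_distrib_left)

lemma lsplit_sum: "finite A \<Longrightarrow> lsplit (\<lambda>w. \<Sum>a\<in>A. f a w) w = (\<Sum>a\<in>A. lsplit (f a) w)"
proof (induction w arbitrary: f)
  case (Cons p w)
  obtain t Z where p: "p = (t, Z)" by force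
  show ?case using Cons.prems by (simp add: p sum_subtractf Cons.IH sum.swap[of _ "Pow Z" A])
qed simp

text \<open>Labellings that give the two halves of a block different labels cancel: exchanging the
  halves together with their labels reverses the sign, by the assumption on
  \<open>\<Phi>\<close>.\<close>

lemma split_sum_adams:
  assumes "\<And>xs t t' X Y ys. t \<noteq> t' \<Longrightarrow> \<Phi> (xs @ (t, X) # (t', Y) # ys) = - \<Phi> (xs @ (t', Y) # (t, X) # ys)"
  shows "split_sum (\<lambda>w'. \<Sum>v\<in>labels c (length w'). \<Phi> (zip v w')) w
    = (\<Sum>v\<in>labels c (length w). lsplit \<Phi> (zip v w))"
  using assms
proof (induction w arbitrary: \<Phi>)
  case (Cons Z w)
  let ?I = "{- int c..int c}"
  have cancel: "(\<Sum>X\<in>Pow Z. \<Sum>t\<in>?I. \<Sum>t'\<in>?I. \<Phi> ((t, X) # (t', Z - X) # M))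
      = (\<Sum>t\<in>?I. \<Sum>X\<in>Pow Z. \<Phi> ((t, X) # (t, Z - X) # M))" for M
  proof -
    \<comment> \<open>The part with different labels, an antisymmetric function of the two
      halves.\<close>
    define g where "g X Y = (\<Sum>t\<in>?I. \<Sum>t'\<in>?I. if t = t' then 0 else \<Phi> ((t, X) # (t', Y) # M))" for X Y
    have anti: "g X Y = - g Y X" for X Y
    proof -
      have "g X Y = (\<Sum>t'\<in>?I. \<Sum>t\<in>?I. if t = t' then 0 else \<Phi> ((t, X) # (t', Y) # M))"
        unfolding g_def by (rule sum.swap)
      also have "\<dots> = (\<Sum>t'\<in>?I. \<Sum>t\<in>?I. - (if t' = t then 0 else \<Phi> ((t', Y) # (t, X) # M)))"
      proof (intro sum.cong refl)
        fix t t'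
        show "(if t = t' then 0 else \<Phi> ((t, X) # (t', Y) # M))
            = - (if t' = t then 0 else \<Phi> ((t', Y) # (t, X) # M))"
          using Cons.prems[of t t' "[]" X Y M] by auto
      qed
      finally show ?thesis by (simp add: g_def sum_negf)
    qed
    have "(\<Sum>X\<in>Pow Z. g X (Z - X)) = - (\<Sum>X\<in>Pow Z. g (Z - X) X)"
      unfolding sum_negf[symmetric] by (rule sum.cong[OF refl], rule anti)
    also have "(\<Sum>X\<in>Pow Z. g (Z - X) X) = (\<Sum>X\<in>Pow Z. g X (Z - X))"
      by (rule sum_Pow_diff[symmetric])
    finally have zero: "(\<Sum>X\<in>Pow Z. g X (Z - X)) = 0" by simp
    have "(\<Sum>t\<in>?I. \<Sum>t'\<in>?I. \<Phi> ((t, X) # (t', Y) # M)) = (\<Sum>t\<in>?I. \<Phi> ((t, X) # (t, Y) # M)) + g X Y" for X Y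
      unfolding g_def sum.distrib[symmetric]
    proof (rule sum.cong[OF refl])
      fix t assume "t \<in> ?I"
      then show "(\<Sum>t'\<in>?I. \<Phi> ((t, X) # (t', Y) # M)) = \<Phi> ((t, X) # (t, Y) # M)
          + (\<Sum>t'\<in>?I. if t = t' then 0 else \<Phi> ((t, X) # (t', Y) # M))"
        by (subst (1 2) sum.remove[of ?I t]) (auto intro!: sum.cong)
    qed
    then have "(\<Sum>X\<in>Pow Z. \<Sum>t\<in>?I. \<Sum>t'\<in>?I. \<Phi> ((t, X) # (t', Z - X) # M))
        = (\<Sum>X\<in>Pow Z. \<Sum>t\<in>?I. \<Phi> ((t, X) # (t, Z - X) # M)) + (\<Sum>X\<in>Pow Z. g X (Z - X))"
      by (simp add: sum.distrib)
    then show ?thesis using zero sum.swap[of "\<lambda>X t. \<Phi> ((t, X) # (t, Z - X) # M)" ?I "Pow Z"] by simp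
  qed
  have 1: "(\<Sum>X\<in>Pow Z. \<Sum>v\<in>labels c (Suc (Suc (length w))). \<Phi> (zip v (X # (Z - X) # w)))
      = (\<Sum>t\<in>?I. \<Sum>v\<in>labels c (length w). \<Sum>X\<in>Pow Z. \<Phi> ((t, X) # (t, Z - X) # zip v w))"
  proof -
    have "(\<Sum>X\<in>Pow Z. \<Sum>v\<in>labels c (Suc (Suc (length w))). \<Phi> (zip v (X # (Z - X) # w)))
        = (\<Sum>X\<in>Pow Z. \<Sum>v\<in>labels c (length w). \<Sum>t\<in>?I. \<Sum>t'\<in>?I. \<Phi> ((t, X) # (t', Z - X) # zip v w))"
      by (simp add: sum_labels_Cons sum.swap[of _ "labels c (length w)" ?I])
    also have "\<dots> = (\<Sum>v\<in>labels c (length w). \<Sum>X\<in>Pow Z. \<Sum>t\<in>?I. \<Sum>t'\<in>?I. \<Phi> ((t, X) # (t', Z - X) # zip v w))"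
      by (rule sum.swap)
    finally show ?thesis unfolding cancel by (simp add: sum.swap[of _ "labels c (length w)" ?I])
  qed
  have 2: "split_sum (\<lambda>M. \<Sum>v\<in>labels c (length M). \<Sum>t\<in>?I. \<Phi> ((t, Z) # zip v M)) w
      = (\<Sum>v\<in>labels c (length w). lsplit (\<lambda>M. \<Sum>t\<in>?I. \<Phi> ((t, Z) # M)) (zip v w))"
  proof (rule Cons.IH)
    fix xs t t' X Y ys assume "t \<noteq> (t' :: int)"
    then have "\<Phi> ((s, Z) # xs @ (t, X) # (t', Y) # ys) = - \<Phi> ((s, Z) # xs @ (t', Y) # (t, X) # ys)" for s
      using Cons.prems[of t t' "(s, Z) # xs" X Y ys] by simp
    then show "(\<Sum>s\<in>?I. \<Phi> ((s, Z) # xs @ (t, X) # (t', Y) # ys))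
        = - (\<Sum>s\<in>?I. \<Phi> ((s, Z) # xs @ (t', Y) # (t, X) # ys))"
      by (simp add: sum_negf)
  qed
  have 3: "(\<Sum>v\<in>labels c (length (Z # M)). \<Phi> (zip v (Z # M)))
      = (\<Sum>v\<in>labels c (length M). \<Sum>t\<in>?I. \<Phi> ((t, Z) # zip v M))" for M
    unfolding list.size add_0_right add_Suc_right sum_labels_Cons zip_Cons_Cons by (rule sum.swap)
  have "split_sum (\<lambda>w'. \<Sum>v\<in>labels c (length w'). \<Phi> (zip v w')) (Z # w) =
      (\<Sum>t\<in>?I. \<Sum>v\<in>labels c (length w). \<Sum>X\<in>Pow Z. \<Phi> ((t, X) # (t, Z - X) # zip v w))
      - (\<Sum>v\<in>labels c (length w). lsplit (\<lambda>M. \<Sum>t\<in>?I. \<Phi> ((t, Z) # M)) (zip v w))"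
    unfolding split_sum.simps 3 2 using 1 by simp
  then show ?case
    by (simp add: sum_labels_Cons sum_subtractf lsplit_sum sum.swap[of _ "labels c (length w)" ?I])
qed simp

lemma isort_labels:
  "fst ` set xs \<subseteq> {- int c..int c} \<Longrightarrow> fst ` set (isort neg xs) \<subseteq> {0..int c}"
  by (induction xs rule: rev_induct) (auto simp: ins_def below_def above_def)

text \<open>The letter \<open>X\<close> with label \<open>- s\<close> cancels against the letter \<open>- X\<close> with label \<open>s - 1\<close>; only label \<open>c\<close> survives.\<close>

lemma sum_ins_last:
  assumes "fst ` set L \<subseteq> {0..int c}"
  shows "(\<Sum>t\<in>{- int c..int c}. \<Sum>X\<in>Pow (ground n). ins_sign t L * f (map snd (ins neg_set (t, X) L)))
    = (\<Sum>X\<in>Pow (ground n). f (map snd L @ [X]))"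
proof -
  define H where "H s = (\<Sum>X\<in>Pow (ground n). (- 1) ^ length (above s L) *
      f (map snd (below s L) @ [X] @ map snd (above s L)))" for s
  have gr: "neg_set (ground n) = ground n" by (auto simp: ground_def image_iff intro: minus_minus[symmetric])
  have summand: "(\<Sum>X\<in>Pow (ground n). ins_sign t L * f (map snd (ins neg_set (t, X) L)))
      = (if t < 0 then - H (- t) else H (t + 1))" for t
  proof (cases "t < 0")
    case True
    have "H (- t) = (\<Sum>X\<in>Pow (ground n). (- 1) ^ length (above (- t) L) *
      f (map snd (below (- t) L) @ [neg_set X] @ map snd (above (- t) L)))"
      unfolding H_def by (subst (1) gr[symmetric], subst sum_Pow_neg_set) simp
    then show ?thesis using True by (simp add: ins_sign_def ins_def cutoff_def sum_negf)
  qed (simp add: ins_sign_def ins_def cutoff_def H_def)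
  have "(\<Sum>t\<in>{- int c..int c}. if t < 0 then - H (- t) else H (t + 1)) = H (int c + 1)"
  proof (induction c)
    case (Suc c)
    have "{- int (Suc c)..int (Suc c)} = insert (- int (Suc c)) (insert (int (Suc c)) {- int c..int c})" by auto
    then show ?case using Suc by (simp add: algebra_simps)
  qed simp
  moreover have "below (int c + 1) L = L" "above (int c + 1) L = []"
    using assms by (auto simp: below_def above_def filter_id_conv filter_empty_conv)
  ultimately show ?thesis by (simp add: summand H_def)
qed

text \<open>The two kinds of terms are treated separately. Splitting a letter commutes with sorting;
  a letter appended at the end, summed over its labels, contributes only as a last letter.\<close>

theorem word_boundary_adams: "word_boundary n (adams c f) w = adams c (word_boundary n f) w"
proof -
  let ?m = "length w" and ?I = "{- int c..int c}"
  let ?V = "sort_val neg_set (\<lambda>L. f (map snd L))"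
  have split: "split_sum (adams c f) w = (\<Sum>v\<in>labels c ?m. sort_val neg_set (lsplit (\<lambda>L. f (map snd L))) (zip v w))"
    unfolding adams_def lsplit_sort_val[symmetric]
    by (rule split_sum_adams) (rule sort_val_swap)
  have "(\<Sum>X\<in>Pow (ground n). adams c f (w @ [X]))
      = (\<Sum>v\<in>labels c ?m. \<Sum>X\<in>Pow (ground n). \<Sum>t\<in>?I. ?V (zip v w @ [(t, X)]))"
  proof -
    have "adams c f (w @ [X]) = (\<Sum>v\<in>labels c ?m. \<Sum>t\<in>?I. ?V (zip v w @ [(t, X)]))" for X
    proof -
      have "adams c f (w @ [X]) = (\<Sum>t\<in>?I. \<Sum>v\<in>labels c ?m. ?V (zip v w @ [(t, X)]))"
        unfolding adams_def length_append list.size add_0 add_Suc_right sum_labels_snoc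
        by (intro sum.cong refl) (auto simp: labels_def)
      then show ?thesis by (simp add: sum.swap[of _ ?I])
    qed
    then show ?thesis by (simp add: sum.swap[of _ "labels c ?m"])
  qed
  also have "\<dots> = (\<Sum>v\<in>labels c ?m. sort_val neg_set (\<lambda>L. \<Sum>X\<in>Pow (ground n). f (map snd L @ [X])) (zip v w))"
  proof (rule sum.cong[OF refl])
    fix v assume v: "v \<in> labels c ?m"
    have "fst ` set (zip v w) \<subseteq> {- int c..int c}"
      using v by (auto simp: labels_def dest: set_zip_leftD)
    from sum_ins_last[OF isort_labels[OF this], where n = n and f = f]
    show "(\<Sum>X\<in>Pow (ground n). \<Sum>t\<in>?I. ?V (zip v w @ [(t, X)]))
        = sort_val neg_set (\<lambda>L. \<Sum>X\<in>Pow (ground n). f (map snd L @ [X])) (zip v w)"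
      by (simp add: sort_val_snoc sum.swap[of _ "Pow (ground n)"])
        (simp add: sort_val_def sum_distrib_left[symmetric])
  qed
  finally have last: "(\<Sum>X\<in>Pow (ground n). adams c f (w @ [X])) = \<dots>" .
  have "adams c (word_boundary n f) w = (\<Sum>v\<in>labels c ?m.
      (- 1) ^ ?m * sort_val neg_set (\<lambda>L. \<Sum>X\<in>Pow (ground n). f (map snd L @ [X])) (zip v w)
      + sort_val neg_set (lsplit (\<lambda>L. f (map snd L))) (zip v w))"
    unfolding adams_def word_boundary_def
    by (rule sum.cong[OF refl])
      (auto simp: sort_val_def lsplit_map_snd labels_def algebra_simps)
  then show ?thesis
    unfolding word_boundary_def[of n "adams c f"] split last by (simp add: sum.distrib sum_distrib_left)
qed

section \<open>Signed permutations\<close>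

abbreviation pword :: "nat \<Rightarrow> (int \<Rightarrow> int) \<Rightarrow> int list" where
  "pword m \<pi> \<equiv> map \<pi> [1..int m]"

definition gen_prod :: "nat list \<Rightarrow> int \<Rightarrow> int" where
  "gen_prod w = foldr (\<lambda>i \<rho>. coxeter_generator i \<circ> \<rho>) w id"

lemma gen_prod_simps [simp]:
  "gen_prod [] = id" "gen_prod (i # w) = coxeter_generator i \<circ> gen_prod w"
  by (simp_all add: gen_prod_def)

lemma hyperoctahedral_odd:
  assumes "\<pi> \<in> hyperoctahedral m" shows "\<pi> (- k) = - \<pi> k"
proof (cases "k \<in> {- int m..int m}")
  case False
  then have "- k \<notin> {- int m..int m}" by auto
  then show ?thesis using assms False by (auto simp: hyperoctahedral_def permutes_def)
qed (use assms in \<open>auto simp: hyperoctahedral_def\<close>)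

lemma hyperoctahedral_0 [simp]: "\<pi> \<in> hyperoctahedral m \<Longrightarrow> \<pi> 0 = 0"
  using hyperoctahedral_odd[of \<pi> m 0] by simp

lemma hyperoctahedral_permutes: "\<pi> \<in> hyperoctahedral m \<Longrightarrow> \<pi> permutes {- int m..int m}"
  by (simp add: hyperoctahedral_def)

lemma hyperoctahedralI:
  "\<pi> permutes {- int m..int m} \<Longrightarrow> (\<And>k. \<pi> (- k) = - \<pi> k) \<Longrightarrow> \<pi> \<in> hyperoctahedral m"
  by (simp add: hyperoctahedral_def)

lemma finite_hyperoctahedral [simp]: "finite (hyperoctahedral m)"
  by (rule finite_subset[OF _ finite_permutations[of "{- int m..int m}"]])
    (auto simp: hyperoctahedral_def)

lemma id_hyperoctahedral [simp]: "id \<in> hyperoctahedral m"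
  by (auto simp: hyperoctahedral_def permutes_id)

lemma comp_hyperoctahedral:
  "\<pi> \<in> hyperoctahedral m \<Longrightarrow> \<rho> \<in> hyperoctahedral m \<Longrightarrow> \<pi> \<circ> \<rho> \<in> hyperoctahedral m"
  by (rule hyperoctahedralI)
    (simp_all add: permutes_compose hyperoctahedral_permutes hyperoctahedral_odd)

lemma inv_hyperoctahedral:
  assumes "\<pi> \<in> hyperoctahedral m" shows "inv \<pi> \<in> hyperoctahedral m"
proof (rule hyperoctahedralI)
  have p: "\<pi> permutes {- int m..int m}" using assms by (rule hyperoctahedral_permutes)
  then show "inv \<pi> permutes {- int m..int m}" by (rule permutes_inv)
  show "inv \<pi> (- k) = - inv \<pi> k" for k
    using hyperoctahedral_odd[OF assms, of "inv \<pi> k"] p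
    by (metis permutes_inverses(1) permutes_inverses(2))
qed

lemma hyperoctahedral_mem:
  assumes "\<pi> \<in> hyperoctahedral m" shows "\<bar>\<pi> k\<bar> \<le> int m \<longleftrightarrow> \<bar>k\<bar> \<le> int m"
  using permutes_in_image[OF hyperoctahedral_permutes[OF assms], of k] by auto

lemma hyperoctahedral_eq_0:
  assumes "\<pi> \<in> hyperoctahedral m" shows "\<pi> k = 0 \<longleftrightarrow> k = 0"
  using permutes_inj[OF hyperoctahedral_permutes[OF assms]] hyperoctahedral_0[OF assms]
  by (metis injD)

lemma hyperoctahedral_abs_inj:
  assumes "\<pi> \<in> hyperoctahedral m" "\<bar>\<pi> k\<bar> = \<bar>\<pi> l\<bar>" shows "\<bar>k\<bar> = \<bar>l\<bar>"
proof -
  have "\<pi> k = \<pi> l \<or> \<pi> k = \<pi> (- l)" using assms(2) hyperoctahedral_odd[OF assms(1), of l] by linarith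
  then have "k = l \<or> k = - l"
    using permutes_inj[OF hyperoctahedral_permutes[OF assms(1)]] by (auto dest: injD)
  then show ?thesis by auto
qed

section \<open>Generation by the Coxeter generators\<close>

lemma coxeter_generator_0: "coxeter_generator 0 k = (if \<bar>k\<bar> = 1 then - k else k)"
  by (auto simp: coxeter_generator_def transpose_def)

lemma coxeter_generator_pos:
  "i > 0 \<Longrightarrow> coxeter_generator i k =
    (if k = int i then int i + 1 else if k = int i + 1 then int i
     else if k = - int i then - int i - 1 else if k = - int i - 1 then - int i else k)"
  by (auto simp: coxeter_generator_def transpose_def)

lemma coxeter_generator_invol [simp]: "coxeter_generator i (coxeter_generator i k) = k"
  by (cases "i = 0") (auto simp: coxeter_generator_0 coxeter_generator_pos)

lemma coxeter_generator_hyperoctahedral: "i < m \<Longrightarrow> coxeter_generator i \<in> hyperoctahedral m"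
proof (rule hyperoctahedralI)
  assume i: "i < m"
  show "coxeter_generator i permutes {- int m..int m}"
  proof (rule bij_imp_permutes)
    show "bij_betw (coxeter_generator i) {- int m..int m} {- int m..int m}"
      by (rule bij_betw_byWitness[where f' = "coxeter_generator i"])
        (use i in \<open>cases "i = 0"; auto simp: coxeter_generator_0 coxeter_generator_pos split: if_splits\<close>)+
    show "coxeter_generator i x = x" if "x \<notin> {- int m..int m}" for x
      using i that by (cases "i = 0") (auto simp: coxeter_generator_0 coxeter_generator_pos)
  qed
qed (cases "i = 0"; auto simp: coxeter_generator_0 coxeter_generator_pos)

lemma gen_prod_hyperoctahedral: "set w \<subseteq> {..<m} \<Longrightarrow> gen_prod w \<in> hyperoctahedral m"
  by (induction w) (auto simp del: comp_apply intro!: comp_hyperoctahedral coxeter_generator_hyperoctahedral)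

text \<open>Every value below the maximum is raised by one by some generator, except that 0 is
  skipped by passing from -1 to 1.\<close>

lemma gen_prod_raise:
  assumes "1 \<le> \<bar>j\<bar>" "\<bar>j\<bar> \<le> int m"
  shows "\<exists>w. set w \<subseteq> {..<m} \<and> gen_prod w j = int m"
  using assms
proof (induction "nat (int m - j)" arbitrary: j rule: less_induct)
  case less
  have step: ?case if st: "i < m" "coxeter_generator i j = j'" "j' > j" "1 \<le> \<bar>j'\<bar>" "\<bar>j'\<bar> \<le> int m" for i j'
  proof -
    have "nat (int m - j') < nat (int m - j)" using that by linarith
    then obtain w where "set w \<subseteq> {..<m}" "gen_prod w j' = int m" using less.hyps[of j'] st by blast
    \<comment> \<open>The last generator of a word acts first.\<close>
    moreover have "gen_prod (w @ [i]) j = gen_prod w (coxeter_generator i j)" by (induction w) auto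
    ultimately show ?thesis using that by (intro exI[of _ "w @ [i]"]) auto
  qed
  consider "j = int m" | "0 < j" "j < int m" | "j = - 1" | "j < - 1" using less.prems by linarith
  then show ?case
  proof cases
    case 1 then show ?thesis by (intro exI[of _ "[]"]) auto
  next
    case 2 then show ?thesis by (intro step[of "nat j" "j + 1"]) (auto simp: coxeter_generator_pos)
  next
    case 3 then show ?thesis using less.prems by (intro step[of 0 1]) (auto simp: coxeter_generator_0)
  next
    case 4 then show ?thesis using less.prems
      by (intro step[of "nat (- j - 1)" "j + 1"]) (auto simp: coxeter_generator_pos)
  qed
qed

text \<open>Moving the image of the largest index back to its place leaves an element of the smaller
  group. Generators are involutions, so the reversed word undoes the move.\<close>

lemma hyperoctahedral_generated:
  "\<pi> \<in> hyperoctahedral m \<Longrightarrow> \<exists>w. set w \<subseteq> {..<m} \<and> gen_prod w = \<pi>"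
proof (induction m arbitrary: \<pi>)
  case 0
  have "\<pi> x = x" for x
    using permutes_not_in[OF hyperoctahedral_permutes[OF 0], of x] hyperoctahedral_0[OF 0] by (cases "x = 0") auto
  then show ?case by (intro exI[of _ "[]"]) auto
next
  case (Suc m)
  let ?M = "int (Suc m)"
  have M: "1 \<le> \<bar>\<pi> ?M\<bar>" "\<bar>\<pi> ?M\<bar> \<le> ?M"
    using hyperoctahedral_eq_0[OF Suc.prems, of ?M] hyperoctahedral_mem[OF Suc.prems, of ?M] by auto
  then obtain w where w: "set w \<subseteq> {..<Suc m}" "gen_prod w (\<pi> ?M) = ?M" using gen_prod_raise by blast
  define \<sigma> where "\<sigma> = gen_prod w \<circ> \<pi>"
  have \<sigma>: "\<sigma> \<in> hyperoctahedral (Suc m)"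
    unfolding \<sigma>_def using w(1) Suc.prems by (intro comp_hyperoctahedral gen_prod_hyperoctahedral)
  have fix1: "\<sigma> ?M = ?M" using w(2) by (simp add: \<sigma>_def)
  then have fix2: "\<sigma> (- ?M) = - ?M" using hyperoctahedral_odd[OF \<sigma>, of ?M] by simp
  have "\<sigma> \<in> hyperoctahedral m"
  proof (rule hyperoctahedralI)
    have "{- ?M..?M} - {- int m..int m} = {?M, - ?M}" by auto
    then show "\<sigma> permutes {- int m..int m}"
      using fix1 fix2 by (intro permutes_superset[OF hyperoctahedral_permutes[OF \<sigma>]]) auto
  qed (use hyperoctahedral_odd[OF \<sigma>] in auto)
  then obtain w' where w': "set w' \<subseteq> {..<m}" "gen_prod w' = \<sigma>" using Suc.IH by blast
  have "gen_prod (rev w @ w') = \<pi>" if "gen_prod w' = gen_prod w \<circ> \<pi>" for w' :: "nat list" and w \<pi>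
    using that
  proof (induction w arbitrary: w')
    case (Cons i w)
    have "gen_prod (i # w') = gen_prod w \<circ> \<pi>" using Cons.prems by (auto simp: fun_eq_iff)
    from Cons.IH[OF this] show ?case by simp
  qed simp
  from this[OF w'(2)[unfolded \<sigma>_def]] show ?case using w w' by (intro exI[of _ "rev w @ w'"]) auto
qed

text \<open>The sign character on one-line notation: the parity of the number of negative entries
  plus the number of inversions of absolute values. Unlike Coxeter length, it can be followed
  through insertion sort.\<close>

primrec word_sign :: "int list \<Rightarrow> complex" where
  "word_sign [] = 1"
| "word_sign (x # p) = (if x < 0 then - 1 else 1) *
     prod_list (map (\<lambda>y. if \<bar>y\<bar> < \<bar>x\<bar> then - 1 else 1) p) * word_sign p"

text \<open>An entry of largest absolute value is in inversion with everything behind it and with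
  nothing in front of it, which gives exactly the sign of an insertion.\<close>

lemma word_sign_insert:
  assumes "\<And>y. y \<in> set A \<union> set B \<Longrightarrow> \<bar>y\<bar> < \<bar>x\<bar>"
  shows "word_sign (A @ x # B) = (if x < 0 then - 1 else 1) * (- 1) ^ length B * word_sign (A @ B)"
  using assms
proof (induction A)
  case Nil
  have "prod_list (map (\<lambda>y. if \<bar>y\<bar> < \<bar>x\<bar> then - 1 else 1 :: complex) B) = (- 1) ^ length B"
    using Nil by (induction B) auto
  then show ?case by simp
next
  case (Cons a A)
  have "\<not> \<bar>x\<bar> < \<bar>a\<bar>" using Cons.prems[of a] by auto
  then show ?case using Cons by simp
qed

lemma word_sign_generator_0:
  assumes "distinct (map abs p)"
  shows "word_sign (map (coxeter_generator 0) p) = (if 1 \<in> abs ` set p then - 1 else 1) * word_sign p"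
  using assms
proof (induction p)
  case (Cons x p)
  have "\<bar>coxeter_generator 0 y\<bar> = \<bar>y\<bar>" for y by (simp add: coxeter_generator_0)
  then have *: "map (\<lambda>y. if \<bar>y\<bar> < \<bar>coxeter_generator 0 x\<bar> then - 1 else 1) (map (coxeter_generator 0) p)
      = map (\<lambda>y. if \<bar>y\<bar> < \<bar>x\<bar> then - 1 else 1 :: complex) p" by simp
  have s: "coxeter_generator 0 x < 0 \<longleftrightarrow> (if \<bar>x\<bar> = 1 then \<not> x < 0 else x < 0)"
    by (auto simp: coxeter_generator_0)
  have "distinct (map abs p)" "\<bar>x\<bar> \<notin> abs ` set p" using Cons.prems by auto
  moreover have "1 \<in> abs ` set (x # p) \<longleftrightarrow> \<bar>x\<bar> = 1 \<or> 1 \<in> abs ` set p" by auto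
  ultimately show ?case unfolding list.map word_sign.simps * s using Cons.IH by auto
qed simp

text \<open>Exchanging the absolute values \<open>i\<close> and \<open>i + 1\<close> affects only
  their mutual comparison, which is counted at whichever of the two comes first in the word.\<close>

lemma prod_list_generator:
  fixes x :: int
  assumes i: "i > 0" and d: "distinct (map abs p)" "\<bar>x\<bar> \<notin> abs ` set p"
  shows "prod_list (map (\<lambda>y. if \<bar>y\<bar> < \<bar>coxeter_generator i x\<bar> then - 1 else 1) (map (coxeter_generator i) p))
    = (if \<bar>x\<bar> = int i \<and> int i + 1 \<in> abs ` set p \<or> \<bar>x\<bar> = int i + 1 \<and> int i \<in> abs ` set p
       then - 1 else 1) * prod_list (map (\<lambda>y. if \<bar>y\<bar> < \<bar>x\<bar> then - 1 else 1 :: complex) p)"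
  using d
proof (induction p)
  case (Cons y p)
  have IH: "prod_list (map (\<lambda>y. if \<bar>y\<bar> < \<bar>coxeter_generator i x\<bar> then - 1 else 1) (map (coxeter_generator i) p))
    = (if \<bar>x\<bar> = int i \<and> int i + 1 \<in> abs ` set p \<or> \<bar>x\<bar> = int i + 1 \<and> int i \<in> abs ` set p
       then - 1 else 1) * prod_list (map (\<lambda>y. if \<bar>y\<bar> < \<bar>x\<bar> then - 1 else 1 :: complex) p)"
    using Cons by auto
  have ab: "\<bar>coxeter_generator i z\<bar> = (if \<bar>z\<bar> = int i then int i + 1 else if \<bar>z\<bar> = int i + 1 then int i else \<bar>z\<bar>)"
    for z using i by (auto simp: coxeter_generator_pos)
  have ne: "\<bar>x\<bar> \<noteq> \<bar>y\<bar>" "\<bar>y\<bar> \<notin> abs ` set p" using Cons.prems by auto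
  have *: "(if \<bar>coxeter_generator i y\<bar> < \<bar>coxeter_generator i x\<bar> then - 1 else 1 :: complex)
      = (if \<bar>x\<bar> = int i \<and> \<bar>y\<bar> = int i + 1 \<or> \<bar>x\<bar> = int i + 1 \<and> \<bar>y\<bar> = int i then - 1 else 1)
        * (if \<bar>y\<bar> < \<bar>x\<bar> then - 1 else 1)"
    unfolding ab using ne(1) by auto
  define A B where "A \<longleftrightarrow> int i \<in> abs ` set p" and "B \<longleftrightarrow> int i + 1 \<in> abs ` set p"
  have "int i \<in> abs ` set (y # p) \<longleftrightarrow> \<bar>y\<bar> = int i \<or> A"
    "int i + 1 \<in> abs ` set (y # p) \<longleftrightarrow> \<bar>y\<bar> = int i + 1 \<or> B" by (auto simp: A_def B_def)
  moreover have "\<bar>y\<bar> = int i \<Longrightarrow> \<not> A" "\<bar>y\<bar> = int i + 1 \<Longrightarrow> \<not> B" using ne(2) by (auto simp: A_def B_def)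
  ultimately show ?case
    unfolding list.map prod_list.Cons * IH A_def[symmetric] B_def[symmetric]
    by (cases A; cases B; cases "\<bar>y\<bar> = int i"; cases "\<bar>y\<bar> = int i + 1") auto
qed simp

lemma word_sign_generator_pos:
  assumes "i > 0" "distinct (map abs p)"
  shows "word_sign (map (coxeter_generator i) p)
    = (if int i \<in> abs ` set p \<and> int i + 1 \<in> abs ` set p then - 1 else 1) * word_sign p"
  using assms(2)
proof (induction p)
  case (Cons x p)
  have s: "coxeter_generator i x < 0 \<longleftrightarrow> x < 0" using assms(1) by (auto simp: coxeter_generator_pos)
  have d: "distinct (map abs p)" "\<bar>x\<bar> \<notin> abs ` set p" using Cons.prems by auto
  define A B where "A \<longleftrightarrow> int i \<in> abs ` set p" and "B \<longleftrightarrow> int i + 1 \<in> abs ` set p"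
  have "int i \<in> abs ` set (x # p) \<longleftrightarrow> \<bar>x\<bar> = int i \<or> A"
    "int i + 1 \<in> abs ` set (x # p) \<longleftrightarrow> \<bar>x\<bar> = int i + 1 \<or> B" by (auto simp: A_def B_def)
  moreover have "\<bar>x\<bar> = int i \<Longrightarrow> \<not> A" "\<bar>x\<bar> = int i + 1 \<Longrightarrow> \<not> B" using d(2) by (auto simp: A_def B_def)
  ultimately show ?case
    unfolding list.map word_sign.simps s prod_list_generator[OF assms(1) d] Cons.IH[OF d(1)]
      A_def[symmetric] B_def[symmetric]
    by (cases A; cases B; cases "\<bar>x\<bar> = int i"; cases "\<bar>x\<bar> = int i + 1") simp_all
qed simp

section \<open>Signed permutations in one-line notation\<close>

definition signed_words :: "nat \<Rightarrow> int list set" where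
  "signed_words m = {p. length p = m \<and> abs ` set p = {1..int m}}"

lemma signed_words_distinct: "p \<in> signed_words m \<Longrightarrow> distinct (map abs p)"
  by (rule card_distinct) (simp add: signed_words_def)

lemma pword_signed_words:
  assumes "\<pi> \<in> hyperoctahedral m" shows "pword m \<pi> \<in> signed_words m"
proof -
  have "(\<lambda>k. \<bar>\<pi> k\<bar>) ` {1..int m} = {1..int m}"
  proof (rule card_subset_eq)
    show "(\<lambda>k. \<bar>\<pi> k\<bar>) ` {1..int m} \<subseteq> {1..int m}"
    proof
      fix y assume "y \<in> (\<lambda>k. \<bar>\<pi> k\<bar>) ` {1..int m}"
      then obtain k where k: "y = \<bar>\<pi> k\<bar>" "1 \<le> k" "k \<le> int m" by auto
      then show "y \<in> {1..int m}"
        using hyperoctahedral_mem[OF assms, of k] hyperoctahedral_eq_0[OF assms, of k] by auto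
    qed
    have "inj_on (\<lambda>k. \<bar>\<pi> k\<bar>) {1..int m}"
      by (rule inj_onI, drule hyperoctahedral_abs_inj[OF assms]) auto
    then show "card ((\<lambda>k. \<bar>\<pi> k\<bar>) ` {1..int m}) = card {1..int m}" by (rule card_image)
  qed simp
  then show ?thesis by (simp add: signed_words_def image_image)
qed

lemma word_sign_generator:
  assumes "i < m" "p \<in> signed_words m"
  shows "word_sign (map (coxeter_generator i) p) = - word_sign p"
proof (cases "i = 0")
  case True
  then have "1 \<in> abs ` set p" using assms by (auto simp: signed_words_def)
  then show ?thesis using True word_sign_generator_0[OF signed_words_distinct[OF assms(2)]] by simp
next
  case False
  then have "int i \<in> abs ` set p" "int i + 1 \<in> abs ` set p" using assms by (auto simp: signed_words_def)
  then show ?thesis using False word_sign_generator_pos[OF _ signed_words_distinct[OF assms(2)]] by simp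
qed

lemma word_sign_gen_prod_comp:
  assumes "set w \<subseteq> {..<m}" "\<sigma> \<in> hyperoctahedral m"
  shows "word_sign (pword m (gen_prod w \<circ> \<sigma>)) = (- 1) ^ length w * word_sign (pword m \<sigma>)"
  using assms(1)
proof (induction w)
  case (Cons i w)
  have "gen_prod w \<circ> \<sigma> \<in> hyperoctahedral m"
    using Cons.prems assms(2) by (intro comp_hyperoctahedral gen_prod_hyperoctahedral) auto
  then have "word_sign (map (coxeter_generator i) (pword m (gen_prod w \<circ> \<sigma>)))
      = - word_sign (pword m (gen_prod w \<circ> \<sigma>))"
    using Cons.prems by (intro word_sign_generator[OF _ pword_signed_words]) auto
  moreover have "pword m (gen_prod (i # w) \<circ> \<sigma>) = map (coxeter_generator i) (pword m (gen_prod w \<circ> \<sigma>))"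
    by simp
  moreover have "word_sign (pword m (gen_prod w \<circ> \<sigma>)) = (- 1) ^ length w * word_sign (pword m \<sigma>)"
    using Cons.prems by (intro Cons.IH) simp
  ultimately show ?case by (simp only: list.size power_add) simp
qed simp

lemma word_sign_upto [simp]: "word_sign [1..int m] = 1"
proof (induction m)
  case (Suc m)
  have "[1..int (Suc m)] = [1..int m] @ [int (Suc m)]" by (simp add: upto_rec2)
  then show ?case using word_sign_insert[of "[1..int m]" "[]" "int (Suc m)"] Suc by auto
qed simp

text \<open>Every generator reverses \<open>word_sign\<close>, so all generating words of a
  permutation have the same parity, and a shortest one is among them.\<close>

lemma coxeter_length_sign:
  assumes "\<pi> \<in> hyperoctahedral m"
  shows "(- 1) ^ coxeter_length m \<pi> = word_sign (pword m \<pi>)"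
proof -
  have "\<exists>l w. length w = l \<and> set w \<subseteq> {..<m} \<and> gen_prod w = \<pi>"
    using hyperoctahedral_generated[OF assms] by blast
  then have "\<exists>w. length w = coxeter_length m \<pi> \<and> set w \<subseteq> {..<m} \<and> gen_prod w = \<pi>"
    unfolding coxeter_length_def gen_prod_def[symmetric] by (rule LeastI_ex)
  then obtain w where w: "length w = coxeter_length m \<pi>" "set w \<subseteq> {..<m}" "gen_prod w = \<pi>" by blast
  show ?thesis
    using word_sign_gen_prod_comp[OF w(2) id_hyperoctahedral] w by simp
qed

lemma word_sign_comp:
  assumes "\<pi> \<in> hyperoctahedral m" "\<sigma> \<in> hyperoctahedral m"
  shows "word_sign (pword m (\<pi> \<circ> \<sigma>)) = word_sign (pword m \<pi>) * word_sign (pword m \<sigma>)"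
proof -
  obtain w where w: "set w \<subseteq> {..<m}" "gen_prod w = \<pi>" using hyperoctahedral_generated[OF assms(1)] by blast
  then show ?thesis
    using word_sign_gen_prod_comp[OF w(1) id_hyperoctahedral] word_sign_gen_prod_comp[OF w(1) assms(2)]
    by simp
qed

lemma pword_bij: "bij_betw (pword m) (hyperoctahedral m) (signed_words m)"
proof (rule bij_betw_imageI)
  show "inj_on (pword m) (hyperoctahedral m)"
  proof (rule inj_onI)
    fix \<pi> \<rho> assume A: "\<pi> \<in> hyperoctahedral m" "\<rho> \<in> hyperoctahedral m" "pword m \<pi> = pword m \<rho>"
    have pos: "\<pi> k = \<rho> k" if "1 \<le> k" "k \<le> int m" for k using A(3) that by auto
    show "\<pi> = \<rho>"
    proof
      fix k
      consider "k = 0" | "1 \<le> k" "k \<le> int m" | "1 \<le> - k" "- k \<le> int m" | "k \<notin> {- int m..int m}"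
        by fastforce
      then show "\<pi> k = \<rho> k"
      proof cases
        case 3 then show ?thesis using pos[of "- k"] A by (simp add: hyperoctahedral_odd)
      next
        case 4 then show ?thesis
          using permutes_not_in[OF hyperoctahedral_permutes[OF A(1)]]
            permutes_not_in[OF hyperoctahedral_permutes[OF A(2)]] by simp
      qed (use A pos in auto)
    qed
  qed
  show "pword m ` hyperoctahedral m = signed_words m"
  proof (intro equalityI subsetI)
    fix p assume p: "p \<in> signed_words m"
    define \<pi> where "\<pi> k = (if 1 \<le> k \<and> k \<le> int m then p ! nat (k - 1)
      else if 1 \<le> - k \<and> - k \<le> int m then - p ! nat (- k - 1) else k)" for k
    have len: "length p = m" and set_p: "abs ` set p = {1..int m}" using p by (auto simp: signed_words_def)
    have odd: "\<pi> (- k) = - \<pi> k" for k by (auto simp: \<pi>_def)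
    have bd: "1 \<le> \<bar>p ! i\<bar> \<and> \<bar>p ! i\<bar> \<le> int m" if "i < m" for i
      using set_p nth_mem[of i p] that len by (metis atLeastAtMost_iff imageI)
    have surj: "\<pi> ` {- int m..int m} = {- int m..int m}"
    proof (intro equalityI subsetI)
      fix y assume "y \<in> \<pi> ` {- int m..int m}"
      then obtain k where k: "y = \<pi> k" "k \<in> {- int m..int m}" by blast
      have "nat (k - 1) < m" if "1 \<le> k" using that k by auto
      moreover have "nat (- k - 1) < m" if "1 \<le> - k" using that k by auto
      ultimately show "y \<in> {- int m..int m}"
        using k bd[of "nat (k - 1)"] bd[of "nat (- k - 1)"] unfolding \<pi>_def atLeastAtMost_iff
        by (smt (verit))
    next
      fix y assume y: "y \<in> {- int m..int m}"
      show "y \<in> \<pi> ` {- int m..int m}"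
      proof (cases "y = 0")
        case True
        then show ?thesis by (intro image_eqI[of _ _ 0]) (auto simp: \<pi>_def)
      next
        case False
        then have "\<bar>y\<bar> \<in> abs ` set p" using y set_p by auto
        then obtain i where i: "i < m" "\<bar>p ! i\<bar> = \<bar>y\<bar>" using len by (auto simp: in_set_conv_nth)
        have "\<pi> (int i + 1) = p ! i" using i by (auto simp: \<pi>_def)
        then have "y = \<pi> (int i + 1) \<or> y = \<pi> (- (int i + 1))" using i odd[of "int i + 1"] by linarith
        then show ?thesis using i by force
      qed
    qed
    have "\<pi> permutes {- int m..int m}"
    proof (rule bij_imp_permutes)
      show "bij_betw \<pi> {- int m..int m} {- int m..int m}"
        unfolding bij_betw_def by (simp add: surj eq_card_imp_inj_on)
    qed (auto simp: \<pi>_def)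
    then have "\<pi> \<in> hyperoctahedral m" using odd by (rule hyperoctahedralI)
    moreover have "pword m \<pi> = p"
      by (rule nth_equalityI) (auto simp: len \<pi>_def)
    ultimately show "p \<in> pword m ` hyperoctahedral m" by blast
  qed (use pword_signed_words in blast)
qed

section \<open>Standardisation\<close>

text \<open>Position \<open>k\<close> of a word stands for a block and \<open>- k\<close> for its
  negative, which carries the opposite label.\<close>

definition odd_ext :: "int list \<Rightarrow> int \<Rightarrow> int" where
  "odd_ext v k = (if k > 0 then v ! (nat k - 1) else if k < 0 then - v ! (nat (- k) - 1) else 0)"

lemma odd_ext_uminus: "odd_ext v (- k) = - odd_ext v k"
  by (simp add: odd_ext_def)

lemma odd_ext_0 [simp]: "odd_ext v 0 = 0"
  by (simp add: odd_ext_def)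

text \<open>Sorting the positions 1, ..., m in place of blocks records the signed permutation that
  the sort performs on any word.\<close>

definition sorted_labels :: "int list \<Rightarrow> (int \<times> int) list" where
  "sorted_labels v = isort uminus (zip v [1..int (length v)])"

text \<open>Sorting looks only at labels, so it commutes with renaming the letters.\<close>

lemma isort_map:
  assumes "\<And>x. x \<in> snd ` set xs \<Longrightarrow> h (neg x) = neg' (h x)"
  shows "isort neg' (map (apsnd h) xs) = map (apsnd h) (isort neg xs) \<and>
    isort_sign neg' (map (apsnd h) xs) = isort_sign neg xs"
  using assms
proof (induction xs rule: rev_induct)
  case (snoc p xs)
  have fm: "below s (map (apsnd h) L) = map (apsnd h) (below s L)"
    "above s (map (apsnd h) L) = map (apsnd h) (above s L)" for s L
    by (simp_all add: below_def above_def filter_map comp_def)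
  have "h (neg (snd p)) = neg' (h (snd p))" using snoc.prems by simp
  then show ?case using snoc
    by (simp add: ins_def ins_sign_def fm)
qed simp

text \<open>Insertion sort orders lexicographically by label and signed position, keeping from each
  pair \<open>p\<close>, \<open>- p\<close> the member above zero. The new position is largest in
  absolute value, so among equal labels it goes last when kept and first when negated, as the
  thresholds prescribe.\<close>

lemma sorted_labels_props:
  "set (sorted_labels v) = {(odd_ext v p, p) | p. 1 \<le> \<bar>p\<bar> \<and> \<bar>p\<bar> \<le> int (length v) \<and> (0, 0) < (odd_ext v p, p)}
   \<and> sorted_wrt (<) ((0, 0) # sorted_labels v)
   \<and> isort_sign uminus (zip v [1..int (length v)]) = word_sign (map snd (sorted_labels v))"
proof (induction v rule: rev_induct)
  case Nil
  then show ?case by (auto simp: sorted_labels_def)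
next
  case (snoc t v)
  define M where "M = int (length v) + 1"
  define L where "L = sorted_labels v"
  define A where "A = below (cutoff t) L"
  define B where "B = above (cutoff t) L"
  define z where "z = (\<bar>t\<bar>, if t < 0 then - M else M)"
  have setL: "set L = {(odd_ext v p, p) | p. 1 \<le> \<bar>p\<bar> \<and> \<bar>p\<bar> \<le> int (length v) \<and> (0, 0) < (odd_ext v p, p)}"
    and srt: "sorted_wrt (<) ((0, 0) # L)"
    and sgn: "isort_sign uminus (zip v [1..int (length v)]) = word_sign (map snd L)"
    using snoc by (simp_all add: L_def)
  have "[1..int (length (v @ [t]))] = [1..int (length v)] @ [M]" by (simp add: upto_rec2 M_def)
  then have zip: "zip (v @ [t]) [1..int (length (v @ [t]))] = zip v [1..int (length v)] @ [(t, M)]" by simp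
  have new: "sorted_labels (v @ [t]) = A @ z # B"
    unfolding sorted_labels_def[of "v @ [t]"] zip
    by (simp add: ins_def A_def B_def z_def L_def sorted_labels_def)
  have small: "\<bar>snd x\<bar> < M \<and> (0, 0) < x" if "x \<in> set L" for x using that setL by (auto simp: M_def)
  have AB: "set A \<union> set B = set L" "\<And>x. x \<in> set A \<Longrightarrow> fst x < cutoff t" "\<And>x. x \<in> set B \<Longrightarrow> \<not> fst x < cutoff t"
    by (auto simp: A_def B_def below_def above_def)
  have "set (A @ z # B) = insert z (set L)" using AB(1) by auto
  also have "\<dots> = {(odd_ext (v @ [t]) p, p) | p. 1 \<le> \<bar>p\<bar> \<and> \<bar>p\<bar> \<le> int (length (v @ [t])) \<and> (0, 0) < (odd_ext (v @ [t]) p, p)}"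
    (is "_ = ?R")
  proof -
    have old: "odd_ext (v @ [t]) p = odd_ext v p" if "\<bar>p\<bar> \<le> int (length v)" for p
      using that by (auto simp: odd_ext_def nth_append)
    have top: "odd_ext (v @ [t]) M = t" "odd_ext (v @ [t]) (- M) = - t"
      by (auto simp: odd_ext_def M_def nth_append nat_add_distrib)
    have "z \<in> ?R"
      using top by (cases "t < 0") (auto simp: z_def M_def)
    moreover have "set L \<subseteq> ?R" unfolding setL using old by fastforce
    moreover have "?R \<subseteq> insert z (set L)"
    proof
      fix x assume "x \<in> ?R"
      then obtain p where p: "x = (odd_ext (v @ [t]) p, p)" "1 \<le> \<bar>p\<bar>" "\<bar>p\<bar> \<le> int (length v) + 1" "(0, 0) < x" by auto
      consider "\<bar>p\<bar> \<le> int (length v)" | "p = M" | "p = - M" using p(2,3) unfolding M_def by linarith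
      then show "x \<in> insert z (set L)"
      proof cases
        case 1 then show ?thesis using p old[OF 1] unfolding setL by auto
      next
        case 2 then show ?thesis using p top by (auto simp: z_def)
      next
        case 3 then show ?thesis using p top by (auto simp: z_def M_def)
      qed
    qed
    ultimately show ?thesis by blast
  qed
  finally have 1: "set (A @ z # B) = ?R" .
  have "sorted_wrt (<) ((0, 0) # A @ z # B)"
  proof -
    have z0: "(0, 0) < z" by (auto simp: z_def M_def)
    have "sorted_wrt (<) A" "sorted_wrt (<) B"
      using srt by (auto simp: A_def B_def below_def above_def sorted_wrt_filter)
    moreover have "x < z" if "x \<in> set A" for x
    proof -
      have "x \<in> set L" using that AB(1) by blast
      moreover obtain a b where "x = (a, b)" by force
      ultimately show ?thesis using AB(2)[OF that] small[of x] by (auto simp: z_def cutoff_def split: if_splits)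
    qed
    moreover have "z < y" if "y \<in> set B" for y
    proof -
      have "y \<in> set L" using that AB(1) by blast
      moreover obtain a b where "y = (a, b)" by force
      ultimately show ?thesis using AB(3)[OF that] small[of y] by (auto simp: z_def cutoff_def split: if_splits)
    qed
    moreover have "x < y" if "x \<in> set A" "y \<in> set B" for x y
      using calculation(3)[OF that(1)] calculation(4)[OF that(2)] by (rule less_trans)
    ultimately show ?thesis using small AB(1) z0 by (auto simp: sorted_wrt_append)
  qed
  moreover have "isort_sign uminus (zip (v @ [t]) [1..int (length (v @ [t]))]) = word_sign (map snd (A @ z # B))"
  proof -
    have L: "L = A @ B" unfolding A_def B_def
      by (rule below_append_above[symmetric]) (simp add: L_def sorted_labels_def sorted_isort)
    have "isort_sign uminus (zip (v @ [t]) [1..int (length (v @ [t]))]) = word_sign (map snd L) * ins_sign t L"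
      unfolding zip by (simp add: sgn) (simp add: L_def sorted_labels_def)
    also have "\<dots> = word_sign (map snd A @ snd z # map snd B)"
    proof -
      have "\<bar>y\<bar> < \<bar>snd z\<bar>" if y: "y \<in> set (map snd A) \<union> set (map snd B)" for y
      proof -
        have "y \<in> snd ` set L" using y AB(1) by auto
        then have "\<bar>y\<bar> < M" using small by blast
        then show ?thesis by (simp add: z_def)
      qed
      then have "word_sign (map snd A @ snd z # map snd B)
          = (if snd z < 0 then - 1 else 1) * (- 1) ^ length (map snd B) * word_sign (map snd A @ map snd B)"
        by (rule word_sign_insert)
      moreover have "snd z < 0 \<longleftrightarrow> t < 0" by (simp add: z_def M_def)
      moreover have "ins_sign t L = (if t < 0 then - 1 else 1) * (- 1) ^ length B"
        by (simp add: ins_sign_def B_def)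
      moreover have "map snd L = map snd A @ map snd B" by (subst L) simp
      ultimately show ?thesis by simp
    qed
    finally show ?thesis by simp
  qed
  ultimately show ?case using 1 unfolding new by blast
qed

lemma length_sorted_labels [simp]: "length (sorted_labels v) = length v"
  by (simp add: sorted_labels_def)

lemma sorted_labels_signed_words: "map snd (sorted_labels v) \<in> signed_words (length v)"
proof -
  let ?m = "int (length v)"
  have S: "set (sorted_labels v) = {(odd_ext v p, p) | p. 1 \<le> \<bar>p\<bar> \<and> \<bar>p\<bar> \<le> ?m \<and> (0, 0) < (odd_ext v p, p)}"
    using sorted_labels_props[of v] by blast
  have "abs ` snd ` set (sorted_labels v) = {1..?m}"
  proof (intro equalityI subsetI)
    fix k assume k: "k \<in> {1..?m}"
    then have "(0, 0) < (odd_ext v k, k) \<or> (0, 0) < (odd_ext v (- k), - k)"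
      by (auto simp: odd_ext_uminus)
    then have "(odd_ext v k, k) \<in> set (sorted_labels v) \<or> (odd_ext v (- k), - k) \<in> set (sorted_labels v)"
      unfolding S using k by auto
    then show "k \<in> abs ` snd ` set (sorted_labels v)"
    proof
      assume "(odd_ext v k, k) \<in> set (sorted_labels v)"
      then show ?thesis using k by (intro image_eqI[of _ _ k] image_eqI[of _ snd]) auto
    next
      assume "(odd_ext v (- k), - k) \<in> set (sorted_labels v)"
      then show ?thesis using k by (intro image_eqI[of _ _ "- k"] image_eqI[of _ snd]) auto
    qed
  qed (auto simp: S)
  then show ?thesis by (simp add: signed_words_def)
qed

text \<open>The standardisation of a labelling: the signed permutation that lists the positions in
  sorted order.\<close>

definition std :: "int list \<Rightarrow> int \<Rightarrow> int" where
  "std v = inv_into (hyperoctahedral (length v)) (pword (length v)) (map snd (sorted_labels v))"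

lemma std_hyperoctahedral [simp]: "std v \<in> hyperoctahedral (length v)"
  unfolding std_def by (rule inv_into_into)
    (use pword_bij[of "length v"] sorted_labels_signed_words[of v] in \<open>auto simp: bij_betw_def\<close>)

lemma pword_std: "pword (length v) (std v) = map snd (sorted_labels v)"
proof -
  have "map snd (sorted_labels v) \<in> pword (length v) ` hyperoctahedral (length v)"
    using pword_bij[of "length v"] sorted_labels_signed_words[of v] by (simp add: bij_betw_def)
  then show ?thesis unfolding std_def by (rule f_inv_into_f)
qed

text \<open>Index 0 is included. For a signed permutation its pair is zero, which makes all labels
  read along it nonnegative and settles label 0 in favour of positive positions.\<close>

definition ranked :: "nat \<Rightarrow> int list \<Rightarrow> (int \<Rightarrow> int) \<Rightarrow> bool" where
  "ranked m v \<pi> \<longleftrightarrow> (\<forall>k l. 0 \<le> k \<and> k < l \<and> l \<le> int m \<longrightarrow> (odd_ext v (\<pi> k), \<pi> k) < (odd_ext v (\<pi> l), \<pi> l))"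

lemma ranked_sorted:
  assumes "\<pi> \<in> hyperoctahedral m"
  shows "ranked m v \<pi> \<longleftrightarrow> sorted_wrt (<) ((0, 0) # map (\<lambda>k. (odd_ext v (\<pi> k), \<pi> k)) [1..int m])"
proof -
  have "(0, 0) # map (\<lambda>k. (odd_ext v (\<pi> k), \<pi> k)) [1..int m] = map (\<lambda>k. (odd_ext v (\<pi> k), \<pi> k)) [0..int m]"
    using assms by (simp add: upto_rec1)
  then have eq: "sorted_wrt (<) ((0, 0) # map (\<lambda>k. (odd_ext v (\<pi> k), \<pi> k)) [1..int m])
    \<longleftrightarrow> (\<forall>i j. i < j \<longrightarrow> j < Suc m \<longrightarrow> (odd_ext v (\<pi> (int i)), \<pi> (int i)) < (odd_ext v (\<pi> (int j)), \<pi> (int j)))"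
    by (simp add: sorted_wrt_iff_nth_less nat_add_distrib del: less_prod_simp)
  show ?thesis unfolding eq ranked_def
  proof (intro iffI allI impI)
    fix k l assume A: "\<forall>i j. i < j \<longrightarrow> j < Suc m \<longrightarrow> (odd_ext v (\<pi> (int i)), \<pi> (int i)) < (odd_ext v (\<pi> (int j)), \<pi> (int j))"
      and "0 \<le> k \<and> k < l \<and> l \<le> int m"
    then show "(odd_ext v (\<pi> k), \<pi> k) < (odd_ext v (\<pi> l), \<pi> l)"
      using A[rule_format, of "nat k" "nat l"] by auto
  qed auto
qed

lemma sorted_labels_std:
  "sorted_labels v = map (\<lambda>k. (odd_ext v (std v k), std v k)) [1..int (length v)]"
proof -
  have "sorted_labels v = map (\<lambda>p. (odd_ext v p, p)) (map snd (sorted_labels v))"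
    unfolding list.map_comp using sorted_labels_props[of v] by (intro map_idI[symmetric]) auto
  then show ?thesis unfolding pword_std[symmetric] by (simp add: comp_def)
qed

lemma ranked_std: "ranked (length v) v (std v)"
  using sorted_labels_props[of v] by (simp add: ranked_sorted sorted_labels_std del: less_prod_simp)

text \<open>A strictly sorted list is determined by its set of entries, and both lists consist of
  the pairs above zero.\<close>

lemma std_unique:
  assumes \<pi>: "\<pi> \<in> hyperoctahedral m" and v: "length v = m" and r: "ranked m v \<pi>"
  shows "std v = \<pi>"
proof -
  let ?L = "map (\<lambda>k. (odd_ext v (\<pi> k), \<pi> k)) [1..int m]"
  have srt: "sorted_wrt (<) ((0, 0) # ?L)" using r ranked_sorted[OF \<pi>] by simp
  have gt: "(0, 0) < (odd_ext v (\<pi> k), \<pi> k)" if "1 \<le> k" "k \<le> int m" for k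
    using r[unfolded ranked_def, rule_format, of 0 k] that \<pi> by auto
  have "set ?L = set (sorted_labels v)"
  proof (intro equalityI subsetI)
    fix x assume "x \<in> set ?L"
    then obtain k where k: "1 \<le> k" "k \<le> int m" "x = (odd_ext v (\<pi> k), \<pi> k)" by auto
    then have "1 \<le> \<bar>\<pi> k\<bar>" "\<bar>\<pi> k\<bar> \<le> int m"
      using hyperoctahedral_mem[OF \<pi>, of k] hyperoctahedral_eq_0[OF \<pi>, of k] by auto
    then show "x \<in> set (sorted_labels v)" using sorted_labels_props[of v] v k gt by blast
  next
    fix x assume "x \<in> set (sorted_labels v)"
    then obtain p where p: "x = (odd_ext v p, p)" "1 \<le> \<bar>p\<bar>" "\<bar>p\<bar> \<le> int m" "(0, 0) < (odd_ext v p, p)"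
      using sorted_labels_props[of v] v by blast
    obtain k where k: "p = \<pi> k" using permutes_surj[OF hyperoctahedral_permutes[OF \<pi>]] by (metis surjD)
    have km: "\<bar>k\<bar> \<le> int m" "k \<noteq> 0" using p k hyperoctahedral_mem[OF \<pi>, of k] hyperoctahedral_eq_0[OF \<pi>, of k] by auto
    \<comment> \<open>For a negative index the opposite one would carry a pair above zero, and
      oddness would put the pair of \<open>p\<close> below zero.\<close>
    have "k > 0"
    proof (rule ccontr)
      assume "\<not> k > 0"
      then have "(0, 0) < (odd_ext v (\<pi> (- k)), \<pi> (- k))" using km by (intro gt) auto
      then show False using p(4) by (auto simp: k hyperoctahedral_odd[OF \<pi>] odd_ext_uminus)
    qed
    then show "x \<in> set ?L" using p(1) k km by auto
  qed
  moreover have "sorted_wrt (<) (sorted_labels v)" using sorted_labels_props[of v] by simp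
  ultimately have "sorted_labels v = ?L" using srt by (intro strict_sorted_equal) auto
  then have "pword m (std v) = pword m \<pi>" using pword_std[of v] v by (simp add: comp_def)
  then show ?thesis using pword_bij[of m] std_hyperoctahedral[of v] \<pi> v
    by (auto simp: bij_betw_def dest: inj_onD)
qed

lemma signed_block_uminus: "k > 0 \<Longrightarrow> signed_block w (- k) = neg_set (signed_block w k)"
  by (simp add: signed_block_def)

lemma signed_block_pword:
  assumes "\<pi> \<in> hyperoctahedral m" "1 \<le> \<bar>k\<bar>" "\<bar>k\<bar> \<le> int m"
  shows "signed_block (map (signed_block w) (pword m \<pi>)) k = signed_block w (\<pi> k)"
proof (cases "k > 0")
  case True
  then show ?thesis using assms by (simp add: signed_block_def nth_map)
next
  case False
  then have "signed_block (map (signed_block w) (pword m \<pi>)) k = neg_set (signed_block w (- \<pi> k))"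
    using assms hyperoctahedral_odd[OF assms(1), of k] by (simp add: signed_block_def[of "map _ _"] nth_map)
  moreover have "\<pi> k \<noteq> 0" using assms hyperoctahedral_eq_0[OF assms(1), of k] by auto
  ultimately show ?thesis
    using signed_block_uminus[of "\<pi> k" w] signed_block_uminus[of "- \<pi> k" w] by (cases "\<pi> k > 0") auto
qed

text \<open>Expressing the sort by a signed permutation makes composition of Adams operations
  accessible.\<close>

lemma adams_std:
  assumes "length w = m"
  shows "adams c f w = (\<Sum>v\<in>labels c m. word_sign (pword m (std v)) * f (map (signed_block w) (pword m (std v))))"
  unfolding adams_def assms
proof (rule sum.cong[OF refl])
  fix v assume "v \<in> labels c m"
  then have v: "length v = m" by (simp add: labels_def)
  let ?xs = "zip v [1..int m]"
  have w: "w = map (signed_block w) [1..int m]"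
    by (rule nth_equalityI) (auto simp: assms signed_block_def nat_add_distrib)
  have "zip v w = zip v (map (signed_block w) [1..int m])" using w by (rule arg_cong)
  also have "\<dots> = map (apsnd (signed_block w)) ?xs"
    unfolding zip_map2 by (intro map_cong) auto
  finally have "zip v w = map (apsnd (signed_block w)) ?xs" .
  moreover have "isort neg_set (map (apsnd (signed_block w)) ?xs) = map (apsnd (signed_block w)) (isort uminus ?xs) \<and>
      isort_sign neg_set (map (apsnd (signed_block w)) ?xs) = isort_sign uminus ?xs"
    by (rule isort_map) (auto dest!: set_zip_rightD intro!: signed_block_uminus)
  ultimately show "sort_val neg_set (\<lambda>L. f (map snd L)) (zip v w)
      = word_sign (pword m (std v)) * f (map (signed_block w) (pword m (std v)))"
    using sorted_labels_props[of v] pword_std[of v] v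
    by (simp add: sort_val_def sorted_labels_def comp_def)
qed

subsection \<open>Composition\<close>

definition relabel :: "nat \<Rightarrow> (int \<Rightarrow> int) \<Rightarrow> int list \<Rightarrow> int list" where
  "relabel m \<tau> a = map (\<lambda>k. odd_ext a (\<tau> k)) [1..int m]"

lemma length_relabel [simp]: "length (relabel m \<tau> a) = m"
  by (simp add: relabel_def)

lemma odd_ext_map:
  assumes "\<bar>k\<bar> \<le> int m" "\<And>k. g (- k) = - g k"
  shows "odd_ext (map g [1..int m]) k = g k"
proof -
  have "g 0 = 0" using assms(2)[of 0] by simp
  then show ?thesis using assms(1) assms(2)[of k] by (auto simp: odd_ext_def nth_map)
qed

lemma odd_ext_relabel:
  assumes "\<tau> \<in> hyperoctahedral m" "\<bar>k\<bar> \<le> int m"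
  shows "odd_ext (relabel m \<tau> a) k = odd_ext a (\<tau> k)"
  unfolding relabel_def using assms
  by (intro odd_ext_map) (auto simp: hyperoctahedral_odd odd_ext_uminus)

lemma list_eq_odd_extI:
  assumes "length a = m" "length b = m" "\<And>k. 1 \<le> k \<Longrightarrow> k \<le> int m \<Longrightarrow> odd_ext a k = odd_ext b k"
  shows "a = b"
proof (rule nth_equalityI)
  fix i assume "i < length a"
  then show "a ! i = b ! i" using assms(3)[of "int i + 1"] assms(1) by (auto simp: odd_ext_def nat_add_distrib)
qed (use assms in simp)

lemma labels_odd_ext:
  assumes "v \<in> labels c m" "\<bar>k\<bar> \<le> int m" shows "\<bar>odd_ext v k\<bar> \<le> int c"
proof -
  have "\<bar>v ! i\<bar> \<le> int c" if "i < m" for i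
  proof -
    have "v ! i \<in> {- int c..int c}" using assms(1) that nth_mem[of i v] unfolding labels_def by blast
    then show ?thesis by auto
  qed
  from this[of "nat k - 1"] this[of "nat (- k) - 1"] show ?thesis using assms(2) by (auto simp: odd_ext_def)
qed

lemma labelsI:
  assumes "length v = m" "\<And>k. 1 \<le> k \<Longrightarrow> k \<le> int m \<Longrightarrow> \<bar>odd_ext v k\<bar> \<le> int c"
  shows "v \<in> labels c m"
proof -
  have "x \<in> {- int c..int c}" if "x \<in> set v" for x
  proof -
    obtain i where "i < m" "x = v ! i" using \<open>x \<in> set v\<close> assms(1) by (auto simp: in_set_conv_nth)
    then show ?thesis using assms(2)[of "int i + 1"] by (auto simp: odd_ext_def nat_add_distrib)
  qed
  then show ?thesis using assms(1) by (auto simp: labels_def)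
qed

text \<open>Two-digit numbers in base \<open>2 a + 1\<close> with balanced digits. The low digit is
  \<open>v\<close>; the high digit is \<open>u\<close>, read at the place to which \<open>v\<close>
  sorts a position.\<close>

definition compose_labels :: "nat \<Rightarrow> nat \<Rightarrow> int list \<Rightarrow> int list \<Rightarrow> int list" where
  "compose_labels m a v u = map (\<lambda>k. (2 * int a + 1) * odd_ext u (inv (std v) k) + odd_ext v k) [1..int m]"

lemma odd_ext_compose_labels:
  assumes "length v = m" "\<bar>k\<bar> \<le> int m"
  shows "odd_ext (compose_labels m a v u) k = (2 * int a + 1) * odd_ext u (inv (std v) k) + odd_ext v k"
  unfolding compose_labels_def
  by (rule odd_ext_map[OF assms(2)])
    (use hyperoctahedral_odd[OF inv_hyperoctahedral[OF std_hyperoctahedral[of v]]] in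
      \<open>simp add: odd_ext_uminus algebra_simps\<close>)

text \<open>Sorting by two-digit labels means sorting by the low digit and then by the high digit; a
  tie in the high digit falls back to the order produced by \<open>v\<close>.\<close>

lemma std_compose_labels:
  assumes v: "v \<in> labels a m" and u: "u \<in> labels b m"
  shows "std (compose_labels m a v u) = std v \<circ> std u"
proof (rule std_unique)
  have len: "length v = m" "length u = m" using v u by (auto simp: labels_def)
  have B: "std v \<in> hyperoctahedral m" "std u \<in> hyperoctahedral m"
    using std_hyperoctahedral[of v] std_hyperoctahedral[of u] len by auto
  then show "std v \<circ> std u \<in> hyperoctahedral m" by (rule comp_hyperoctahedral)
  show "length (compose_labels m a v u) = m" by (simp add: compose_labels_def)
  have inv: "inv (std v) (std v k) = k" for k
    using permutes_inverses(2)[OF hyperoctahedral_permutes[OF B(1)]] .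
  \<comment> \<open>Places in the image of \<open>std u\<close> may be negative, so the ranking is
    extended to them by oddness.\<close>
  have rv: "(odd_ext v (std v k), std v k) < (odd_ext v (std v l), std v l)"
    if "- int m \<le> k" "k < l" "l \<le> int m" for k l
  proof -
    have pos: "(odd_ext v (std v k), std v k) < (odd_ext v (std v l), std v l)"
      if "0 \<le> k" "k < l" "l \<le> int m" for k l
      using ranked_std[of v] that len by (simp add: ranked_def del: less_prod_simp)
    consider "0 \<le> k" | "l \<le> 0" | "k < 0" "0 < l" by linarith
    then show ?thesis
    proof cases
      case 1 then show ?thesis using pos that by blast
    next
      case 2
      then show ?thesis using pos[of "- l" "- k"] that
        by (auto simp: hyperoctahedral_odd[OF B(1)] odd_ext_uminus)
    next
      case 3
      then show ?thesis using pos[of 0 "- k"] pos[of 0 l] that B(1)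
        by (auto simp: hyperoctahedral_odd[OF B(1)] odd_ext_uminus)
    qed
  qed
  show "ranked m (compose_labels m a v u) (std v \<circ> std u)"
    unfolding ranked_def comp_apply
  proof (intro allI impI, elim conjE)
    fix k l :: int assume kl: "0 \<le> k" "k < l" "l \<le> int m"
    let ?x = "odd_ext (compose_labels m a v u)"
    have bd: "\<bar>std u k\<bar> \<le> int m" "\<bar>std u l\<bar> \<le> int m"
      using hyperoctahedral_mem[OF B(2)] kl by auto
    then have bd2: "\<bar>std v (std u k)\<bar> \<le> int m" "\<bar>std v (std u l)\<bar> \<le> int m"
      using hyperoctahedral_mem[OF B(1)] by auto
    have x: "?x (std v (std u j)) = (2 * int a + 1) * odd_ext u (std u j) + odd_ext v (std v (std u j))"
      if "j \<in> {k, l}" for j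
      using that bd2 odd_ext_compose_labels[OF len(1)] by (auto simp: inv)
    have va: "\<bar>odd_ext v (std v (std u k))\<bar> \<le> int a" "\<bar>odd_ext v (std v (std u l))\<bar> \<le> int a"
      using labels_odd_ext[OF v] bd2 by auto
    have "(odd_ext u (std u k), std u k) < (odd_ext u (std u l), std u l)"
      using ranked_std[of u] kl len by (simp add: ranked_def del: less_prod_simp)
    then consider "odd_ext u (std u k) < odd_ext u (std u l)"
      | "odd_ext u (std u k) = odd_ext u (std u l)" "std u k < std u l" by fastforce
    then show "(?x (std v (std u k)), std v (std u k)) < (?x (std v (std u l)), std v (std u l))"
    proof cases
      case 1
      then have "(2 * int a + 1) * (odd_ext u (std u k) + 1) \<le> (2 * int a + 1) * odd_ext u (std u l)"
        by (intro mult_left_mono) auto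
      then have "?x (std v (std u k)) < ?x (std v (std u l))" using va x by (simp add: algebra_simps)
      then show ?thesis by simp
    next
      case 2
      have "(odd_ext v (std v (std u k)), std v (std u k)) < (odd_ext v (std v (std u l)), std v (std u l))"
        using bd 2(2) by (intro rv) auto
      then show ?thesis using 2(1) x by auto
    qed
  qed
qed

lemma card_labels: "card (labels c m) = (2 * c + 1) ^ m"
proof -
  have "nat (int c + 1 + int c) = 2 * c + 1" by simp
  then show ?thesis unfolding labels_def by (subst card_lists_length_eq) simp_all
qed

text \<open>The low digit determines \<open>v\<close>, hence the place of every position, hence
  \<open>u\<close>. Surjectivity follows by counting, because \<open>2 (2 a b + a + b) + 1\<close>
  is the product of \<open>2 a + 1\<close> and \<open>2 b + 1\<close>.\<close>

lemma compose_labels_bij: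
  "bij_betw (\<lambda>(v, u). compose_labels m a v u) (labels a m \<times> labels b m) (labels (2 * a * b + a + b) m)"
proof (rule bij_betw_imageI)
  let ?f = "\<lambda>(v, u). compose_labels m a v u" and ?c = "2 * a * b + a + b"
  show inj: "inj_on ?f (labels a m \<times> labels b m)"
  proof (rule inj_onI, clarify)
    fix v u v' u' assume A: "v \<in> labels a m" "u \<in> labels b m" "v' \<in> labels a m" "u' \<in> labels b m"
      "compose_labels m a v u = compose_labels m a v' u'"
    have len: "length v = m" "length u = m" "length v' = m" "length u' = m" using A by (auto simp: labels_def)
    have eq: "(2 * int a + 1) * odd_ext u (inv (std v) k) + odd_ext v k
        = (2 * int a + 1) * odd_ext u' (inv (std v') k) + odd_ext v' k" if "\<bar>k\<bar> \<le> int m" for k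
      using odd_ext_compose_labels[OF len(1) that, of a u] odd_ext_compose_labels[OF len(3) that, of a u'] A(5) by simp
    \<comment> \<open>Two balanced digits differ by less than the base.\<close>
    have digit: "x = x' \<and> y = y'" if "N * x + y = N * x' + y'" "\<bar>y\<bar> \<le> int a" "\<bar>y'\<bar> \<le> int a" "N = 2 * int a + 1"
      for x y x' y' N :: int
    proof -
      have "N * (x - x') = y' - y" using that(1) by (simp add: algebra_simps)
      moreover have "\<bar>y' - y\<bar> < N" using that by auto
      ultimately have "\<bar>N * (x - x')\<bar> < N" by simp
      then have "N * \<bar>x - x'\<bar> < N * 1" using that(4) by (simp add: abs_mult)
      then have "\<bar>x - x'\<bar> < 1" using that(4) by (simp only: mult_less_cancel_left)
      then show ?thesis using that(1) by auto
    qed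
    have vv: "v = v'"
    proof (rule list_eq_odd_extI[OF len(1,3)])
      fix k assume "1 \<le> k" "k \<le> int m"
      then have "\<bar>k\<bar> \<le> int m" by simp
      then show "odd_ext v k = odd_ext v' k"
        using digit[OF eq] labels_odd_ext[OF A(1)] labels_odd_ext[OF A(3)] by blast
    qed
    have "u = u'"
    proof (rule list_eq_odd_extI[OF len(2,4)])
      fix k assume k: "1 \<le> k" "k \<le> int m"
      have B: "std v \<in> hyperoctahedral m" using std_hyperoctahedral[of v] len by auto
      have bd: "\<bar>std v k\<bar> \<le> int m" using hyperoctahedral_mem[OF B] k by auto
      have "odd_ext u (inv (std v) (std v k)) = odd_ext u' (inv (std v) (std v k))"
        using eq[OF bd] by (simp add: vv)
      then show "odd_ext u k = odd_ext u' k"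
        using permutes_inverses(2)[OF hyperoctahedral_permutes[OF B]] by simp
    qed
    then show "v = v' \<and> u = u'" using vv by simp
  qed
  show "?f ` (labels a m \<times> labels b m) = labels ?c m"
  proof (rule card_subset_eq)
    show "?f ` (labels a m \<times> labels b m) \<subseteq> labels ?c m"
    proof clarify
      fix v u assume A: "v \<in> labels a m" "u \<in> labels b m"
      then have len: "length v = m" "length u = m" by (auto simp: labels_def)
      show "compose_labels m a v u \<in> labels ?c m"
      proof (rule labelsI)
        fix k assume k: "1 \<le> k" "k \<le> int m"
        have B: "inv (std v) \<in> hyperoctahedral m"
          using inv_hyperoctahedral[OF std_hyperoctahedral[of v]] len by auto
        have bd: "\<bar>inv (std v) k\<bar> \<le> int m" using hyperoctahedral_mem[OF B] k by auto
        have "\<bar>(2 * int a + 1) * odd_ext u (inv (std v) k)\<bar> \<le> (2 * int a + 1) * int b"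
          unfolding abs_mult using labels_odd_ext[OF A(2) bd] by (simp add: mult_left_mono)
        moreover have "\<bar>odd_ext v k\<bar> \<le> int a" using labels_odd_ext[OF A(1)] k by auto
        ultimately have "\<bar>(2 * int a + 1) * odd_ext u (inv (std v) k) + odd_ext v k\<bar> \<le> (2 * int a + 1) * int b + int a"
          by linarith
        then show "\<bar>odd_ext (compose_labels m a v u) k\<bar> \<le> int ?c"
          using k by (subst odd_ext_compose_labels[OF len(1)]) (auto simp: algebra_simps)
      qed (simp add: compose_labels_def)
    qed
    have "(2 * a + 1) * (2 * b + 1) = 2 * ?c + 1" by (simp add: algebra_simps)
    then have "(2 * a + 1) ^ m * (2 * b + 1) ^ m = (2 * ?c + 1) ^ m" by (metis power_mult_distrib)
    then show "card (?f ` (labels a m \<times> labels b m)) = card (labels ?c m)"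
      unfolding card_image[OF inj] card_cartesian_product card_labels .
  qed simp
qed

theorem adams_adams: "adams a (adams b f) w = adams (2 * a * b + a + b) f w"
proof -
  let ?m = "length w"
  have "adams a (adams b f) w = (\<Sum>v\<in>labels a ?m. \<Sum>u\<in>labels b ?m.
      word_sign (pword ?m (std (compose_labels ?m a v u))) *
      f (map (signed_block w) (pword ?m (std (compose_labels ?m a v u)))))"
    unfolding adams_std[OF refl, of a]
  proof (rule sum.cong[OF refl])
    fix v assume v: "v \<in> labels a ?m"
    then have lv: "length v = ?m" by (simp add: labels_def)
    have B: "std v \<in> hyperoctahedral ?m" using std_hyperoctahedral[of v] lv by simp
    have "word_sign (pword ?m (std v)) * (word_sign (pword ?m (std u)) *
          f (map (signed_block (map (signed_block w) (pword ?m (std v)))) (pword ?m (std u))))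
        = word_sign (pword ?m (std (compose_labels ?m a v u))) *
          f (map (signed_block w) (pword ?m (std (compose_labels ?m a v u))))" if u: "u \<in> labels b ?m" for u
    proof -
      have lu: "length u = ?m" using u by (simp add: labels_def)
      have C: "std u \<in> hyperoctahedral ?m" using std_hyperoctahedral[of u] lu by simp
      have "signed_block (map (signed_block w) (pword ?m (std v))) (std u k) = signed_block w (std v (std u k))"
        if "1 \<le> k" "k \<le> int ?m" for k
        using that hyperoctahedral_mem[OF C, of k] hyperoctahedral_eq_0[OF C, of k]
        by (intro signed_block_pword[OF B]) auto
      then have "map (signed_block (map (signed_block w) (pword ?m (std v)))) (pword ?m (std u))
          = map (signed_block w) (pword ?m (std v \<circ> std u))" unfolding list.map_comp by (intro map_cong) auto
      then show ?thesis unfolding std_compose_labels[OF v u] word_sign_comp[OF B C] by (simp only: mult.assoc)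
    qed
    then show "word_sign (pword ?m (std v)) * adams b f (map (signed_block w) (pword ?m (std v))) =
        (\<Sum>u\<in>labels b ?m. word_sign (pword ?m (std (compose_labels ?m a v u))) *
          f (map (signed_block w) (pword ?m (std (compose_labels ?m a v u)))))"
      by (subst adams_std[of _ ?m]) (simp_all add: sum_distrib_left)
  qed
  also have "\<dots> = adams (2 * a * b + a + b) f w"
    unfolding adams_std[OF refl] sum.cartesian_product
    using sum.reindex_bij_betw[OF compose_labels_bij[of ?m a b],
      of "\<lambda>x. word_sign (pword ?m (std x)) * f (map (signed_block w) (pword ?m (std x)))"]
    by (simp add: case_prod_unfold)
  finally show ?thesis .
qed

section \<open>Eulerian idempotents\<close>

definition word_descents :: "int list \<Rightarrow> nat" where
  "word_descents p = card {k. k < length p \<and> (0 # p) ! k > p ! k}"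

text \<open>Type B P-partitions: the lexicographic order lets labels repeat at an ascent and forces
  a strict increase at a descent, where the word is preceded by 0.\<close>

definition rank_labels :: "nat \<Rightarrow> int list \<Rightarrow> int list set" where
  "rank_labels c p = {a. length a = length p \<and> set a \<subseteq> {0..int c} \<and> sorted_wrt (<) ((0, 0) # zip a p)}"

lemma word_descents_le: "word_descents p \<le> length p"
proof -
  have "word_descents p \<le> card {..<length p}" unfolding word_descents_def by (rule card_mono) auto
  then show ?thesis by simp
qed

lemma word_descents_snoc:
  "word_descents (p @ [q]) = word_descents p + (if last (0 # p) > q then 1 else 0)"
proof -
  have last: "(0 # p @ [q]) ! length p = last (0 # p)"
    by (cases p rule: rev_cases) (auto simp: nth_append nth_Cons')
  have old: "(0 # p @ [q]) ! k = (0 # p) ! k" if "k < length p" for k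
    using that by (cases k) (auto simp: nth_append)
  have "{k. k < length (p @ [q]) \<and> (0 # p @ [q]) ! k > (p @ [q]) ! k}
      = {k. k < length p \<and> (0 # p) ! k > p ! k} \<union> (if last (0 # p) > q then {length p} else {})"
    using last old by (auto simp: nth_append less_Suc_eq split: if_splits)
  moreover have "card ({k. k < length p \<and> (0 # p) ! k > p ! k} \<union> (if last (0 # p) > q then {length p} else {}))
      = word_descents p + (if last (0 # p) > q then 1 else 0)"
    unfolding word_descents_def by (subst card_Un_disjoint) auto
  ultimately show ?thesis unfolding word_descents_def[of "p @ [q]"] by simp
qed

lemma last_zip_0:
  "length a = length p \<Longrightarrow> last ((0, 0) # zip a p) = (last (0 # a), last (0 # p))"
  by (cases a rule: rev_cases; cases p rule: rev_cases) auto

lemma sorted_wrt_snoc: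
  fixes xs :: "'a::linorder list"
  assumes "xs \<noteq> []"
  shows "sorted_wrt (<) (xs @ [y]) \<longleftrightarrow> sorted_wrt (<) xs \<and> last xs < y"
  using assms by (cases xs rule: rev_cases) (auto simp: sorted_wrt_append intro: less_trans)

lemma sorted_zip_le_last:
  assumes "length a = length p" "sorted_wrt (<) ((0, 0) # zip a p)" "x \<in> set a"
  shows "0 \<le> x \<and> x \<le> last (0 # (a :: int list))"
proof -
  have pos: "0 \<le> y" if "y \<in> set a" for y
  proof -
    obtain z where "(y, z) \<in> set (zip a p)" using \<open>y \<in> set a\<close> assms(1) by (metis in_set_impl_in_set_zip1)
    then have "(0, 0) < (y, z)" using assms(2) unfolding sorted_wrt.simps by blast
    then show ?thesis by auto
  qed
  obtain a' l where a: "a = a' @ [l]" using assms(3) by (cases a rule: rev_cases) auto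
  obtain p' q where p: "p = p' @ [q]" "length p' = length a'" using assms(1) a by (cases p rule: rev_cases) auto
  have "x \<le> l"
  proof (cases "x \<in> set a'")
    case True
    then obtain z where "(x, z) \<in> set (zip a' p')" using p(2) by (metis in_set_impl_in_set_zip1)
    then have "(x, z) < (l, q)" using assms(2) a p by (auto simp: sorted_wrt_append simp del: less_prod_simp)
    then show ?thesis by auto
  qed (use assms(3) a in auto)
  then show ?thesis using pos assms(3) a by simp
qed

text \<open>The last label minus \<open>\<delta>\<close> bounds all earlier labels, where
  \<open>\<delta>\<close> enforces the increase at a final descent. Summing over this bound gives a
  recursion in the length.\<close>

lemma rank_labels_snoc:
  fixes p :: "int list" and q :: int
  defines "\<delta> \<equiv> if last (0 # p) > q then 1 else (0 :: nat)"
  assumes "last (0 # p) \<noteq> q"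
  shows "rank_labels c (p @ [q]) = (\<lambda>(y, a). a @ [int y + int \<delta>]) ` (SIGMA y:{..<c + 1 - \<delta>}. rank_labels y p)"
proof (intro equalityI subsetI)
  fix b assume b: "b \<in> rank_labels c (p @ [q])"
  then obtain a x where ax: "b = a @ [x]" "length a = length p"
    by (cases b rule: rev_cases) (auto simp: rank_labels_def)
  have "sorted_wrt (<) (((0, 0) # zip a p) @ [(x, q)])" using b ax by (simp add: rank_labels_def del: less_prod_simp)
  then have srt: "sorted_wrt (<) ((0, 0) # zip a p)" and lt: "(last (0 # a), last (0 # p)) < (x, q)"
    unfolding sorted_wrt_snoc[OF list.simps(3)] last_zip_0[OF ax(2)] by blast+
  have x: "0 \<le> x" "x \<le> int c" using b ax by (auto simp: rank_labels_def)
  have l: "last (0 # a) + int \<delta> \<le> x" using lt by (auto simp: \<delta>_def)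
  have l0: "0 \<le> last (0 # a)"
    using sorted_zip_le_last[OF ax(2) srt] by (cases a rule: rev_cases) auto
  have "a \<in> rank_labels (nat (x - int \<delta>)) p"
    using sorted_zip_le_last[OF ax(2) srt] srt ax(2) l l0 unfolding rank_labels_def by force
  then show "b \<in> (\<lambda>(y, a). a @ [int y + int \<delta>]) ` (SIGMA y:{..<c + 1 - \<delta>}. rank_labels y p)"
    using l l0 x ax(1) by (intro image_eqI[of _ _ "(nat (x - int \<delta>), a)"]) auto
next
  fix b assume "b \<in> (\<lambda>(y, a). a @ [int y + int \<delta>]) ` (SIGMA y:{..<c + 1 - \<delta>}. rank_labels y p)"
  then obtain y a where ya: "b = a @ [int y + int \<delta>]" "y < c + 1 - \<delta>" "a \<in> rank_labels y p" by auto
  then have a: "length a = length p" "set a \<subseteq> {0..int y}" "sorted_wrt (<) ((0, 0) # zip a p)"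
    by (auto simp: rank_labels_def)
  have "last (0 # a) \<le> int y" using a(2) by (cases a rule: rev_cases) auto
  then have lt: "(last (0 # a), last (0 # p)) < (int y + int \<delta>, q)"
    using assms(2) by (auto simp: \<delta>_def)
  have "sorted_wrt (<) (((0, 0) # zip a p) @ [(int y + int \<delta>, q)])"
    unfolding sorted_wrt_snoc[OF list.simps(3)] last_zip_0[OF a(1)] using a(3) lt by blast
  moreover have "set a \<subseteq> {0..int c}" using a(2) ya(2) by force
  ultimately show "b \<in> rank_labels c (p @ [q])"
    using a(1) ya(1,2) unfolding rank_labels_def by auto
qed

lemma finite_rank_labels [simp]: "finite (rank_labels c p)"
  by (rule finite_subset[OF _ finite_lists_length_eq[of "{0..int c}" "length p"]]) (auto simp: rank_labels_def)

lemma sum_shifted_choose: "r \<le> m \<Longrightarrow> (\<Sum>y<K. (y + r) choose m) = (K + r) choose Suc m"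
  by (induction K) (auto simp: binomial_eq_0)

text \<open>Each descent costs one unit of the range of labels; the recursion is then the
  hockey-stick identity for binomial coefficients.\<close>

lemma card_rank_labels:
  "distinct (0 # p) \<Longrightarrow> card (rank_labels c p) = (c + length p - word_descents p) choose length p"
proof (induction p arbitrary: c rule: rev_induct)
  case Nil
  have "rank_labels c [] = {[]}" by (auto simp: rank_labels_def)
  then show ?case by simp
next
  case (snoc q p)
  define \<delta> :: nat where "\<delta> = (if last (0 # p) > q then 1 else 0)"
  have ne: "last (0 # p) \<noteq> q" using snoc.prems by (cases p rule: rev_cases) auto
  have inj: "inj_on (\<lambda>(y, a). a @ [int y + int \<delta>]) (SIGMA y:{..<c + 1 - \<delta>}. rank_labels y p)"
    by (auto simp: inj_on_def)
  have IH: "card (rank_labels y p) = (y + (length p - word_descents p)) choose length p" for y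
    using snoc.IH[of y] snoc.prems word_descents_le[of p] by (simp add: insert_commute)
  have "card (rank_labels c (p @ [q])) = (\<Sum>y<c + 1 - \<delta>. card (rank_labels y p))"
    unfolding rank_labels_snoc[OF ne] \<delta>_def[symmetric] card_image[OF inj] by (simp add: card_SigmaI)
  also have "\<dots> = (c + 1 - \<delta> + (length p - word_descents p)) choose Suc (length p)"
    unfolding IH by (rule sum_shifted_choose) simp
  also have "c + 1 - \<delta> + (length p - word_descents p) = c + length (p @ [q]) - word_descents (p @ [q])"
    using word_descents_le[of p] by (auto simp: word_descents_snoc \<delta>_def)
  finally show ?case by simp
qed

lemma descents_pword:
  assumes "\<pi> \<in> hyperoctahedral m" shows "descents m \<pi> = word_descents (pword m \<pi>)"
  unfolding descents_def word_descents_def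
proof (rule bij_betw_same_card[of nat], rule bij_betw_byWitness[where f' = int])
  have nth: "(0 # pword m \<pi>) ! k = \<pi> (int k)" if "k < Suc m" for k
    using that assms by (cases k) auto
  show "nat ` {i \<in> {0..<int m}. \<pi> (i + 1) < \<pi> i} \<subseteq> {k. k < length (pword m \<pi>) \<and> (0 # pword m \<pi>) ! k > pword m \<pi> ! k}"
    using nth by (auto simp: add.commute)
  show "int ` {k. k < length (pword m \<pi>) \<and> (0 # pword m \<pi>) ! k > pword m \<pi> ! k} \<subseteq> {i \<in> {0..<int m}. \<pi> (i + 1) < \<pi> i}"
    using nth by (auto simp: add.commute)
qed auto

text \<open>Reading the labels in sorted order turns a labelling into a sequence compatible with the
  one-line notation of \<open>\<pi>\<close>. Nothing is lost, since \<open>\<pi>\<close> tells where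
  each label belongs.\<close>

lemma card_std:
  assumes \<pi>: "\<pi> \<in> hyperoctahedral m"
  shows "card {v \<in> labels c m. std v = \<pi>} = (c + m - descents m \<pi>) choose m"
proof -
  have inv: "inv \<pi> \<in> hyperoctahedral m" using \<pi> by (rule inv_hyperoctahedral)
  have inverses: "inv \<pi> (\<pi> k) = k" "\<pi> (inv \<pi> k) = k" for k
    using permutes_inverses[OF hyperoctahedral_permutes[OF \<pi>]] by auto
  have bound: "\<bar>\<pi> k\<bar> \<le> int m" "\<bar>inv \<pi> k\<bar> \<le> int m" if "\<bar>k\<bar> \<le> int m" for k
    using hyperoctahedral_mem[OF \<pi>] hyperoctahedral_mem[OF inv] that by auto
  have zip: "zip (relabel m \<pi> v) (pword m \<pi>) = map (\<lambda>k. (odd_ext v (\<pi> k), \<pi> k)) [1..int m]" for v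
    by (simp add: relabel_def zip_map_map zip_same_conv_map)
  have rel: "relabel m \<pi> (relabel m (inv \<pi>) a) = a \<and> relabel m (inv \<pi>) (relabel m \<pi> a) = a" if "length a = m" for a
    by (intro conjI; rule list_eq_odd_extI[of _ m]; use that \<pi> inv bound in \<open>simp add: odd_ext_relabel inverses\<close>)+
  have "bij_betw (relabel m \<pi>) {v \<in> labels c m. std v = \<pi>} (rank_labels c (pword m \<pi>))"
  proof (rule bij_betw_byWitness[where f' = "relabel m (inv \<pi>)"])
    show "\<forall>v\<in>{v \<in> labels c m. std v = \<pi>}. relabel m (inv \<pi>) (relabel m \<pi> v) = v"
      using rel by (auto simp: labels_def)
    show "\<forall>a\<in>rank_labels c (pword m \<pi>). relabel m \<pi> (relabel m (inv \<pi>) a) = a"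
      using rel by (auto simp: rank_labels_def)
    show "relabel m \<pi> ` {v \<in> labels c m. std v = \<pi>} \<subseteq> rank_labels c (pword m \<pi>)"
    proof clarify
      fix v assume v: "v \<in> labels c m" "\<pi> = std v"
      then have len: "length v = m" by (simp add: labels_def)
      have "ranked m v \<pi>" using ranked_std[of v] len v by simp
      then have srt: "sorted_wrt (<) ((0, 0) # zip (relabel m \<pi> v) (pword m \<pi>))"
        unfolding zip ranked_sorted[OF \<pi>] .
      have "x \<in> {0..int c}" if x: "x \<in> set (relabel m \<pi> v)" for x
      proof -
        obtain k where k: "1 \<le> k" "k \<le> int m" "x = odd_ext v (\<pi> k)" using x by (auto simp: relabel_def)
        have "0 \<le> x" using sorted_zip_le_last[OF _ srt x] by simp
        moreover have "\<bar>x\<bar> \<le> int c" unfolding k(3) using k bound by (intro labels_odd_ext[OF v(1)]) auto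
        ultimately show ?thesis by simp
      qed
      then have "relabel m \<pi> v \<in> rank_labels c (pword m \<pi>)" using srt by (auto simp: rank_labels_def)
      then show "relabel m (std v) v \<in> rank_labels c (pword m (std v))" using v(2) by simp
    qed
    show "relabel m (inv \<pi>) ` rank_labels c (pword m \<pi>) \<subseteq> {v \<in> labels c m. std v = \<pi>}"
    proof clarify
      fix a assume a: "a \<in> rank_labels c (pword m \<pi>)"
      let ?v = "relabel m (inv \<pi>) a"
      have len: "length a = m" using a by (simp add: rank_labels_def)
      have "a \<in> labels c m" using a len by (auto simp: rank_labels_def labels_def)
      then have "?v \<in> labels c m"
        using bound by (intro labelsI) (auto simp: odd_ext_relabel[OF inv] intro!: labels_odd_ext)
      moreover have "ranked m ?v \<pi>"
        using a rel[OF len] zip[of ?v] by (simp add: ranked_sorted[OF \<pi>] rank_labels_def del: less_prod_simp)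
      then have "std ?v = \<pi>" by (intro std_unique[OF \<pi>]) simp_all
      ultimately show "?v \<in> labels c m \<and> std ?v = \<pi>" by blast
    qed
  qed
  then have "card {v \<in> labels c m. std v = \<pi>} = card (rank_labels c (pword m \<pi>))"
    by (rule bij_betw_same_card)
  also have "distinct (0 # pword m \<pi>)"
  proof -
    have "distinct (map abs (pword m \<pi>))" "0 \<notin> abs ` set (pword m \<pi>)"
      using signed_words_distinct[OF pword_signed_words[OF \<pi>]] pword_signed_words[OF \<pi>]
      by (simp_all add: signed_words_def)
    then show ?thesis using distinct_map[of abs] by force
  qed
  then have "card (rank_labels c (pword m \<pi>)) = (c + m - descents m \<pi>) choose m"
    using card_rank_labels[of "pword m \<pi>" c] by (simp add: descents_pword[OF \<pi>])
  finally show ?thesis .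
qed

section \<open>From Adams operations to idempotents\<close>

definition eulerian_poly :: "nat \<Rightarrow> nat \<Rightarrow> complex poly" where
  "eulerian_poly m d = smult (1 / (2 ^ m * fact m)) (\<Prod>k=1..m. [:- 2 * of_nat d + 2 * of_nat k - 1, 1:])"

lemma degree_eulerian_poly: "degree (eulerian_poly m d) \<le> m"
proof -
  have "degree (\<Prod>k=1..m. [:- 2 * of_nat d + 2 * of_nat k - 1 :: complex, 1:]) \<le> m"
    by (rule order_trans[OF degree_prod_sum_le]) simp_all
  then show ?thesis unfolding eulerian_poly_def using degree_smult_le order_trans by blast
qed

text \<open>At \<open>2 c + 1\<close> the k-th factor equals \<open>2 (c - d + k)\<close>, so the
  normalisation turns the product into the number of labellings that standardise to a given
  permutation with \<open>d\<close> descents.\<close>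

lemma poly_eulerian_poly:
  assumes "d \<le> m"
  shows "poly (eulerian_poly m d) (2 * of_nat c + 1) = of_nat ((c + m - d) choose m)"
proof -
  have "(\<Prod>k=1..m. 2 * of_nat c + 1 + (- 2 * of_nat d + 2 * of_nat k - 1 :: complex))
      = (\<Prod>k=1..m. 2 * (of_nat c - of_nat d + of_nat k))"
    by (rule prod.cong) (auto simp: algebra_simps)
  also have "\<dots> = 2 ^ m * (\<Prod>k=1..m. of_nat c - of_nat d + of_nat k)"
    unfolding prod.distrib by simp
  also have "(\<Prod>k=1..m. of_nat c - of_nat d + of_nat k :: complex) = (\<Prod>i=0..<m. of_nat (c + m - d) - of_nat i)"
    by (rule prod.reindex_bij_witness[where i = "\<lambda>i. m - i" and j = "\<lambda>k. m - k"])
      (use assms in \<open>auto simp: of_nat_diff\<close>)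
  also have "\<dots> = fact m * of_nat ((c + m - d) choose m)"
    by (simp add: binomial_gbinomial gbinomial_prod_rev)
  finally have prod: "(\<Prod>k=1..m. 2 * of_nat c + 1 + (- 2 * of_nat d + 2 * of_nat k - 1 :: complex))
      = 2 ^ m * (fact m * of_nat ((c + m - d) choose m))" .
  have "poly (eulerian_poly m d) (2 * of_nat c + 1)
      = 1 / (2 ^ m * fact m) * (\<Prod>k=1..m. 2 * of_nat c + 1 + (- 2 * of_nat d + 2 * of_nat k - 1))"
    unfolding eulerian_poly_def poly_smult poly_prod
    by (intro arg_cong2[of _ _ _ _ "(*)"] refl prod.cong) simp
  then show ?thesis unfolding prod by simp
qed

lemma eulerian_coeff_eq:
  assumes "\<pi> \<in> hyperoctahedral m"
  shows "eulerian_coeff m j \<pi> = coeff (eulerian_poly m (descents m \<pi>)) j * word_sign (pword m \<pi>)"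
  unfolding eulerian_coeff_def eulerian_poly_def coxeter_length_sign[OF assms] ..

text \<open>The word is read along \<open>\<pi>\<close> itself and not along its inverse, because
  this is the action on coefficients: the image of a chain under \<open>\<pi>\<close> has at
  \<open>w\<close> the coefficient of the word that \<open>\<pi>\<close> carries to
  \<open>w\<close>.\<close>

definition euler_op :: "nat \<Rightarrow> (int set list \<Rightarrow> complex) \<Rightarrow> int set list \<Rightarrow> complex" where
  "euler_op j f w = (\<Sum>\<pi>\<in>hyperoctahedral (length w).
     eulerian_coeff (length w) j \<pi> * f (map (signed_block w) (pword (length w) \<pi>)))"

text \<open>Grouping labellings by standardisation makes the Adams operation a polynomial in
  \<open>2 c + 1\<close> whose coefficients are the Eulerian operators. The bound \<open>N\<close>
  is free so that words of different lengths can share it.\<close>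

lemma adams_euler_op:
  assumes "length w \<le> N"
  shows "adams c f w = (\<Sum>j\<le>N. (2 * of_nat c + 1) ^ j * euler_op j f w)"
proof -
  let ?m = "length w" and ?x = "2 * of_nat c + 1 :: complex"
  let ?F = "\<lambda>\<pi>. word_sign (pword ?m \<pi>) * f (map (signed_block w) (pword ?m \<pi>))"
  have "adams c f w = (\<Sum>v\<in>labels c ?m. ?F (std v))" by (rule adams_std) simp
  also have "\<dots> = (\<Sum>\<pi>\<in>hyperoctahedral ?m. \<Sum>v | v \<in> labels c ?m \<and> std v = \<pi>. ?F (std v))"
  proof (rule sum.group[symmetric])
    show "std ` labels c ?m \<subseteq> hyperoctahedral ?m"
    proof
      fix x assume "x \<in> std ` labels c ?m"
      then obtain v where "x = std v" "length v = ?m" by (auto simp: labels_def)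
      then show "x \<in> hyperoctahedral ?m" using std_hyperoctahedral[of v] by simp
    qed
  qed simp_all
  also have "\<dots> = (\<Sum>\<pi>\<in>hyperoctahedral ?m. poly (eulerian_poly ?m (descents ?m \<pi>)) ?x * ?F \<pi>)"
  proof (rule sum.cong[OF refl])
    fix \<pi> assume \<pi>: "\<pi> \<in> hyperoctahedral ?m"
    have "(\<Sum>v | v \<in> labels c ?m \<and> std v = \<pi>. ?F (std v)) = of_nat (card {v \<in> labels c ?m. std v = \<pi>}) * ?F \<pi>"
      by simp
    moreover have "descents ?m \<pi> \<le> ?m"
      using word_descents_le[of "pword ?m \<pi>"] descents_pword[OF \<pi>] by simp
    ultimately show "(\<Sum>v | v \<in> labels c ?m \<and> std v = \<pi>. ?F (std v))
        = poly (eulerian_poly ?m (descents ?m \<pi>)) ?x * ?F \<pi>"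
      by (simp add: card_std[OF \<pi>] poly_eulerian_poly)
  qed
  also have "\<dots> = (\<Sum>\<pi>\<in>hyperoctahedral ?m. \<Sum>j\<le>N. ?x ^ j * (eulerian_coeff ?m j \<pi> * f (map (signed_block w) (pword ?m \<pi>))))"
  proof (rule sum.cong[OF refl])
    fix \<pi> assume \<pi>: "\<pi> \<in> hyperoctahedral ?m"
    have "poly (eulerian_poly ?m (descents ?m \<pi>)) ?x = (\<Sum>j\<le>N. coeff (eulerian_poly ?m (descents ?m \<pi>)) j * ?x ^ j)"
      unfolding poly_altdef using degree_eulerian_poly[of ?m "descents ?m \<pi>"] assms
      by (intro sum.mono_neutral_left) (auto simp: coeff_eq_0)
    then show "poly (eulerian_poly ?m (descents ?m \<pi>)) ?x * ?F \<pi>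
        = (\<Sum>j\<le>N. ?x ^ j * (eulerian_coeff ?m j \<pi> * f (map (signed_block w) (pword ?m \<pi>))))"
      by (simp add: eulerian_coeff_eq[OF \<pi>] sum_distrib_left sum_distrib_right mult_ac)
  qed
  also have "\<dots> = (\<Sum>j\<le>N. ?x ^ j * euler_op j f w)"
    unfolding euler_op_def sum_distrib_left by (rule sum.swap)
  finally show ?thesis .
qed

text \<open>The polynomial has infinitely many roots. This turns identities between Adams operations
  into identities between their coefficients.\<close>

lemma odd_poly_zero:
  fixes A :: "nat \<Rightarrow> complex"
  assumes "\<And>c::nat. (\<Sum>j\<le>N. (2 * of_nat c + 1) ^ j * A j) = 0" "j \<le> N"
  shows "A j = 0"
proof -
  define p where "p = (\<Sum>j\<le>N. monom (A j) j)"
  have "poly p (2 * of_nat c + 1) = 0" for c :: nat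
    using assms(1)[of c] by (simp add: p_def poly_sum poly_monom mult.commute)
  then have "range (\<lambda>c::nat. 2 * of_nat c + 1) \<subseteq> {x. poly p x = 0}" by auto
  moreover have "infinite (range (\<lambda>c::nat. 2 * of_nat c + 1 :: complex))"
    by (rule range_inj_infinite) (auto simp: inj_def)
  ultimately have "p = 0" using poly_roots_finite finite_subset by blast
  then have "coeff p j = 0" by simp
  then show ?thesis using assms(2) by (simp add: p_def coeff_sum)
qed

lemma euler_op_linear:
  "finite A \<Longrightarrow> euler_op j (\<lambda>u. \<Sum>a\<in>A. c a * f a u) w = (\<Sum>a\<in>A. c a * euler_op j (f a) w)"
  unfolding euler_op_def sum_distrib_left by (subst sum.swap) (simp add: mult_ac)

lemma euler_op_cong:
  assumes "\<And>u. length u = length w \<Longrightarrow> f u = g u" shows "euler_op j f w = euler_op j g w"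
  unfolding euler_op_def by (intro sum.cong refl arg_cong2[of _ _ _ _ "(*)"] assms) simp

text \<open>Composing two Adams operations gives a polynomial identity in two odd numbers. One side
  has all monomials, the other, depending only on the product, those with equal exponents.\<close>

theorem euler_op_orthogonal: "euler_op i (euler_op j f) w = (if i = j then euler_op i f w else 0)"
proof -
  define N where "N = length w + i + j"
  let ?x = "\<lambda>a::nat. 2 * of_nat a + 1 :: complex"
  have *: "(\<Sum>i\<le>N. ?x a ^ i * (\<Sum>j\<le>N. ?x b ^ j * (euler_op i (euler_op j f) w - (if i = j then euler_op i f w else 0)))) = 0"
    for a b
  proof -
    have "(\<Sum>i\<le>N. ?x a ^ i * (\<Sum>j\<le>N. ?x b ^ j * euler_op i (euler_op j f) w))
        = (\<Sum>i\<le>N. ?x a ^ i * euler_op i (adams b f) w)"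
    proof (rule sum.cong[OF refl])
      fix i
      have "euler_op i (adams b f) w = euler_op i (\<lambda>u. \<Sum>j\<le>N. ?x b ^ j * euler_op j f u) w"
        by (rule euler_op_cong, rule adams_euler_op) (simp add: N_def)
      also have "\<dots> = (\<Sum>j\<le>N. ?x b ^ j * euler_op i (euler_op j f) w)" by (rule euler_op_linear) simp
      finally show "?x a ^ i * (\<Sum>j\<le>N. ?x b ^ j * euler_op i (euler_op j f) w) = ?x a ^ i * euler_op i (adams b f) w"
        by simp
    qed
    also have "\<dots> = adams a (adams b f) w" by (rule adams_euler_op[symmetric]) (simp add: N_def)
    also have "\<dots> = (\<Sum>i\<le>N. ?x (2 * a * b + a + b) ^ i * euler_op i f w)"
      unfolding adams_adams by (rule adams_euler_op) (simp add: N_def)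
    also have "\<dots> = (\<Sum>i\<le>N. ?x a ^ i * (\<Sum>j\<le>N. ?x b ^ j * (if i = j then euler_op i f w else 0)))"
    proof (rule sum.cong[OF refl])
      fix i assume "i \<in> {..N}"
      have x: "?x (2 * a * b + a + b) = ?x a * ?x b" by (simp add: algebra_simps)
      have "(\<Sum>j\<le>N. ?x b ^ j * (if i = j then euler_op i f w else 0)) = (\<Sum>j\<le>N. if i = j then ?x b ^ j * euler_op i f w else 0)"
        by (rule sum.cong) auto
      also have "\<dots> = ?x b ^ i * euler_op i f w" using \<open>i \<in> {..N}\<close> by simp
      finally show "?x (2 * a * b + a + b) ^ i * euler_op i f w
          = ?x a ^ i * (\<Sum>j\<le>N. ?x b ^ j * (if i = j then euler_op i f w else 0))"
        unfolding x by (simp add: power_mult_distrib)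
    qed
    finally show ?thesis by (simp add: right_diff_distrib sum_subtractf)
  qed
  have "(\<Sum>j\<le>N. ?x b ^ j * (euler_op i (euler_op j f) w - (if i = j then euler_op i f w else 0))) = 0" for b
    by (rule odd_poly_zero[where N = N, OF *]) (simp add: N_def)
  from odd_poly_zero[where N = N and j = j, OF this] show ?thesis by (simp add: N_def)
qed

lemma word_boundary_linear:
  "finite A \<Longrightarrow> word_boundary n (\<lambda>u. \<Sum>a\<in>A. c a * f a u) w = (\<Sum>a\<in>A. c a * word_boundary n (f a) w)"
proof (induction A rule: finite_induct)
  case empty
  have "split_sum (\<lambda>w. 0) w = 0" for w by (induction w) auto
  then show ?case by (simp add: word_boundary_def)
next
  case (insert a A)
  then show ?case
    by (simp add: word_boundary_def split_sum_add split_sum_scale sum.distrib algebra_simps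
        sum_distrib_left[symmetric])
qed

lemma split_sum_cong:
  assumes "\<And>u. length u = Suc (length w) \<Longrightarrow> f u = g u" shows "split_sum f w = split_sum g w"
  using assms
proof (induction w arbitrary: f g)
  case (Cons Z w)
  have "split_sum (\<lambda>M. f (Z # M)) w = split_sum (\<lambda>M. g (Z # M)) w"
    using Cons.prems by (intro Cons.IH) simp
  moreover have "f (X # (Z - X) # w) = g (X # (Z - X) # w)" for X by (rule Cons.prems) simp
  ultimately show ?case by simp
qed simp

lemma word_boundary_cong:
  assumes "\<And>u. length u = Suc (length w) \<Longrightarrow> f u = g u" shows "word_boundary n f w = word_boundary n g w"
  unfolding word_boundary_def using split_sum_cong[of w f g] assms by simp

text \<open>Coefficients are compared in the commutation of the boundary with Adams operations;
  \<open>N\<close> also covers the words with one more letter that enter the boundary at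
  \<open>w\<close>.\<close>

theorem word_boundary_euler_op: "word_boundary n (euler_op j f) w = euler_op j (word_boundary n f) w"
proof -
  define N where "N = Suc (length w) + j"
  let ?x = "\<lambda>a::nat. 2 * of_nat a + 1 :: complex"
  have "(\<Sum>j\<le>N. ?x c ^ j * (word_boundary n (euler_op j f) w - euler_op j (word_boundary n f) w)) = 0" for c
  proof -
    have "(\<Sum>j\<le>N. ?x c ^ j * word_boundary n (euler_op j f) w)
        = word_boundary n (\<lambda>u. \<Sum>j\<le>N. ?x c ^ j * euler_op j f u) w"
      by (rule word_boundary_linear[symmetric]) simp
    also have "\<dots> = word_boundary n (adams c f) w"
      by (rule word_boundary_cong, rule adams_euler_op[symmetric]) (simp add: N_def)
    also have "\<dots> = (\<Sum>j\<le>N. ?x c ^ j * euler_op j (word_boundary n f) w)"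
      unfolding word_boundary_adams by (rule adams_euler_op) (simp add: N_def)
    finally show ?thesis by (simp add: right_diff_distrib sum_subtractf)
  qed
  from odd_poly_zero[where N = N and j = j, OF this] show ?thesis by (simp add: N_def)
qed

section \<open>Block words\<close>

text \<open>
  A face \<open>(P\<^sub>1|\<dots>|P\<^sub>m|P\<^sub>m\<^sub>+\<^sub>1)\<close> is determined by the word \<open>P\<^sub>1 \<dots> P\<^sub>m\<close>.
\<close>

definition block_words :: "nat \<Rightarrow> int set list set" where
  "block_words n = {w.
     (\<forall>k. 1 \<le> \<bar>k\<bar> \<and> \<bar>k\<bar> \<le> int (length w) \<longrightarrow> signed_block w k \<noteq> {} \<and> signed_block w k \<subseteq> ground n) \<and>
     (\<forall>k l. 1 \<le> \<bar>k\<bar> \<and> \<bar>k\<bar> \<le> int (length w) \<and> 1 \<le> \<bar>l\<bar> \<and> \<bar>l\<bar> \<le> int (length w) \<and> k \<noteq> l \<longrightarrow>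
        signed_block w k \<inter> signed_block w l = {})}"

text \<open>Partial unions recover the nested sets of the flag from the blocks.\<close>

definition partial :: "int set list \<Rightarrow> nat \<Rightarrow> int set" where
  "partial w k = \<Union> (set (take k w))"

definition flag_set :: "int set list \<Rightarrow> int set set" where
  "flag_set w = partial w ` {1..length w}"

lemma neg_set_iff: "x \<in> neg_set B \<longleftrightarrow> - x \<in> B"
  by force

lemma neg_set_ground [simp]: "neg_set B \<subseteq> ground n \<longleftrightarrow> B \<subseteq> ground n"
  by auto

lemma block_words_signed:
  assumes "w \<in> block_words n" "1 \<le> \<bar>k\<bar>" "\<bar>k\<bar> \<le> int (length w)"
  shows "signed_block w k \<noteq> {}" "signed_block w k \<subseteq> ground n"
    and "1 \<le> \<bar>l\<bar> \<Longrightarrow> \<bar>l\<bar> \<le> int (length w) \<Longrightarrow> k \<noteq> l \<Longrightarrow> signed_block w k \<inter> signed_block w l = {}"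
  using assms unfolding block_words_def by blast+

text \<open>The definition speaks of signed blocks because these are what the group permutes;
  conditions on plain blocks are easier to check when words are split and merged.\<close>

lemma block_words_iff:
  "w \<in> block_words n \<longleftrightarrow> (\<forall>i<length w. w ! i \<noteq> {} \<and> w ! i \<subseteq> ground n) \<and>
     (\<forall>i<length w. \<forall>j<length w. (i \<noteq> j \<longrightarrow> w ! i \<inter> w ! j = {}) \<and> w ! i \<inter> neg_set (w ! j) = {})"
  (is "_ \<longleftrightarrow> ?A \<and> ?B")
proof
  assume w: "w \<in> block_words n"
  have sb: "signed_block w (int i + 1) = w ! i" "signed_block w (- (int i + 1)) = neg_set (w ! i)" for i
    by (auto simp: signed_block_def nat_add_distrib)
  have ?A
  proof (intro allI impI)
    fix i assume "i < length w"
    then have "signed_block w (int i + 1) \<noteq> {} \<and> signed_block w (int i + 1) \<subseteq> ground n"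
      using w unfolding block_words_def by auto
    then show "w ! i \<noteq> {} \<and> w ! i \<subseteq> ground n" unfolding sb .
  qed
  moreover have ?B
  proof (intro allI impI conjI)
    fix i j assume "i < length w" "j < length w"
    then have *: "1 \<le> \<bar>int i + 1\<bar> \<and> \<bar>int i + 1\<bar> \<le> int (length w)" "1 \<le> \<bar>int j + 1\<bar> \<and> \<bar>int j + 1\<bar> \<le> int (length w)"
      "1 \<le> \<bar>- (int j + 1)\<bar> \<and> \<bar>- (int j + 1)\<bar> \<le> int (length w)"
      by auto
    have "signed_block w (int i + 1) \<inter> signed_block w (- (int j + 1)) = {}"
      using * by (intro block_words_signed(3)[OF w]) auto
    then show "w ! i \<inter> neg_set (w ! j) = {}" unfolding sb .
    assume "i \<noteq> j"
    then have "signed_block w (int i + 1) \<inter> signed_block w (int j + 1) = {}"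
      using * by (intro block_words_signed(3)[OF w]) auto
    then show "w ! i \<inter> w ! j = {}" unfolding sb .
  qed
  ultimately show "?A \<and> ?B" ..
next
  assume AB: "?A \<and> ?B"
  show "w \<in> block_words n"
    unfolding block_words_def
  proof (intro CollectI conjI allI impI)
    fix k assume k: "1 \<le> \<bar>k\<bar> \<and> \<bar>k\<bar> \<le> int (length w)"
    then have "nat \<bar>k\<bar> - 1 < length w" by linarith
    then have "w ! (nat \<bar>k\<bar> - 1) \<noteq> {} \<and> w ! (nat \<bar>k\<bar> - 1) \<subseteq> ground n" using AB by blast
    then show "signed_block w k \<noteq> {}" "signed_block w k \<subseteq> ground n"
      by (auto simp: signed_block_def abs_if split: if_splits)
  next
    fix k l assume kl: "1 \<le> \<bar>k\<bar> \<and> \<bar>k\<bar> \<le> int (length w) \<and> 1 \<le> \<bar>l\<bar> \<and> \<bar>l\<bar> \<le> int (length w) \<and> k \<noteq> l"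
    define i j where "i = nat \<bar>k\<bar> - 1" and "j = nat \<bar>l\<bar> - 1"
    have ij: "i < length w" "j < length w" using kl unfolding i_def j_def by linarith+
    have "k > 0 \<longleftrightarrow> l > 0 \<Longrightarrow> i \<noteq> j" using kl unfolding i_def j_def by linarith
    then have 1: "k > 0 \<longleftrightarrow> l > 0 \<Longrightarrow> w ! i \<inter> w ! j = {}" using AB ij by blast
    have 2: "w ! i \<inter> neg_set (w ! j) = {}" "w ! j \<inter> neg_set (w ! i) = {}" using AB ij by blast+
    have "signed_block w k = (if k > 0 then w ! i else neg_set (w ! i))"
      "signed_block w l = (if l > 0 then w ! j else neg_set (w ! j))"
      by (auto simp: signed_block_def i_def j_def)
    then show "signed_block w k \<inter> signed_block w l = {}"
      using 1 2 by (auto split: if_splits)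
  qed
qed

lemma block_wordsD:
  assumes "w \<in> block_words n" "i < length w"
  shows "w ! i \<noteq> {}" "w ! i \<subseteq> ground n"
    and "j < length w \<Longrightarrow> i \<noteq> j \<Longrightarrow> w ! i \<inter> w ! j = {}" "j < length w \<Longrightarrow> w ! i \<inter> neg_set (w ! j) = {}"
  using assms unfolding block_words_iff by blast+

section \<open>Words and chains of admissible sets\<close>

lemma partial_0 [simp]: "partial w 0 = {}"
  by (simp add: partial_def)

lemma partial_Suc: "i < length w \<Longrightarrow> partial w (Suc i) = partial w i \<union> w ! i"
  by (auto simp: partial_def take_Suc_conv_app_nth)

lemma partial_iff: "k \<le> length w \<Longrightarrow> x \<in> partial w k \<longleftrightarrow> (\<exists>i<k. x \<in> w ! i)"
  by (auto simp: partial_def nth_image[symmetric])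

lemma partial_mono: "i \<le> j \<Longrightarrow> partial w i \<subseteq> partial w j"
  using set_take_subset_set_take[of i j w] by (auto simp: partial_def)

lemma partial_disjoint:
  assumes "w \<in> block_words n" "i < length w" shows "partial w i \<inter> w ! i = {}"
proof -
  have "w ! j \<inter> w ! i = {}" if "j < i" for j using assms that by (intro block_wordsD) auto
  then show ?thesis using assms(2) by (fastforce simp: partial_iff)
qed

lemma partial_strict:
  assumes "w \<in> block_words n" "i < j" "j \<le> length w" shows "partial w i \<subset> partial w j"
proof -
  have i: "i < length w" using assms by simp
  have "partial w i \<subset> partial w (Suc i)"
    using partial_disjoint[OF assms(1) i] partial_Suc[OF i] block_wordsD(1)[OF assms(1) i] by blast
  also have "\<dots> \<subseteq> partial w j" using assms by (intro partial_mono) simp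
  finally show ?thesis .
qed

lemma partial_inj:
  assumes "w \<in> block_words n" "i \<le> length w" "j \<le> length w" "partial w i = partial w j" shows "i = j"
  using partial_strict[OF assms(1), of i j] partial_strict[OF assms(1), of j i] assms by (cases i j rule: linorder_cases) auto

lemma partial_admissible:
  assumes "w \<in> block_words n" "1 \<le> k" "k \<le> length w" shows "admissible n (partial w k)"
proof -
  have "partial w k \<noteq> {}" using partial_strict[OF assms(1), of 0 k] assms by auto
  moreover have "partial w k \<subseteq> ground n"
  proof
    fix x assume "x \<in> partial w k"
    then obtain i where "i < k" "x \<in> w ! i" using assms by (auto simp: partial_iff)
    then show "x \<in> ground n" using block_wordsD(2)[OF assms(1), of i] assms by auto
  qed
  moreover have "- x \<notin> partial w k" if x: "x \<in> partial w k" for x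
  proof
    assume "- x \<in> partial w k"
    then obtain i j where ij: "i < k" "x \<in> w ! i" "j < k" "- x \<in> w ! j" using x assms by (auto simp: partial_iff)
    then have "w ! i \<inter> neg_set (w ! j) = {}" using assms by (intro block_wordsD) auto
    then show False using ij by (auto simp: neg_set_iff)
  qed
  ultimately show ?thesis by (auto simp: admissible_def)
qed

lemma flag_set_order_complex:
  "w \<in> block_words n \<Longrightarrow> flag_set w \<in> order_complex {Q. admissible n Q}"
  unfolding order_complex_def flag_set_def
proof (intro CollectI conjI ballI)
  fix x y assume "x \<in> partial w ` {1..length w}" "y \<in> partial w ` {1..length w}"
  then obtain i j where "x = partial w i" "y = partial w j" by blast
  then show "x \<subseteq> y \<or> y \<subseteq> x" using partial_mono[of i j w] partial_mono[of j i w] by (cases "i \<le> j") auto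
qed (use partial_admissible[of w n] in auto)

lemma card_flag_set: "w \<in> block_words n \<Longrightarrow> card (flag_set w) = length w"
  unfolding flag_set_def by (subst card_image) (auto intro!: inj_onI dest: partial_inj)

text \<open>The number of smaller members recovers the position of a set in the flag; at
  \<open>k = 0\<close> the difference is truncated to 0.\<close>

lemma partial_flag_set_card:
  assumes "w \<in> block_words n" "k \<le> length w"
  shows "card {y \<in> flag_set w. y \<subset> partial w k} = k - 1"
proof -
  have "{y \<in> flag_set w. y \<subset> partial w k} = partial w ` {1..<k}"
  proof (intro equalityI subsetI)
    fix y assume "y \<in> {y \<in> flag_set w. y \<subset> partial w k}"
    then have yin: "y \<in> partial w ` {1..length w}" and yk: "y \<subset> partial w k" by (simp_all add: flag_set_def)
    from yin obtain i where i: "1 \<le> i" "i \<le> length w" "y = partial w i" by (auto simp del: One_nat_def)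
    then have i4: "partial w i \<subset> partial w k" using yk by simp
    have "i < k" using partial_mono[of k i w] i4 by (cases "i < k") auto
    then show "y \<in> partial w ` {1..<k}" using i by auto
  next
    fix y assume "y \<in> partial w ` {1..<k}"
    then obtain i where "1 \<le> i" "i < k" "y = partial w i" by auto
    then show "y \<in> {y \<in> flag_set w. y \<subset> partial w k}"
      using partial_strict[OF assms(1), of i k] assms(2) by (auto simp: flag_set_def)
  qed
  moreover have "inj_on (partial w) {1..<k}"
    using assms by (auto intro!: inj_onI intro: partial_inj[OF assms(1)])
  ultimately show ?thesis by (simp add: card_image)
qed

lemma nth_partial:
  assumes "w \<in> block_words n" "i < length w" shows "w ! i = partial w (Suc i) - partial w i"
  using partial_disjoint[OF assms] partial_Suc[OF assms(2)] by auto

lemma flag_set_inj: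
  assumes "w \<in> block_words n" "u \<in> block_words n" "flag_set w = flag_set u"
  shows "w = u"
proof -
  have len: "length w = length u" using card_flag_set assms by metis
  have eq: "partial w k = partial u k" if "k \<le> length w" for k
  proof (cases "k = 0")
    case False
    then have "partial w k \<in> flag_set u" using that assms(3)[symmetric] by (auto simp: flag_set_def)
    then obtain l where l: "1 \<le> l" "l \<le> length u" "partial w k = partial u l" by (auto simp: flag_set_def)
    have "k - 1 = l - 1"
      using partial_flag_set_card[OF assms(1) that] partial_flag_set_card[OF assms(2) l(2)] l(3) assms(3) by simp
    then have "k = l" using l False by simp
    then show ?thesis using l by simp
  qed simp
  show ?thesis
  proof (rule nth_equalityI[OF len])
    fix i assume "i < length w"
    then show "w ! i = u ! i"
      using nth_partial[OF assms(1), of i] nth_partial[OF assms(2), of i] eq[of i] eq[of "Suc i"] len by simp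
  qed
qed

text \<open>The largest set of the chain is removed, and what it adds to the next smaller one is
  appended as a last block to the word of the rest.\<close>

lemma flag_set_surj:
  assumes "Y \<in> order_complex {Q. admissible n Q}"
  shows "\<exists>w\<in>block_words n. flag_set w = Y"
  using assms
proof (induction "card Y" arbitrary: Y)
  case 0
  then have "Y = {}" by (auto simp: order_complex_def)
  moreover have "[] \<in> block_words n" by (simp add: block_words_iff)
  ultimately show ?case by (intro bexI[of _ "[]"]) (auto simp: flag_set_def)
next
  case (Suc m)
  then have fin: "finite Y" and ne: "Y \<noteq> {}" by (auto simp: order_complex_def)
  obtain M where M: "M \<in> Y" "\<And>y. y \<in> Y \<Longrightarrow> M \<subseteq> y \<Longrightarrow> y = M"
    using finite_has_maximal[OF fin ne] by (metis)
  have top: "y \<subset> M" if "y \<in> Y - {M}" for y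
  proof -
    have "y \<subseteq> M \<or> M \<subseteq> y" using that M(1) Suc.prems unfolding order_complex_def by blast
    then show ?thesis using that M(2)[of y] by blast
  qed
  have "Y - {M} \<in> order_complex {Q. admissible n Q}"
    by (rule order_complex_subset[OF Suc.prems]) auto
  moreover have "m = card (Y - {M})" using Suc.hyps(2) M(1) fin by simp
  ultimately obtain w where w: "w \<in> block_words n" "flag_set w = Y - {M}" using Suc.hyps(1) by blast
  define u where "u = w @ [M - partial w (length w)]"
  have sub: "partial w (length w) \<subset> M"
  proof (cases "w = []")
    case True
    then show ?thesis using M(1) Suc.prems by (auto simp: order_complex_def admissible_def)
  next
    case False
    then have "partial w (length w) \<in> flag_set w" by (cases w) (auto simp: flag_set_def)
    then show ?thesis using w(2) top by blast
  qed
  have adm: "admissible n M" using M(1) Suc.prems by (auto simp: order_complex_def)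
  have in_w: "w ! i \<subseteq> partial w (length w)" if "i < length w" for i using that by (auto simp: partial_iff)
  have p: "partial u k = partial w k" if "k \<le> length w" for k using that by (simp add: partial_def u_def)
  have pM: "partial u (length u) = M" using sub by (auto simp: partial_def u_def)
  have "u \<in> block_words n"
  proof -
    have A: "u ! i \<noteq> {} \<and> u ! i \<subseteq> ground n \<and> u ! i \<subseteq> M" if "i < length u" for i
    proof (cases "i = length w")
      case True
      then show ?thesis using sub adm by (auto simp: u_def admissible_def)
    next
      case False
      then have i: "i < length w" using that by (simp add: u_def)
      then show ?thesis using block_wordsD(1,2)[OF w(1) i] in_w[OF i] sub by (auto simp: u_def nth_append)
    qed
    have "u ! i \<inter> u ! j = {}" if "i < j" "j < length u" for i j
    proof (cases "j = length w")
      case True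
      then show ?thesis using in_w[of i] that by (auto simp: u_def nth_append)
    next
      case False
      then have "i < length w" "j < length w" using that by (simp_all add: u_def)
      then show ?thesis using block_wordsD(3)[OF w(1), of i j] that by (simp add: u_def nth_append)
    qed
    then have "u ! i \<inter> u ! j = {}" if "i \<noteq> j" "i < length u" "j < length u" for i j
      using that Int_commute by (cases i j rule: linorder_cases) blast+
    moreover have "u ! i \<inter> neg_set (u ! j) = {}" if "i < length u" "j < length u" for i j
      using A[OF that(1)] A[OF that(2)] adm unfolding admissible_def by (auto simp: neg_set_iff)
    ultimately show ?thesis using A unfolding block_words_iff by blast
  qed
  moreover have "flag_set u = Y"
  proof -
    have "{1..length u} = insert (length u) {1..length w}" by (auto simp: u_def)
    then have "flag_set u = insert M (partial u ` {1..length w})" using pM by (simp add: flag_set_def)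
    also have "partial u ` {1..length w} = partial w ` {1..length w}" using p by (intro image_cong) auto
    finally show ?thesis using w(2) M(1) by (auto simp: flag_set_def)
  qed
  ultimately show ?case by blast
qed

text \<open>Index \<open>length w\<close> stands for splitting the omitted last block of the face,
  which appends a letter. This unifies the two summands of \<open>word_boundary\<close>.\<close>

definition split_word :: "int set list \<Rightarrow> nat \<Rightarrow> int set \<Rightarrow> int set list" where
  "split_word w i X = take i w @ X # (if i < length w then (w ! i - X) # drop (Suc i) w else [])"

definition split_range :: "nat \<Rightarrow> int set list \<Rightarrow> nat \<Rightarrow> int set set" where
  "split_range n w i = Pow (if i < length w then w ! i else ground n)"

section \<open>Splittings of words and the simplicial boundary\<close>

lemma split_sum_eq: "split_sum f w = (\<Sum>i<length w. (- 1) ^ i * (\<Sum>X\<in>Pow (w ! i). f (split_word w i X)))"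
proof (induction w arbitrary: f)
  case (Cons Z w)
  have sp: "split_word (Z # w) (Suc i) X = Z # split_word w i X" for i X by (simp add: split_word_def)
  show ?case
    unfolding split_sum.simps Cons.IH list.size add_0_right add_Suc_right sum.lessThan_Suc_shift nth_Cons_Suc sp
    by (simp add: sum_negf split_word_def[of _ 0])
qed simp

lemma word_boundary_eq:
  "word_boundary n f w = (\<Sum>i\<le>length w. (- 1) ^ i * (\<Sum>X\<in>split_range n w i. f (split_word w i X)))"
proof -
  have "(\<Sum>i\<le>length w. (- 1) ^ i * (\<Sum>X\<in>split_range n w i. f (split_word w i X)))
      = (\<Sum>i<length w. (- 1) ^ i * (\<Sum>X\<in>Pow (w ! i). f (split_word w i X)))
        + (- 1) ^ length w * (\<Sum>X\<in>Pow (ground n). f (w @ [X]))"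
    unfolding lessThan_Suc_atMost[symmetric] sum.lessThan_Suc
    by (intro arg_cong2[of _ _ _ _ "(+)"] sum.cong) (auto simp: split_range_def split_word_def)
  then show ?thesis by (simp add: word_boundary_def split_sum_eq)
qed

lemma length_split_word [simp]: "i \<le> length w \<Longrightarrow> length (split_word w i X) = Suc (length w)"
  by (auto simp: split_word_def)

lemma partial_split_word:
  assumes "i \<le> length w" "i < length w \<Longrightarrow> X \<subseteq> w ! i"
  shows "k \<le> i \<Longrightarrow> partial (split_word w i X) k = partial w k"
    and "partial (split_word w i X) (Suc i) = partial w i \<union> X"
    and "i < k \<Longrightarrow> k \<le> length w \<Longrightarrow> partial (split_word w i X) (Suc k) = partial w k"
proof -
  show "k \<le> i \<Longrightarrow> partial (split_word w i X) k = partial w k"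
    using assms by (simp add: partial_def split_word_def)
  show "partial (split_word w i X) (Suc i) = partial w i \<union> X"
    using assms by (auto simp: partial_def split_word_def)
  assume k: "i < k" "k \<le> length w"
  then obtain d where d: "k = Suc (i + d)" using less_imp_Suc_add by blast
  have "take (Suc k) (split_word w i X) = take i w @ X # (w ! i - X) # take d (drop (Suc i) w)"
    using assms k by (simp add: split_word_def d Suc_diff_le)
  moreover have "take k w = take i w @ w ! i # take d (drop (Suc i) w)"
    using take_add[of i "Suc d" w] Cons_nth_drop_Suc[of i w, symmetric] k by (simp add: d)
  ultimately show "partial (split_word w i X) (Suc k) = partial w k"
    using assms k by (auto simp: partial_def)
qed

lemma flag_set_split_word:
  assumes "i \<le> length w" "i < length w \<Longrightarrow> X \<subseteq> w ! i"
  shows "flag_set (split_word w i X) = insert (partial w i \<union> X) (flag_set w)"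
proof -
  note p = partial_split_word[OF assms]
  have "{1..Suc (length w)} = insert (Suc i) ({1..i} \<union> Suc ` {Suc i..length w})"
    using assms(1) unfolding image_Suc_atLeastAtMost by auto
  then have "flag_set (split_word w i X) = insert (partial w i \<union> X)
      (partial w ` {1..i} \<union> partial w ` {Suc i..length w})"
    unfolding flag_set_def length_split_word[OF assms(1)] using p
    by (simp add: image_Un image_image del: image_Suc_atLeastAtMost)
  moreover have "{1..length w} = {1..i} \<union> {Suc i..length w}" using assms(1) by auto
  ultimately show ?thesis by (simp add: flag_set_def image_Un)
qed

lemma block_words_sorted:
  "w \<in> block_words n \<longleftrightarrow> sorted_wrt (\<lambda>A B. A \<inter> B = {}) w \<and> (\<forall>B\<in>set w. B \<noteq> {} \<and> B \<subseteq> ground n) \<and>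
     (\<forall>A\<in>set w. \<forall>B\<in>set w. A \<inter> neg_set B = {})"
proof -
  have "(\<forall>i<length w. \<forall>j<length w. i \<noteq> j \<longrightarrow> w ! i \<inter> w ! j = {})
      \<longleftrightarrow> (\<forall>i j. i < j \<longrightarrow> j < length w \<longrightarrow> w ! i \<inter> w ! j = {})"
  proof (intro iffI allI impI)
    fix i j assume A: "\<forall>i j. i < j \<longrightarrow> j < length w \<longrightarrow> w ! i \<inter> w ! j = {}" "i < length w" "j < length w" "i \<noteq> j"
    then show "w ! i \<inter> w ! j = {}" using Int_commute by (cases i j rule: linorder_cases) blast+
  qed auto
  moreover have "w \<in> block_words n \<longleftrightarrow> (\<forall>i<length w. w ! i \<noteq> {} \<and> w ! i \<subseteq> ground n) \<and>
      (\<forall>i<length w. \<forall>j<length w. i \<noteq> j \<longrightarrow> w ! i \<inter> w ! j = {}) \<and>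
      (\<forall>i<length w. \<forall>j<length w. w ! i \<inter> neg_set (w ! j) = {})"
    unfolding block_words_iff all_conj_distrib imp_conjR by (rule refl)
  ultimately show ?thesis unfolding sorted_wrt_iff_nth_less all_set_conv_all_nth by (simp only: conj_ac)
qed

lemma split_word_block_words:
  assumes w: "w \<in> block_words n" and Q: "admissible n Q"
    and i: "i \<le> length w" "partial w i \<subset> Q" "i < length w \<Longrightarrow> Q \<subset> partial w (Suc i)"
  shows "split_word w i (Q - partial w i) \<in> block_words n"
proof -
  define X where "X = Q - partial w i"
  have ws: "sorted_wrt (\<lambda>A B. A \<inter> B = {}) w" "\<And>B. B \<in> set w \<Longrightarrow> B \<noteq> {} \<and> B \<subseteq> ground n"
    "\<And>A B. A \<in> set w \<Longrightarrow> B \<in> set w \<Longrightarrow> A \<inter> neg_set B = {}"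
    using w unfolding block_words_sorted by blast+
  have X: "X \<noteq> {}" "X \<subseteq> ground n" "X \<inter> neg_set X = {}"
    using i(2) Q by (auto simp: X_def admissible_def neg_set_iff)
  show ?thesis
  proof (cases "i < length w")
    case True
    define Z A B where "Z = w ! i" and "A = take i w" and "B = drop (Suc i) w"
    have w_eq: "w = A @ Z # B" using id_take_nth_drop[OF True] by (simp add: Z_def A_def B_def)
    have XZ: "X \<subseteq> Z" "Z - X \<noteq> {}"
      using i(2) i(3)[OF True] partial_Suc[OF True] partial_disjoint[OF w True] by (auto simp: X_def Z_def)
    have "split_word w i X = A @ X # (Z - X) # B" using True by (simp add: split_word_def A_def B_def Z_def)
    moreover have "A @ X # (Z - X) # B \<in> block_words n"
      unfolding block_words_sorted
    proof (intro conjI)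
      show "sorted_wrt (\<lambda>A B. A \<inter> B = {}) (A @ X # (Z - X) # B)"
        using ws(1) XZ(1) unfolding w_eq sorted_wrt_append by auto
      have sub: "\<exists>D\<in>set w. C \<subseteq> D" if "C \<in> set (A @ X # (Z - X) # B)" for C
        using that XZ(1) unfolding w_eq by auto
      show "\<forall>C\<in>set (A @ X # (Z - X) # B). C \<noteq> {} \<and> C \<subseteq> ground n"
      proof
        fix C assume C: "C \<in> set (A @ X # (Z - X) # B)"
        obtain D where "D \<in> set w" "C \<subseteq> D" using sub[OF C] by blast
        then have "C \<subseteq> ground n" using ws(2) by blast
        moreover have "C \<noteq> {}" using C X(1) XZ(2) ws(2)[unfolded w_eq] by auto
        ultimately show "C \<noteq> {} \<and> C \<subseteq> ground n" by simp
      qed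
      show "\<forall>C\<in>set (A @ X # (Z - X) # B). \<forall>D\<in>set (A @ X # (Z - X) # B). C \<inter> neg_set D = {}"
      proof (intro ballI)
        fix C D assume "C \<in> set (A @ X # (Z - X) # B)" "D \<in> set (A @ X # (Z - X) # B)"
        then obtain C' D' where "C' \<in> set w" "C \<subseteq> C'" "D' \<in> set w" "D \<subseteq> D'" using sub by meson
        then show "C \<inter> neg_set D = {}" using ws(3)[of C' D'] by blast
      qed
    qed
    ultimately show ?thesis by (simp add: X_def)
  next
    case False
    then have i_eq: "i = length w" using i(1) by simp
    have sub: "B \<subseteq> partial w i" if "B \<in> set w" for B using that by (auto simp: partial_def i_eq)
    have BQ: "B \<subseteq> Q" if "B \<in> set w" for B using sub[OF that] i(2) by blast
    have negQ: "C \<inter> neg_set D = {}" if "C \<subseteq> Q" "D \<subseteq> Q" for C D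
    proof -
      have "x \<in> Q \<Longrightarrow> - x \<notin> Q" for x using Q unfolding admissible_def by blast
      then show ?thesis using that by (auto simp: neg_set_iff)
    qed
    have "split_word w i X = w @ [X]" by (simp add: split_word_def i_eq)
    moreover have "w @ [X] \<in> block_words n"
      unfolding block_words_sorted
    proof (intro conjI ballI)
      have "B \<inter> X = {}" if "B \<in> set w" for B using sub[OF that] by (auto simp: X_def)
      then show "sorted_wrt (\<lambda>A B. A \<inter> B = {}) (w @ [X])" using ws(1) unfolding sorted_wrt_append by simp
      show "B \<noteq> {}" "B \<subseteq> ground n" if "B \<in> set (w @ [X])" for B using that ws(2) X by auto
      show "C \<inter> neg_set D = {}" if "C \<in> set (w @ [X])" "D \<in> set (w @ [X])" for C D
        using that BQ by (intro negQ) (auto simp: X_def)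
    qed
    ultimately show ?thesis by (simp add: X_def)
  qed
qed

text \<open>The members strictly below \<open>Q\<close> form an initial segment of the chain, so
  their number locates \<open>Q\<close> between two consecutive partial unions.\<close>

lemma flag_set_position:
  assumes w: "w \<in> block_words n" and Q: "Q \<noteq> {}" "Q \<notin> flag_set w" "\<And>y. y \<in> flag_set w \<Longrightarrow> y \<subseteq> Q \<or> Q \<subseteq> y"
  defines "i \<equiv> card {y \<in> flag_set w. y \<subset> Q}"
  shows "i \<le> length w" "partial w i \<subset> Q" "i < length w \<Longrightarrow> Q \<subset> partial w (Suc i)"
proof -
  define A where "A = {k \<in> {1..length w}. partial w k \<subset> Q}"
  have "{y \<in> flag_set w. y \<subset> Q} = partial w ` A" unfolding A_def flag_set_def by blast
  moreover have "inj_on (partial w) A" by (auto simp: A_def intro!: inj_onI intro: partial_inj[OF w])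
  ultimately have iA: "i = card A" unfolding i_def by (simp add: card_image)
  have finA: "finite A" by (simp add: A_def)
  have down: "k \<in> A" if "1 \<le> k" "k \<le> l" "l \<in> A" for k l
    using that partial_mono[of k l w] by (auto simp: A_def)
  have A: "A = {1..i}"
  proof (cases "A = {}")
    case False
    have "A = {1..Max A}"
    proof (intro equalityI subsetI)
      fix k assume "k \<in> {1..Max A}"
      then show "k \<in> A" using down[of k "Max A"] Max_in[OF finA False] by simp
    qed (use finA in \<open>auto simp: A_def\<close>)
    then show ?thesis using iA by (metis card_atLeastAtMost diff_Suc_1)
  qed (use iA in simp)
  show le: "i \<le> length w"
    using card_mono[of "{1..length w}" A] iA by (simp add: A_def subset_iff)
  show "partial w i \<subset> Q"
  proof (cases "i = 0")
    case False
    then have "i \<in> A" using A by simp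
    then show ?thesis by (simp add: A_def)
  qed (use Q(1) in auto)
  assume "i < length w"
  then have f: "partial w (Suc i) \<in> flag_set w" by (auto simp: flag_set_def)
  have "Suc i \<notin> A" using A by simp
  then have "\<not> partial w (Suc i) \<subset> Q" using \<open>i < length w\<close> by (simp add: A_def)
  then show "Q \<subset> partial w (Suc i)" using Q(2) Q(3)[OF f] f by blast
qed

text \<open>Splitting at \<open>i\<close> inserts one set into the flag between consecutive partial
  unions, and \<open>(- 1) ^ i\<close> is its insertion sign. Both boundaries thus have the same
  terms once illegal splittings are dropped.\<close>

lemma word_boundary_flag_set:
  assumes w: "w \<in> block_words n" and h: "\<And>Y. h Y \<noteq> 0 \<Longrightarrow> Y \<in> order_complex {Q. admissible n Q}"
  shows "word_boundary n (\<lambda>u. if u \<in> block_words n then h (flag_set u) else 0) w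
    = bdry {Q. admissible n Q} h (flag_set w)"
proof -
  let ?U = "{Q. admissible n Q}" and ?m = "length w" and ?Y = "flag_set w"
  let ?S = "SIGMA i:{..?m}. split_range n w i"
  define idx where "idx Q = card {y \<in> ?Y. y \<subset> Q}" for Q
  \<comment> \<open>\<open>T\<close> and \<open>T'\<close> index the terms that can be nonzero:
    splittings that yield block words, and new sets that extend the flag to a longer chain.\<close>
  define T where "T = {(i, X) \<in> ?S. split_word w i X \<in> block_words n}"
  define T' where "T' = {Q \<in> ?U - ?Y. insert Q ?Y \<in> order_complex ?U}"
  have finS: "finite ?S"
  proof (rule finite_SigmaI)
    fix i assume "i \<in> {..?m}"
    then show "finite (split_range n w i)"
      using block_wordsD(2)[OF w, of i] finite_subset[OF _ finite_ground[of n]] by (simp add: split_range_def)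
  qed simp
  have "word_boundary n (\<lambda>u. if u \<in> block_words n then h (flag_set u) else 0) w
      = (\<Sum>(i, X)\<in>?S. (- 1) ^ i * (if split_word w i X \<in> block_words n then h (flag_set (split_word w i X)) else 0))"
    unfolding word_boundary_eq sum_distrib_left
    by (rule sum.Sigma) (use block_wordsD(2)[OF w] finite_subset[OF _ finite_ground[of n]] in \<open>auto simp: split_range_def\<close>)
  also have "\<dots> = (\<Sum>(i, X)\<in>T. (- 1) ^ i * h (flag_set (split_word w i X)))"
    using finS by (intro sum.mono_neutral_cong_right) (auto simp: T_def split: if_splits)
  also have "\<dots> = (\<Sum>Q\<in>T'. insert_sign Q ?Y * h (insert Q ?Y))"
  proof (rule sum.reindex_bij_witness[where i = "\<lambda>Q. (idx Q, Q - partial w (idx Q))" and j = "\<lambda>(i, X). partial w i \<union> X"])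
    fix p assume "p \<in> T"
    then obtain i X where p: "p = (i, X)" "i \<le> ?m" "X \<in> split_range n w i" and s: "split_word w i X \<in> block_words n"
      by (auto simp: T_def)
    have X: "i < ?m \<Longrightarrow> X \<subseteq> w ! i" using p(3) by (auto simp: split_range_def)
    define Q where "Q = partial w i \<union> X"
    have Q: "partial (split_word w i X) (Suc i) = Q" using partial_split_word(2)[OF p(2) X] by (simp add: Q_def)
    have fs: "flag_set (split_word w i X) = insert Q ?Y" using flag_set_split_word[OF p(2) X] by (simp add: Q_def)
    have "{y \<in> insert Q ?Y. y \<subset> Q} = {y \<in> ?Y. y \<subset> Q}" by auto
    then have idx: "idx Q = i"
      using partial_flag_set_card[OF s, of "Suc i"] p(2) unfolding Q fs idx_def by simp
    have "split_word w i X ! i = X" using p(2) by (simp add: split_word_def nth_append)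
    then have "partial w i \<inter> X = {}"
      using partial_disjoint[OF s, of i] p(2) partial_split_word(1)[OF p(2) X, of i] by simp
    then show "(\<lambda>Q. (idx Q, Q - partial w (idx Q))) ((\<lambda>(i, X). partial w i \<union> X) p) = p"
      using idx by (auto simp: p Q_def)
    have "card (insert Q ?Y) = Suc (card ?Y)" using card_flag_set[OF s] card_flag_set[OF w] p(2) unfolding fs by simp
    then have "Q \<notin> ?Y" by (auto simp: insert_absorb)
    moreover have "insert Q ?Y \<in> order_complex ?U" using flag_set_order_complex[OF s] fs by simp
    moreover from this have "Q \<in> ?U" by (auto simp: order_complex_def)
    ultimately show "(\<lambda>(i, X). partial w i \<union> X) p \<in> T'" by (simp add: T'_def p Q_def)
    have "insert_sign Q ?Y = (- 1) ^ i" using idx by (simp add: insert_sign_def idx_def)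
    then show "insert_sign ((\<lambda>(i, X). partial w i \<union> X) p) ?Y * h (insert ((\<lambda>(i, X). partial w i \<union> X) p) ?Y)
        = (case p of (i, X) \<Rightarrow> (- 1) ^ i * h (flag_set (split_word w i X)))"
      by (simp add: p fs Q_def)
  next
    fix Q assume QT: "Q \<in> T'"
    then have adm: "admissible n Q" and QY: "Q \<notin> ?Y" and oc: "insert Q ?Y \<in> order_complex ?U" by (auto simp: T'_def)
    have "Q \<noteq> {}" using adm by (simp add: admissible_def)
    moreover have "y \<subseteq> Q \<or> Q \<subseteq> y" if "y \<in> ?Y" for y using oc that unfolding order_complex_def by blast
    ultimately have pos: "idx Q \<le> ?m" "partial w (idx Q) \<subset> Q" "idx Q < ?m \<Longrightarrow> Q \<subset> partial w (Suc (idx Q))"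
      unfolding idx_def using flag_set_position[OF w _ QY] by blast+
    show "(\<lambda>(i, X). partial w i \<union> X) ((\<lambda>Q. (idx Q, Q - partial w (idx Q))) Q) = Q"
      using pos(2) by auto
    have "Q - partial w (idx Q) \<in> split_range n w (idx Q)"
      using pos(3) partial_Suc[of "idx Q" w] adm unfolding split_range_def admissible_def by auto
    then show "(\<lambda>Q. (idx Q, Q - partial w (idx Q))) Q \<in> T"
      using split_word_block_words[OF w adm pos] pos(1) by (simp add: T_def)
  qed
  also have "\<dots> = bdry ?U h ?Y"
    unfolding bdry_def using h by (intro sum.mono_neutral_left) (auto simp: T'_def)
  finally show ?thesis .
qed

text \<open>A simplex inside a finite union of hyperplanes lies in one of them, so a single edge has
  to serve all blocks of the word.\<close>

definition graph_words :: "nat \<Rightarrow> (int \<times> int) set \<Rightarrow> nat \<Rightarrow> int set list set" where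
  "graph_words n E m = {w \<in> block_words n. length w = m \<and> (\<exists>e\<in>E. \<forall>B\<in>set w. collapses e B)}"

text \<open>Blocks are differences of consecutive partial unions, and partial unions are unions of
  blocks; the condition passes through both operations.\<close>

lemma collapses_flag_set:
  assumes w: "w \<in> block_words n"
  shows "(\<forall>Q\<in>flag_set w. collapses e Q) \<longleftrightarrow> (\<forall>B\<in>set w. collapses e B)"
proof
  assume A: "\<forall>Q\<in>flag_set w. collapses e Q"
  have p: "collapses e (partial w k)" if "k \<le> length w" for k
    using A that by (cases "k = 0") (auto simp: collapses_def flag_set_def)
  show "\<forall>B\<in>set w. collapses e B"
  proof
    fix B assume "B \<in> set w"
    then obtain i where i: "i < length w" "B = w ! i" by (auto simp: in_set_conv_nth)
    then show "collapses e B"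
      using p[of i] p[of "Suc i"] nth_partial[OF w i(1)] by (auto simp: collapses_def)
  qed
next
  assume "\<forall>B\<in>set w. collapses e B"
  then have "\<And>B. B \<in> set w \<Longrightarrow> (fst e \<in> B \<longleftrightarrow> snd e \<in> B) \<and> (- fst e \<in> B \<longleftrightarrow> - snd e \<in> B)"
    by (simp add: collapses_def)
  then show "\<forall>Q\<in>flag_set w. collapses e Q"
    by (auto simp: flag_set_def partial_def collapses_def dest: in_set_takeD)
qed

lemma ex_flag_function:
  assumes g: "\<And>w. g w \<noteq> 0 \<Longrightarrow> w \<in> block_words n"
  shows "\<exists>f. (\<forall>Y. f Y \<noteq> 0 \<longrightarrow> Y \<in> order_complex {Q. admissible n Q}) \<and>
    g = (\<lambda>u. if u \<in> block_words n then f (flag_set u) else 0)"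
proof -
  let ?U = "{Q. admissible n Q}"
  define wof where "wof = inv_into (block_words n) flag_set"
  have wof: "wof (flag_set w) = w" if "w \<in> block_words n" for w
    unfolding wof_def using that flag_set_inj by (intro inv_into_f_f) (auto intro!: inj_onI)
  define f where "f Y = (if Y \<in> order_complex ?U then g (wof Y) else 0)" for Y
  have "g u = (if u \<in> block_words n then f (flag_set u) else 0)" for u
    using g[of u] wof[of u] flag_set_order_complex[of u n] by (auto simp: f_def)
  then have "g = (\<lambda>u. if u \<in> block_words n then f (flag_set u) else 0)" ..
  moreover have "f Y \<noteq> 0 \<longrightarrow> Y \<in> order_complex ?U" for Y by (simp add: f_def)
  ultimately show ?thesis by blast
qed

text \<open>Transported from the order complex. Cutting the inner boundary off to block words makes
  it a function of the flag.\<close>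

lemma word_boundary_twice:
  assumes g: "\<And>w. g w \<noteq> 0 \<Longrightarrow> w \<in> block_words n \<and> length w = k" and w: "w \<in> block_words n"
  shows "word_boundary n (\<lambda>u. if u \<in> block_words n then word_boundary n g u else 0) w = 0"
proof -
  let ?U = "{Q. admissible n Q}"
  have "w \<in> block_words n" if "g w \<noteq> 0" for w using g[OF that] ..
  from ex_flag_function[OF this] obtain f where f': "\<forall>Y. f Y \<noteq> 0 \<longrightarrow> Y \<in> order_complex ?U"
    and g_eq: "g = (\<lambda>u. if u \<in> block_words n then f (flag_set u) else 0)" by blast
  have f: "Y \<in> order_complex ?U" if "f Y \<noteq> 0" for Y using f' that by blast
  have supp: "supp_on (order_complex ?U) k f"
    unfolding supp_on_def
  proof (intro allI impI)
    fix Y assume fY: "f Y \<noteq> 0"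
    obtain u where u: "u \<in> block_words n" "flag_set u = Y" using flag_set_surj[OF f[OF fY]] by blast
    have "g u = f (flag_set u)" using u(1) by (subst g_eq) simp
    then have "length u = k" using g[of u] fY u(2) by simp
    then show "Y \<in> order_complex ?U \<and> card Y = k" using f[OF fY] card_flag_set[OF u(1)] u(2) by simp
  qed
  have "Y \<in> order_complex ?U" if nz: "bdry ?U f Y \<noteq> 0" for Y
  proof -
    from sum.not_neutral_contains_not_neutral[OF nz[unfolded bdry_def]]
    obtain q where "f (insert q Y) \<noteq> 0" by auto
    then show "Y \<in> order_complex ?U" using f[of "insert q Y"] order_complex_subset by blast
  qed
  note bd = word_boundary_flag_set[OF w this]
  have "(\<lambda>u. if u \<in> block_words n then word_boundary n g u else 0)
      = (\<lambda>u. if u \<in> block_words n then bdry ?U f (flag_set u) else 0)"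
  proof
    fix u
    show "(if u \<in> block_words n then word_boundary n g u else 0)
        = (if u \<in> block_words n then bdry ?U f (flag_set u) else 0)"
      unfolding g_eq using word_boundary_flag_set[of u n f, OF _ f] by simp
  qed
  then show ?thesis using bd bdry_bdry[OF finite_admissible supp] by simp
qed

text \<open>The identity labelling encodes the whole space, a flat of dimension \<open>n\<close>, so
  the acyclicity of arrangements translates into exactness on words.\<close>

lemma graph_words_exact:
  assumes E: "finite E" "E \<noteq> {}" "E \<subseteq> ground n \<times> ground n" and m: "Suc m < n"
    and g: "\<And>w. g w \<noteq> 0 \<Longrightarrow> w \<in> graph_words n E m"
    and cyc: "\<And>w. w \<in> block_words n \<Longrightarrow> word_boundary n g w = 0"
  shows "\<exists>h. (\<forall>w. h w \<noteq> 0 \<longrightarrow> w \<in> graph_words n E (Suc m)) \<and> (\<forall>w\<in>block_words n. word_boundary n h w = g w)"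
proof -
  let ?U = "{Q. admissible n Q}"
  define K where "K = (\<Union>e\<in>E. order_complex (flat_sets n id \<inter> {Q. collapses e Q}))"
  have flat: "flat_sets n id = ?U" by (auto simp: flat_sets_def)
  have "{a. 0 < a \<and> a \<in> id ` ground n} = {1..int n}" by (auto simp: ground_def)
  then have dim: "flat_dim n id = n" by (simp add: flat_dim_def)
  have ac: "acyclic_at ?U K m"
    unfolding K_def using E m dim by (intro arrangement_acyclic) (auto simp: odd_map_def)
  have K: "flag_set w \<in> K \<and> card (flag_set w) = k \<longleftrightarrow> w \<in> graph_words n E k" if "w \<in> block_words n" for w k
  proof -
    have "flag_set w \<in> K \<longleftrightarrow> (\<exists>e\<in>E. \<forall>Q\<in>flag_set w. collapses e Q)"
    proof -
      have "flag_set w \<in> order_complex (?U \<inter> {Q. collapses e Q}) \<longleftrightarrow> (\<forall>Q\<in>flag_set w. collapses e Q)" for e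
        using flag_set_order_complex[OF that] unfolding order_complex_def by auto
      then show ?thesis unfolding K_def flat by simp
    qed
    then show ?thesis
      using that card_flag_set[OF that] unfolding collapses_flag_set[OF that] graph_words_def by auto
  qed
  have KU: "K \<subseteq> order_complex ?U" unfolding K_def flat by (auto simp: order_complex_def)
  obtain f where f_oc: "\<And>Y. f Y \<noteq> 0 \<Longrightarrow> Y \<in> order_complex ?U"
    and g_eq: "g = (\<lambda>u. if u \<in> block_words n then f (flag_set u) else 0)"
  proof -
    have "w \<in> block_words n" if "g w \<noteq> 0" for w using g[OF that] by (simp add: graph_words_def)
    from ex_flag_function[OF this] show ?thesis using that by blast
  qed
  have "supp_on K m f"
    unfolding supp_on_def
  proof (intro allI impI)
    fix Y assume fY: "f Y \<noteq> 0"
    obtain w where w: "w \<in> block_words n" "flag_set w = Y" using flag_set_surj[OF f_oc[OF fY]] by blast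
    have "g w = f (flag_set w)" using w(1) by (subst g_eq) simp
    then have "w \<in> graph_words n E m" using g[of w] fY w(2) by simp
    then show "Y \<in> K \<and> card Y = m" using K[OF w(1), of m] w(2) by simp
  qed
  moreover have "bdry ?U f = (\<lambda>_. 0)"
  proof
    fix Y
    show "bdry ?U f Y = 0"
    proof (cases "Y \<in> order_complex ?U")
      case True
      obtain w where w: "w \<in> block_words n" "flag_set w = Y" using flag_set_surj[OF True] by blast
      have "bdry ?U f (flag_set w) = word_boundary n g w"
        unfolding g_eq by (rule word_boundary_flag_set[OF w(1) f_oc, symmetric])
      then show ?thesis using w cyc by simp
    next
      case False
      have "f (insert q Y) = 0" for q
      proof (rule ccontr)
        assume "f (insert q Y) \<noteq> 0"
        then have "insert q Y \<in> order_complex ?U" by (rule f_oc)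
        then show False using False order_complex_subset by blast
      qed
      then show ?thesis by (simp add: bdry_def)
    qed
  qed
  ultimately obtain h where h: "supp_on K (Suc m) h" "bdry ?U h = f"
    using ac unfolding acyclic_at_def by blast
  have h_oc: "Y \<in> order_complex ?U" if "h Y \<noteq> 0" for Y using h(1) that KU by (auto simp: supp_on_def)
  show ?thesis
  proof (intro exI conjI ballI allI impI)
    fix w
    show "w \<in> graph_words n E (Suc m)" if "(if w \<in> block_words n then h (flag_set w) else 0) \<noteq> 0"
      using that h(1) K[of w "Suc m"] by (auto simp: supp_on_def split: if_splits)
    show "word_boundary n (\<lambda>u. if u \<in> block_words n then h (flag_set u) else 0) w = g w" if "w \<in> block_words n"
      using word_boundary_flag_set[OF that, of h] h_oc that by (simp add: h(2) g_eq)
  qed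
qed

section \<open>Faces of the coloring complex as words\<close>

text \<open>Signed indices bring the three kinds of hyperplanes into the single form that
  \<open>collapses\<close> tests.\<close>

definition edge_pairs :: "signed_graph \<Rightarrow> (int \<times> int) set" where
  "edge_pairs G = {(int i, int j) | i j. {i, j} \<in> pos_edges G} \<union> {(int i, - int j) | i j. {i, j} \<in> neg_edges G}
     \<union> {(int i, - int i) | i. {i} \<in># half_edges G}"

definition word_face :: "nat \<Rightarrow> int set list \<Rightarrow> int set list" where
  "word_face n w = w @ [ground n - \<Union> (set w)]"

lemma edge_pairs_props:
  assumes "signed_graph_on n G"
  shows "edge_pairs G \<subseteq> ground n \<times> ground n" "finite (edge_pairs G)" "\<And>e. e \<in> edge_pairs G \<Longrightarrow> fst e \<noteq> snd e"
proof -
  have pos: "i \<in> {1..n} \<and> j \<in> {1..n} \<and> i \<noteq> j" if "{i, j} \<in> pos_edges G" for i j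
    using assms that unfolding signed_graph_on_def by (cases "i = j") fastforce+
  have neg: "i \<in> {1..n} \<and> j \<in> {1..n} \<and> i \<noteq> j" if "{i, j} \<in> neg_edges G" for i j
    using assms that unfolding signed_graph_on_def by (cases "i = j") fastforce+
  have half: "i \<in> {1..n}" if "{i} \<in># half_edges G" for i
    using assms that unfolding signed_graph_on_def by fastforce
  show sub: "edge_pairs G \<subseteq> ground n \<times> ground n"
    using pos neg half by (fastforce simp: edge_pairs_def ground_def)
  then show "finite (edge_pairs G)" by (rule finite_subset) simp
  show "fst e \<noteq> snd e" if "e \<in> edge_pairs G" for e
    using that pos neg half by (fastforce simp: edge_pairs_def)
qed

lemma edge_pairs_nonempty:
  assumes "signed_graph_on n G" "edge_multiset G \<noteq> {#}"
  shows "edge_pairs G \<noteq> {}"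
proof -
  have "pos_edges G \<noteq> {} \<or> neg_edges G \<noteq> {} \<or> half_edges G \<noteq> {#}"
    using assms(2) unfolding edge_multiset_def by auto
  moreover have "\<exists>i j. e = {i, j}" if "card e = 2" for e :: "nat set"
    using that by (auto simp: card_2_iff)
  moreover have "\<exists>i. e = {i}" if "card e = 1" for e :: "nat set"
    using that by (auto simp: card_1_singleton_iff)
  ultimately show ?thesis
    using assms(1) unfolding signed_graph_on_def edge_pairs_def by (fastforce dest: multiset_nonemptyE)
qed

subsection \<open>Simplices inside the arrangement\<close>

text \<open>Extends the coordinates of \<open>cube_vertex\<close> to signed indices, so that one
  equality covers all kinds of hyperplanes.\<close>

definition sign_vector :: "int set \<Rightarrow> int \<Rightarrow> real" where
  "sign_vector Q z = (if z \<in> Q then 1 else if - z \<in> Q then - 1 else 0)"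

lemma sign_vector_uminus: "admissible n Q \<Longrightarrow> sign_vector Q (- z) = - sign_vector Q z"
  by (auto simp: sign_vector_def admissible_def)

lemma collapses_sign_vector:
  "admissible n Q \<Longrightarrow> collapses e Q \<longleftrightarrow> sign_vector Q (fst e) = sign_vector Q (snd e)"
proof -
  assume "admissible n Q"
  then have "z \<in> Q \<Longrightarrow> - z \<notin> Q" for z unfolding admissible_def by blast
  from this[of "fst e"] this[of "snd e"] show ?thesis
    by (auto simp: sign_vector_def collapses_def split: if_splits)
qed

text \<open>A set of the flag that separates \<open>a\<close> from \<open>b\<close> makes the
  barycentre larger at \<open>a\<close>: the sets above it contain \<open>a\<close>, and those below
  it contain neither \<open>b\<close> nor \<open>- a\<close>.\<close>

lemma sum_sign_vector_less:
  assumes "flag n Qs" "Q \<in> set Qs" "a \<in> Q" "b \<notin> Q"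
  shows "(\<Sum>k<length Qs. sign_vector (Qs ! k) b) < (\<Sum>k<length Qs. sign_vector (Qs ! k) a)"
proof (rule sum_strict_mono_ex1)
  obtain k0 where k0: "k0 < length Qs" "Q = Qs ! k0" using assms(2) by (auto simp: in_set_conv_nth)
  have adm: "z \<in> Qs ! k \<Longrightarrow> - z \<notin> Qs ! k" if "k < length Qs" for k z
    using assms(1) that nth_mem[of k Qs] unfolding flag_def admissible_def by blast
  have chain: "Qs ! k \<subset> Qs ! l" if "k < l" "l < length Qs" for k l
    using assms(1) that unfolding flag_def sorted_wrt_iff_nth_less by blast
  show "\<forall>k\<in>{..<length Qs}. sign_vector (Qs ! k) b \<le> sign_vector (Qs ! k) a"
  proof
    fix k assume k: "k \<in> {..<length Qs}"
    show "sign_vector (Qs ! k) b \<le> sign_vector (Qs ! k) a"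
    proof (cases "k0 \<le> k")
      case True
      then have "a \<in> Qs ! k" using chain[of k0 k] k k0 assms(3) by (cases "k0 = k") auto
      then show ?thesis by (auto simp: sign_vector_def)
    next
      case False
      then have "Qs ! k \<subset> Q" using chain[of k k0] k0 by auto
      then have "b \<notin> Qs ! k" "- a \<notin> Qs ! k" using assms(3,4) adm[OF k0(1), of a] k0(2) by auto
      then show ?thesis by (auto simp: sign_vector_def)
    qed
  qed
  show "\<exists>k\<in>{..<length Qs}. sign_vector (Qs ! k) b < sign_vector (Qs ! k) a"
    using k0 assms(3,4) by (intro bexI[of _ k0]) (auto simp: sign_vector_def)
qed simp

lemma Union_setcompr1: "\<Union> {F i | i. P i} = {x. \<exists>i. P i \<and> x \<in> F i}"
  by blast

lemma Union_setcompr2: "\<Union> {F i j | i j. P i j} = {x. \<exists>i j. P i j \<and> x \<in> F i j}"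
  by blast

lemma bex_setcompr1: "(\<exists>x\<in>{F i | i. P i}. R x) \<longleftrightarrow> (\<exists>i. P i \<and> R (F i))"
  by blast

lemma bex_setcompr2: "(\<exists>x\<in>{F i j | i j. P i j}. R x) \<longleftrightarrow> (\<exists>i j. P i j \<and> R (F i j))"
  by blast

text \<open>A hyperplane through the barycentre contains every vertex, because the contributions of
  nested sets cannot balance each other. Hence a simplex in the union lies in a single
  hyperplane.\<close>

lemma flag_simplex_iff:
  assumes Qs: "flag n Qs" "Qs \<noteq> []"
  shows "flag_simplex Qs \<subseteq> \<Union> (arrangement n G) \<longleftrightarrow> (\<exists>e\<in>edge_pairs G. \<forall>Q\<in>set Qs. collapses e Q)"
proof -
  have adm: "admissible n (Qs ! k)" if "k < length Qs" for k
    using Qs(1) that nth_mem[of k Qs] unfolding flag_def by blast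
  define X where "X t z = (\<Sum>k<length Qs. t k * sign_vector (Qs ! k) z)" for t z
  have X_neg: "X t (- z) = - X t z" for t z
    unfolding X_def sum_negf[symmetric] by (intro sum.cong refl) (simp add: sign_vector_uminus[OF adm])
  have X_eq: "(\<lambda>i. \<Sum>k<length Qs. t k * cube_vertex (Qs ! k) i) = (\<lambda>i. X t (int i))" for t
    by (simp add: X_def cube_vertex_def sign_vector_def)
  have mem: "(\<lambda>i. X t (int i)) \<in> \<Union> (arrangement n G) \<longleftrightarrow> (\<exists>e\<in>edge_pairs G. X t (fst e) = X t (snd e))" for t
  proof -
    have euc: "(\<lambda>i. X t (int i)) \<in> euclidean n"
    proof -
      have "sign_vector (Qs ! k) (int i) = 0" if "k < length Qs" "i \<notin> {1..n}" for k i
        using adm[OF that(1)] that(2) by (auto simp: sign_vector_def admissible_def ground_def)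
      then show ?thesis by (auto simp: euclidean_def X_def intro!: sum.neutral)
    qed
    have "(\<lambda>i. X t (int i)) \<in> \<Union> (arrangement n G) \<longleftrightarrow>
        (\<exists>i j. {i, j} \<in> pos_edges G \<and> X t (int i) = X t (int j)) \<or>
        (\<exists>i j. {i, j} \<in> neg_edges G \<and> X t (int i) = - X t (int j)) \<or>
        (\<exists>i. {i} \<in># half_edges G \<and> X t (int i) = 0)"
    proof -
      have "\<Union> (arrangement n G) = {x. \<exists>i j. {i, j} \<in> pos_edges G \<and> x \<in> {x \<in> euclidean n. x i = x j}}
          \<union> {x. \<exists>i j. {i, j} \<in> neg_edges G \<and> x \<in> {x \<in> euclidean n. x i = - x j}}
          \<union> {x. \<exists>i. {i} \<in># half_edges G \<and> x \<in> {x \<in> euclidean n. x i = 0}}"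
        unfolding arrangement_def Union_Un_distrib Union_setcompr2 Union_setcompr1 ..
      then show ?thesis using euc by simp
    qed
    also have "\<dots> \<longleftrightarrow> (\<exists>e\<in>edge_pairs G. X t (fst e) = X t (snd e))"
      unfolding edge_pairs_def bex_Un bex_setcompr2 bex_setcompr1 fst_conv snd_conv X_neg by simp
    finally show ?thesis .
  qed
  show ?thesis
  proof
    assume sub: "flag_simplex Qs \<subseteq> \<Union> (arrangement n G)"
    \<comment> \<open>Equal weights give the barycentre.\<close>
    define t where "t k = 1 / real (length Qs)" for k :: nat
    have "(\<lambda>i. X t (int i)) \<in> flag_simplex Qs"
      unfolding flag_simplex_def X_eq[symmetric] using Qs(2) by (intro CollectI exI[of _ t]) (auto simp: t_def)
    then obtain e where e: "e \<in> edge_pairs G" "X t (fst e) = X t (snd e)" using sub mem by blast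
    have sum_eq: "(\<Sum>k<length Qs. sign_vector (Qs ! k) (fst e)) = (\<Sum>k<length Qs. sign_vector (Qs ! k) (snd e))"
      using e(2) Qs(2) by (simp add: X_def t_def sum_divide_distrib[symmetric])
    have sum_neg: "(\<Sum>k<length Qs. sign_vector (Qs ! k) (- z)) = - (\<Sum>k<length Qs. sign_vector (Qs ! k) z)" for z
      unfolding sum_negf[symmetric] by (intro sum.cong refl) (simp add: sign_vector_uminus[OF adm])
    \<comment> \<open>Equal sums rule out a set that contains exactly one of the two indices. The
      negated indices have opposite sums, which are again equal, so no set separates them
      either.\<close>
    have "collapses e Q" if "Q \<in> set Qs" for Q
      using sum_sign_vector_less[OF Qs(1) that, of "fst e" "snd e"] sum_sign_vector_less[OF Qs(1) that, of "snd e" "fst e"]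
        sum_sign_vector_less[OF Qs(1) that, of "- fst e" "- snd e"] sum_sign_vector_less[OF Qs(1) that, of "- snd e" "- fst e"]
        sum_eq sum_neg unfolding collapses_def by (metis less_irrefl)
    then show "\<exists>e\<in>edge_pairs G. \<forall>Q\<in>set Qs. collapses e Q" using e(1) by blast
  next
    assume "\<exists>e\<in>edge_pairs G. \<forall>Q\<in>set Qs. collapses e Q"
    then obtain e where e: "e \<in> edge_pairs G" "\<And>Q. Q \<in> set Qs \<Longrightarrow> collapses e Q" by blast
    have "X t (fst e) = X t (snd e)" for t
      unfolding X_def
    proof (rule sum.cong[OF refl])
      fix k assume "k \<in> {..<length Qs}"
      then show "t k * sign_vector (Qs ! k) (fst e) = t k * sign_vector (Qs ! k) (snd e)"
        using e(2)[of "Qs ! k"] collapses_sign_vector[OF adm, of k e] by simp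
    qed
    then have "(\<lambda>i. X t (int i)) \<in> \<Union> (arrangement n G)" for t using mem e(1) by blast
    then show "flag_simplex Qs \<subseteq> \<Union> (arrangement n G)" unfolding flag_simplex_def X_eq by blast
  qed
qed

subsection \<open>Flags and words\<close>

lemma sorted_subset_eq:
  "sorted_wrt (\<subset>) xs \<Longrightarrow> sorted_wrt (\<subset>) ys \<Longrightarrow> set xs = set ys \<Longrightarrow> xs = ys"
proof (induction xs arbitrary: ys)
  case (Cons x xs)
  then obtain y ys' where ys: "ys = y # ys'" by (cases ys) auto
  have "x = y \<or> x \<in> set ys'" "y = x \<or> y \<in> set xs" using Cons.prems(3) by (auto simp: ys)
  then have xy: "x = y" using Cons.prems(1,2) unfolding ys by auto
  have "x \<notin> set xs" "y \<notin> set ys'" using Cons.prems(1,2) unfolding ys by auto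
  then have "set xs = set ys'" using Cons.prems(3) unfolding ys xy by auto
  then show ?case using Cons.IH[of ys'] Cons.prems(1,2) by (simp add: ys xy)
qed simp

abbreviation word_flag :: "int set list \<Rightarrow> int set list" where
  "word_flag w \<equiv> map (partial w) [1..<Suc (length w)]"

lemma set_word_flag: "set (word_flag w) = flag_set w"
  by (simp add: flag_set_def atLeastLessThanSuc_atLeastAtMost del: upt_Suc)

lemma word_flag_flag: "w \<in> block_words n \<Longrightarrow> flag n (word_flag w)"
  unfolding flag_def sorted_wrt_iff_nth_less
  using partial_admissible[of w n] partial_strict[of w n "Suc i" "Suc j" for i j]
  by (auto simp del: upt_Suc psubsetI)

lemma flag_word:
  assumes "flag n Qs" shows "\<exists>w\<in>block_words n. Qs = word_flag w"
proof -
  have "set Qs \<in> order_complex {Q. admissible n Q}"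
    unfolding order_complex_def
  proof (intro CollectI conjI ballI)
    fix x y assume "x \<in> set Qs" "y \<in> set Qs"
    then obtain i j where ij: "i < length Qs" "x = Qs ! i" "j < length Qs" "y = Qs ! j" by (auto simp: in_set_conv_nth)
    have "sorted_wrt (\<subset>) Qs" using assms by (simp add: flag_def)
    then show "x \<subseteq> y \<or> y \<subseteq> x"
      using ij unfolding sorted_wrt_iff_nth_less by (cases i j rule: linorder_cases) blast+
  qed (use assms in \<open>auto simp: flag_def\<close>)
  then obtain w where w: "w \<in> block_words n" "flag_set w = set Qs" using flag_set_surj by blast
  have "Qs = word_flag w"
    using assms word_flag_flag[OF w(1)] w(2) set_word_flag[of w] unfolding flag_def
    by (intro sorted_subset_eq) auto
  then show ?thesis using w(1) by blast
qed

lemma flag_partition_word_flag: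
  assumes w: "w \<in> block_words n" shows "flag_partition n (word_flag w) = word_face n w"
proof (rule nth_equalityI)
  show len: "length (flag_partition n (word_flag w)) = length (word_face n w)"
    by (simp add: flag_partition_def word_face_def del: upt_Suc)
  fix k assume "k < length (flag_partition n (word_flag w))"
  then have k: "k \<le> length w" using len by (simp add: word_face_def)
  have prev: "({} # word_flag w) ! k = partial w k" using k by (cases k) (auto simp del: upt_Suc)
  have "flag_partition n (word_flag w) ! k = (word_flag w @ [ground n]) ! k - ({} # word_flag w) ! k"
    using k by (simp add: flag_partition_def del: upt_Suc)
  also have "\<dots> = word_face n w ! k"
  proof (cases "k = length w")
    case True
    then show ?thesis unfolding prev by (simp add: word_face_def nth_append partial_def del: upt_Suc)
  next
    case False
    then have "(word_flag w @ [ground n]) ! k = partial w (Suc k)" using k by (simp add: nth_append del: upt_Suc)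
    then show ?thesis unfolding prev using nth_partial[OF w, of k] k False by (simp add: word_face_def nth_append)
  qed
  finally show "flag_partition n (word_flag w) ! k = word_face n w ! k" .
qed

lemma faces_eq:
  assumes "edge_pairs G \<noteq> {}"
  shows "faces n G (int m - 1) = word_face n ` graph_words n (edge_pairs G) m"
proof -
  have iff: "flag_simplex (word_flag w) \<subseteq> \<Union> (arrangement n G) \<longleftrightarrow> (\<exists>e\<in>edge_pairs G. \<forall>B\<in>set w. collapses e B)"
    if w: "w \<in> block_words n" for w
  proof (cases "w = []")
    \<comment> \<open>The empty flag has an empty simplex, which lies in any arrangement, while the
      condition on words asks for at least one edge.\<close>
    case True
    then show ?thesis using assms by (auto simp: flag_simplex_def)
  next
    case False
    have "length (word_flag w) = length w" by (simp del: upt_Suc)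
    then have "word_flag w \<noteq> []" using False by (metis length_0_conv)
    then have "flag_simplex (word_flag w) \<subseteq> \<Union> (arrangement n G)
        \<longleftrightarrow> (\<exists>e\<in>edge_pairs G. \<forall>Q\<in>flag_set w. collapses e Q)"
      using flag_simplex_iff[OF word_flag_flag[OF w], of G] unfolding set_word_flag by blast
    then show ?thesis using collapses_flag_set[OF w] by simp
  qed
  show ?thesis
  proof (intro equalityI subsetI)
    fix P assume "P \<in> faces n G (int m - 1)"
    then obtain Qs where Qs: "P = flag_partition n Qs" "flag n Qs" "length Qs = m" "flag_simplex Qs \<subseteq> \<Union> (arrangement n G)"
      by (auto simp: faces_def)
    obtain w where w: "w \<in> block_words n" "Qs = word_flag w" using flag_word[OF Qs(2)] by blast
    then have "w \<in> graph_words n (edge_pairs G) m" using Qs iff[OF w(1)] by (simp add: graph_words_def del: upt_Suc)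
    then show "P \<in> word_face n ` graph_words n (edge_pairs G) m"
      using Qs(1) w flag_partition_word_flag by blast
  next
    fix P assume "P \<in> word_face n ` graph_words n (edge_pairs G) m"
    then obtain w where w: "P = word_face n w" "w \<in> graph_words n (edge_pairs G) m" by blast
    then have wb: "w \<in> block_words n" "length w = m" by (auto simp: graph_words_def)
    show "P \<in> faces n G (int m - 1)"
      unfolding faces_def
      using w wb iff[OF wb(1)] word_flag_flag[OF wb(1)] flag_partition_word_flag[OF wb(1)]
      by (intro CollectI exI[of _ "word_flag w"]) (simp add: graph_words_def del: upt_Suc)
  qed
qed

lemma word_face_inj: "word_face n w = word_face n u \<longleftrightarrow> w = u"
  by (auto simp: word_face_def)

lemma finite_block_words_length: "finite {w \<in> block_words n. length w = m}"
  by (rule finite_subset[OF _ finite_lists_length_eq[of "Pow (ground n)" m]])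
    (auto simp: block_words_sorted)

lemma finite_graph_words [simp]: "finite (graph_words n E m)"
  by (rule finite_subset[OF _ finite_block_words_length[of n m]]) (auto simp: graph_words_def)

subsection \<open>Boundary and group action on words\<close>

text \<open>Merging the last letter with the omitted block deletes it. Indices start at 0 here and
  at 1 in \<open>merge_blocks\<close>.\<close>

definition merge_word :: "nat \<Rightarrow> int set list \<Rightarrow> int set list" where
  "merge_word i u = (if Suc i < length u then take i u @ (u ! i \<union> u ! Suc i) # drop (Suc (Suc i)) u else take i u)"

lemma merge_blocks_word_face:
  assumes u: "u \<in> block_words n" and i: "i < length u"
  shows "merge_blocks (Suc i) (word_face n u) = word_face n (merge_word i u)"
proof (cases "Suc i < length u")
  case True
  define A Z Y B where "A = take i u" and "Z = u ! i" and "Y = u ! Suc i" and "B = drop (Suc (Suc i)) u"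
  have u_eq: "u = A @ Z # Y # B"
    using id_take_nth_drop[OF i] Cons_nth_drop_Suc[OF True] by (simp add: A_def Z_def Y_def B_def)
  have "i = length A" using i by (simp add: A_def)
  then show ?thesis unfolding u_eq by (simp add: merge_blocks_def word_face_def merge_word_def Un_assoc nth_append)
next
  case False
  define A Z where "A = take i u" and "Z = u ! i"
  have u_eq: "u = A @ [Z]" using id_take_nth_drop[OF i] False by (simp add: A_def Z_def)
  have iA: "i = length A" using i by (simp add: A_def)
  have "Z \<subseteq> ground n" "Z \<inter> \<Union> (set A) = {}"
    using block_wordsD(2)[OF u i] partial_disjoint[OF u i] by (auto simp: Z_def A_def partial_def)
  then have "Z \<union> (ground n - (Z \<union> \<Union> (set A))) = ground n - \<Union> (set A)" by blast
  then show ?thesis unfolding u_eq by (simp add: merge_blocks_def word_face_def merge_word_def iA nth_append)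
qed

lemma merge_word_graph_words:
  assumes u: "u \<in> graph_words n E (Suc m)" and i: "i \<le> m"
  shows "merge_word i u \<in> graph_words n E m"
proof -
  have ub: "u \<in> block_words n" and len: "length u = Suc m" using u by (auto simp: graph_words_def)
  obtain e where e: "e \<in> E" "\<And>B. B \<in> set u \<Longrightarrow> collapses e B" using u by (auto simp: graph_words_def)
  show ?thesis
  proof (cases "Suc i < length u")
    case True
    define A Z Y B where "A = take i u" and "Z = u ! i" and "Y = u ! Suc i" and "B = drop (Suc (Suc i)) u"
    have u_eq: "u = A @ Z # Y # B"
      using id_take_nth_drop[of i u] Cons_nth_drop_Suc[OF True] True by (simp add: A_def Z_def Y_def B_def)
    have m_eq: "merge_word i u = A @ (Z \<union> Y) # B" using True by (simp add: merge_word_def A_def Z_def Y_def B_def)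
    have s: "sorted_wrt (\<lambda>A B. A \<inter> B = {}) u" "\<And>C. C \<in> set u \<Longrightarrow> C \<noteq> {} \<and> C \<subseteq> ground n"
      "\<And>C D. C \<in> set u \<Longrightarrow> D \<in> set u \<Longrightarrow> C \<inter> neg_set D = {}"
      using ub unfolding block_words_sorted by blast+
    have set_u: "set u = insert Z (insert Y (set A \<union> set B))" by (simp add: u_eq insert_commute)
    have "merge_word i u \<in> block_words n"
      unfolding m_eq block_words_sorted
    proof (intro conjI)
      show "sorted_wrt (\<lambda>A B. A \<inter> B = {}) (A @ (Z \<union> Y) # B)"
        using s(1) unfolding u_eq sorted_wrt_append by (auto simp: Int_Un_distrib Int_Un_distrib2)
      show "\<forall>C\<in>set (A @ (Z \<union> Y) # B). C \<noteq> {} \<and> C \<subseteq> ground n"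
        using s(2) unfolding set_u by auto
      show "\<forall>C\<in>set (A @ (Z \<union> Y) # B). \<forall>D\<in>set (A @ (Z \<union> Y) # B). C \<inter> neg_set D = {}"
        using s(3) unfolding set_u by (simp add: image_Un Int_Un_distrib Int_Un_distrib2)
    qed
    moreover have "collapses e C" if "C \<in> set (merge_word i u)" for C
      using that e(2) unfolding m_eq set_u by (auto simp: collapses_def)
    moreover have "length (merge_word i u) = m" using True len by (simp add: merge_word_def)
    ultimately show ?thesis using e(1) by (auto simp: graph_words_def)
  next
    case False
    then have "merge_word i u = take m u" using i len by (simp add: merge_word_def)
    moreover have "take m u \<in> block_words n"
    proof -
      have "sorted_wrt (\<lambda>A B. A \<inter> B = {}) u \<Longrightarrow> sorted_wrt (\<lambda>A B. A \<inter> B = {}) (take m u)"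
        by (rule sorted_wrt_take)
      then show ?thesis using ub set_take_subset[of m u] unfolding block_words_sorted by blast
    qed
    ultimately show ?thesis using e len by (auto simp: graph_words_def dest: in_set_takeD)
  qed
qed

text \<open>A word that merges to \<open>w\<close> at \<open>i\<close> is determined by its block at
  \<open>i\<close>, so merging and splitting are transposes of each other.\<close>

lemma merge_word_iff:
  assumes u: "u \<in> block_words n" "length u = Suc (length w)" and i: "i \<le> length w"
  shows "w = merge_word i u \<longleftrightarrow> (\<exists>X\<in>split_range n w i. u = split_word w i X)"
proof
  assume w: "w = merge_word i u"
  show "\<exists>X\<in>split_range n w i. u = split_word w i X"
  proof (cases "i < length w")
    case True
    define A Z Y B where "A = take i u" and "Z = u ! i" and "Y = u ! Suc i" and "B = drop (Suc (Suc i)) u"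
    have u_eq: "u = A @ Z # Y # B"
      using id_take_nth_drop[of i u] Cons_nth_drop_Suc[of "Suc i" u] True u(2) by (simp add: A_def Z_def Y_def B_def)
    have "Suc i < length u" using True u(2) by simp
    then have w_eq: "w = A @ (Z \<union> Y) # B" unfolding w by (simp add: merge_word_def A_def Z_def Y_def B_def)
    have iA: "i = length A" using True u(2) by (simp add: A_def)
    have "Z \<inter> Y = {}" using block_wordsD(3)[OF u(1), of i "Suc i"] True u(2) by (simp add: Z_def Y_def)
    then have "Z \<union> Y - Z = Y" by blast
    then show ?thesis
      by (intro bexI[of _ Z]) (simp_all add: split_word_def split_range_def u_eq w_eq iA nth_append)
  next
    case False
    then have iw: "i = length w" using i by simp
    have i_u: "\<not> Suc i < length u" "i < length u" "length u = Suc i" using u(2) iw by simp_all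
    have "w = take i u" unfolding w using i_u(1) by (simp add: merge_word_def)
    then have "u = w @ [u ! i]" using take_Suc_conv_app_nth[OF i_u(2)] i_u(3) by simp
    moreover have "u ! i \<subseteq> ground n" using block_wordsD(2)[OF u(1), of i] u(2) iw by simp
    ultimately show ?thesis
      by (intro bexI[of _ "u ! i"]) (simp_all add: split_word_def split_range_def iw)
  qed
next
  assume "\<exists>X\<in>split_range n w i. u = split_word w i X"
  then obtain X where X: "X \<in> split_range n w i" "u = split_word w i X" by blast
  show "w = merge_word i u"
  proof (cases "i < length w")
    case True
    then have "X \<union> w ! i = w ! i" using X(1) by (auto simp: split_range_def)
    then show ?thesis unfolding X(2) using True id_take_nth_drop[OF True]
      by (simp add: merge_word_def split_word_def nth_append)
  next
    case False
    then show ?thesis unfolding X(2) using i by (simp add: merge_word_def split_word_def)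
  qed
qed

abbreviation edge_words :: "nat \<Rightarrow> signed_graph \<Rightarrow> nat \<Rightarrow> int set list set" where
  "edge_words n G m \<equiv> graph_words n (edge_pairs G) m"

lemma chain_space_eq:
  assumes "edge_pairs G \<noteq> {}"
  shows "chain_space n G (int m - 1) = {f. \<forall>P. f P \<noteq> 0 \<longrightarrow> P \<in> word_face n ` edge_words n G m}"
  unfolding chain_space_def faces_eq[OF assms] ..

lemma linear_extension_words:
  assumes E: "edge_pairs G \<noteq> {}" and f: "f \<in> chain_space n G (int m - 1)"
  shows "linear_extension T f Q = (\<Sum>u\<in>edge_words n G m. f (word_face n u) * T (word_face n u) Q)"
proof -
  have "linear_extension T f Q = (\<Sum>P\<in>word_face n ` edge_words n G m. f P * T P Q)"
    unfolding linear_extension_def using f chain_space_eq[OF E]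
    by (intro sum.mono_neutral_left) auto
  also have "\<dots> = (\<Sum>u\<in>edge_words n G m. f (word_face n u) * T (word_face n u) Q)"
    by (subst sum.reindex) (auto simp: inj_on_def word_face_inj)
  finally show ?thesis .
qed

lemma boundary_words:
  assumes E: "edge_pairs G \<noteq> {}" and f: "f \<in> chain_space n G (int m - 1)"
  shows "boundary f Q = (\<Sum>u\<in>edge_words n G m. f (word_face n u) *
    (\<Sum>i<m. (- 1) ^ i * basis_chain (word_face n (merge_word i u)) Q))"
  unfolding boundary_def linear_extension_words[OF E f]
proof (rule sum.cong[OF refl])
  fix u assume u: "u \<in> edge_words n G m"
  then have ub: "u \<in> block_words n" "length u = m" by (auto simp: graph_words_def)
  have "(\<Sum>i=1..length (word_face n u) - 1. (- 1) ^ (i - 1) * basis_chain (merge_blocks i (word_face n u)) Q)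
      = (\<Sum>i<m. (- 1) ^ i * basis_chain (word_face n (merge_word i u)) Q)"
  proof -
    have "merge_blocks i (word_face n u) = word_face n (merge_word (i - 1) u)" if "1 \<le> i" "i \<le> m" for i
      using merge_blocks_word_face[OF ub(1), of "i - 1"] that ub(2) by simp
    moreover have "length (word_face n u) - 1 = m" using ub by (simp add: word_face_def)
    ultimately show ?thesis
      by (intro sum.reindex_bij_witness[where i = Suc and j = "\<lambda>i. i - 1"]) auto
  qed
  then show "f (word_face n u) * (\<Sum>i=1..length (word_face n u) - 1. (- 1) ^ (i - 1) * basis_chain (merge_blocks i (word_face n u)) Q)
      = f (word_face n u) * (\<Sum>i<m. (- 1) ^ i * basis_chain (word_face n (merge_word i u)) Q)" by simp
qed

lemma boundary_chain_space:
  assumes E: "edge_pairs G \<noteq> {}" and f: "f \<in> chain_space n G (int (Suc m) - 1)"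
  shows "boundary f \<in> chain_space n G (int m - 1)"
  unfolding chain_space_eq[OF E]
proof (intro CollectI allI impI)
  fix Q assume "boundary f Q \<noteq> 0"
  then obtain u where u: "u \<in> edge_words n G (Suc m)"
    "(\<Sum>i<Suc m. (- 1) ^ i * basis_chain (word_face n (merge_word i u)) Q) \<noteq> 0"
    unfolding boundary_words[OF E f] by (auto elim!: sum.not_neutral_contains_not_neutral)
  from sum.not_neutral_contains_not_neutral[OF u(2)]
  obtain i where "i < Suc m" "basis_chain (word_face n (merge_word i u)) Q \<noteq> 0" by auto
  then have "i \<le> m" "Q = word_face n (merge_word i u)" by (auto simp: basis_chain_def split: if_splits)
  then show "Q \<in> word_face n ` edge_words n G m" using merge_word_graph_words[OF u(1)] by blast
qed

text \<open>The coefficient of a face in the boundary collects the words that merge to it, and these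
  are its splittings.\<close>

lemma boundary_word_face:
  assumes E: "edge_pairs G \<noteq> {}" and f: "f \<in> chain_space n G (int m - 1)" and w: "w \<in> block_words n"
  shows "boundary f (word_face n w) = word_boundary n (\<lambda>u. f (word_face n u)) w"
proof -
  let ?g = "\<lambda>u. f (word_face n u)" and ?W = "edge_words n G m"
  have g: "u \<in> ?W" if "?g u \<noteq> 0" for u
    using f that unfolding chain_space_eq[OF E] by (auto simp: word_face_inj)
  have bd: "boundary f (word_face n w) = (\<Sum>i<m. (- 1) ^ i * (\<Sum>u\<in>?W. ?g u * (if w = merge_word i u then 1 else 0)))"
    unfolding boundary_words[OF E f] sum_distrib_left
    by (subst sum.swap) (intro sum.cong refl, simp add: basis_chain_def word_face_inj)
  show ?thesis
  proof (cases "m = Suc (length w)")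
    case False
    have "w \<noteq> merge_word i u" if "u \<in> ?W" "i < m" for u i
      using that False by (auto simp: graph_words_def merge_word_def)
    then have "boundary f (word_face n w) = 0" unfolding bd by simp
    moreover have "?g (split_word w i X) = 0" if "i \<le> length w" for i X
      using g[of "split_word w i X"] that False by (auto simp: graph_words_def)
    then have "word_boundary n ?g w = 0" unfolding word_boundary_eq by simp
    ultimately show ?thesis by simp
  next
    case True
    have "(\<Sum>u\<in>?W. ?g u * (if w = merge_word i u then 1 else 0)) = (\<Sum>X\<in>split_range n w i. ?g (split_word w i X))"
      if i: "i \<le> length w" for i
    proof -
      \<comment> \<open>The block at \<open>i\<close> recovers \<open>X\<close>, so different
        choices of \<open>X\<close> give different words.\<close>
      have nth: "split_word w i X ! i = X" for X using i by (simp add: split_word_def nth_append)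
      have fin: "finite (split_range n w i)"
        using block_wordsD(2)[OF w, of i] finite_subset[OF _ finite_ground[of n]] by (simp add: split_range_def)
      have "(\<Sum>u\<in>?W. ?g u * (if w = merge_word i u then 1 else 0))
          = (\<Sum>u\<in>?W. if u \<in> split_word w i ` split_range n w i then ?g u else 0)"
      proof (rule sum.cong[OF refl])
        fix u assume "u \<in> ?W"
        then have "u \<in> block_words n" "length u = Suc (length w)" using True by (auto simp: graph_words_def)
        from merge_word_iff[OF this i]
        show "?g u * (if w = merge_word i u then 1 else 0) = (if u \<in> split_word w i ` split_range n w i then ?g u else 0)"
          by auto
      qed
      also have "\<dots> = (\<Sum>u\<in>split_word w i ` split_range n w i. ?g u)"
        unfolding sum.inter_restrict[OF finite_graph_words, symmetric]
        by (rule sum.mono_neutral_left) (use fin g in auto)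
      also have "\<dots> = (\<Sum>X\<in>split_range n w i. ?g (split_word w i X))"
        by (rule sum.reindex_cong[of "split_word w i"]) (auto intro!: inj_onI dest: arg_cong[of _ _ "\<lambda>u. u ! i"] simp: nth)
      finally show ?thesis .
    qed
    then show ?thesis unfolding bd word_boundary_eq True lessThan_Suc_atMost by simp
  qed
qed

definition perm_word :: "int set list \<Rightarrow> (int \<Rightarrow> int) \<Rightarrow> int set list" where
  "perm_word w \<pi> = map (signed_block w) (pword (length w) \<pi>)"

text \<open>The group permutes the signed blocks, which stay disjoint, and \<open>collapses\<close>
  holds for a set exactly when it holds for its negative.\<close>

lemma perm_word_graph_words:
  assumes u: "u \<in> graph_words n E m" and \<pi>: "\<pi> \<in> hyperoctahedral m"
  shows "perm_word u \<pi> \<in> graph_words n E m"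
proof -
  have ub: "u \<in> block_words n" and len: "length u = m" using u by (auto simp: graph_words_def)
  obtain e where e: "e \<in> E" "\<And>B. B \<in> set u \<Longrightarrow> collapses e B" using u by (auto simp: graph_words_def)
  have rng: "1 \<le> \<bar>\<pi> k\<bar> \<and> \<bar>\<pi> k\<bar> \<le> int (length u)" if "1 \<le> \<bar>k\<bar> \<and> \<bar>k\<bar> \<le> int m" for k
    using that hyperoctahedral_mem[OF \<pi>, of k] hyperoctahedral_eq_0[OF \<pi>, of k] len by auto
  have lp: "length (perm_word u \<pi>) = m" by (simp add: perm_word_def len)
  have sb: "signed_block (perm_word u \<pi>) k = signed_block u (\<pi> k)" if "1 \<le> \<bar>k\<bar> \<and> \<bar>k\<bar> \<le> int m" for k
    using that signed_block_pword[OF \<pi>, of k u] len by (simp add: perm_word_def)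
  have "perm_word u \<pi> \<in> block_words n"
    unfolding block_words_def
  proof (intro CollectI conjI allI impI)
    fix k assume "1 \<le> \<bar>k\<bar> \<and> \<bar>k\<bar> \<le> int (length (perm_word u \<pi>))"
    then have k: "1 \<le> \<bar>k\<bar> \<and> \<bar>k\<bar> \<le> int m" using lp by simp
    show "signed_block (perm_word u \<pi>) k \<noteq> {}" "signed_block (perm_word u \<pi>) k \<subseteq> ground n"
      using block_words_signed(1,2)[OF ub, of "\<pi> k"] rng[OF k] sb[OF k] by simp_all
  next
    fix k l assume "1 \<le> \<bar>k\<bar> \<and> \<bar>k\<bar> \<le> int (length (perm_word u \<pi>)) \<and>
      1 \<le> \<bar>l\<bar> \<and> \<bar>l\<bar> \<le> int (length (perm_word u \<pi>)) \<and> k \<noteq> l"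
    then have kl: "1 \<le> \<bar>k\<bar> \<and> \<bar>k\<bar> \<le> int m \<and> 1 \<le> \<bar>l\<bar> \<and> \<bar>l\<bar> \<le> int m \<and> k \<noteq> l" using lp by simp
    then have "\<pi> k \<noteq> \<pi> l" using permutes_inj[OF hyperoctahedral_permutes[OF \<pi>]] by (auto dest: injD)
    then show "signed_block (perm_word u \<pi>) k \<inter> signed_block (perm_word u \<pi>) l = {}"
      using block_words_signed(3)[OF ub, of "\<pi> k" "\<pi> l"] rng[of k] rng[of l] sb[of k] sb[of l] kl by simp
  qed
  moreover have "collapses e B" if "B \<in> set (perm_word u \<pi>)" for B
  proof -
    obtain k where k: "1 \<le> k" "k \<le> int m" "B = signed_block u (\<pi> k)" using \<open>B \<in> set (perm_word u \<pi>)\<close> len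
      by (auto simp: perm_word_def)
    have "nat \<bar>\<pi> k\<bar> - 1 < length u" using rng[of k] k by linarith
    then have "collapses e (u ! (nat \<bar>\<pi> k\<bar> - 1))" using e(2) by simp
    then show ?thesis unfolding k(3) signed_block_def collapses_def by (auto simp: neg_set_iff)
  qed
  ultimately show ?thesis using e(1) lp by (auto simp: graph_words_def)
qed

lemma map_signed_block_upto: "map (signed_block u) [1..int (length u)] = u"
  by (rule nth_equalityI) (auto simp: signed_block_def nat_add_distrib)

text \<open>Reading words along permutations is a right action, whence the inverse in
  \<open>act_partition\<close>.\<close>

lemma perm_word_comp:
  assumes "length u = m" "\<pi> \<in> hyperoctahedral m" "\<rho> \<in> hyperoctahedral m"
  shows "perm_word (perm_word u \<pi>) \<rho> = perm_word u (\<pi> \<circ> \<rho>)"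
proof -
  have "signed_block (map (signed_block u) (pword m \<pi>)) (\<rho> k) = signed_block u (\<pi> (\<rho> k))"
    if "1 \<le> k" "k \<le> int m" for k
    using that hyperoctahedral_mem[OF assms(3), of k] hyperoctahedral_eq_0[OF assms(3), of k]
    by (intro signed_block_pword[OF assms(2)]) auto
  then show ?thesis using assms(1) by (simp add: perm_word_def)
qed

lemma perm_word_inv_iff:
  assumes "length w = m" "length u = m" "\<pi> \<in> hyperoctahedral m"
  shows "w = perm_word u (inv \<pi>) \<longleftrightarrow> u = perm_word w \<pi>"
proof -
  have inv: "inv \<pi> \<in> hyperoctahedral m" using assms(3) by (rule inv_hyperoctahedral)
  have "\<pi> \<circ> inv \<pi> = id" "inv \<pi> \<circ> \<pi> = id" using permutes_inv_o[OF hyperoctahedral_permutes[OF assms(3)]] by auto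
  then have "perm_word (perm_word w \<pi>) (inv \<pi>) = w" "perm_word (perm_word u (inv \<pi>)) \<pi> = u"
    using perm_word_comp[OF assms(1,3) inv] perm_word_comp[OF assms(2) inv assms(3)] assms(1,2) map_signed_block_upto[of w]
      map_signed_block_upto[of u]
    by (simp_all add: perm_word_def[of _ id])
  then show ?thesis by metis
qed

lemma act_partition_word_face:
  assumes u: "length u = m" and \<pi>: "\<pi> \<in> hyperoctahedral m"
  shows "act_partition n \<pi> (word_face n u) = word_face n (perm_word u (inv \<pi>))"
proof -
  have inv: "inv \<pi> \<in> hyperoctahedral m" using \<pi> by (rule inv_hyperoctahedral)
  have "signed_block (word_face n u) (inv \<pi> k) = signed_block u (inv \<pi> k)" if "1 \<le> k" "k \<le> int m" for k
  proof -
    have "1 \<le> \<bar>inv \<pi> k\<bar>" "\<bar>inv \<pi> k\<bar> \<le> int m"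
      using that hyperoctahedral_mem[OF inv, of k] hyperoctahedral_eq_0[OF inv, of k] by auto
    then have "nat \<bar>inv \<pi> k\<bar> - 1 < length u" using u by linarith
    then show ?thesis by (auto simp: signed_block_def word_face_def nth_append)
  qed
  then have "map (\<lambda>k. signed_block (word_face n u) (inv \<pi> k)) [1..int m] = perm_word u (inv \<pi>)"
    by (simp add: perm_word_def u)
  then show ?thesis by (simp add: act_partition_def word_face_def u Let_def)
qed

lemma eulerian_action_words:
  assumes E: "edge_pairs G \<noteq> {}" and f: "f \<in> chain_space n G (int m - 1)"
  shows "eulerian_action n m j f Q = (\<Sum>\<pi>\<in>hyperoctahedral m. eulerian_coeff m j \<pi> *
    (\<Sum>u\<in>edge_words n G m. f (word_face n u) * basis_chain (word_face n (perm_word u (inv \<pi>))) Q))"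
  unfolding eulerian_action_def linear_extension_words[OF E f]
  by (intro sum.cong refl arg_cong2[of _ _ _ _ "(*)"])
    (simp add: act_partition_word_face graph_words_def)

lemma eulerian_action_chain_space:
  assumes E: "edge_pairs G \<noteq> {}" and f: "f \<in> chain_space n G (int m - 1)"
  shows "eulerian_action n m j f \<in> chain_space n G (int m - 1)"
  unfolding chain_space_eq[OF E]
proof (intro CollectI allI impI)
  fix Q assume "eulerian_action n m j f Q \<noteq> 0"
  then obtain \<pi> where \<pi>: "\<pi> \<in> hyperoctahedral m"
    "(\<Sum>u\<in>edge_words n G m. f (word_face n u) * basis_chain (word_face n (perm_word u (inv \<pi>))) Q) \<noteq> 0"
    unfolding eulerian_action_words[OF E f] by (auto elim!: sum.not_neutral_contains_not_neutral)
  then obtain u where "u \<in> edge_words n G m" "basis_chain (word_face n (perm_word u (inv \<pi>))) Q \<noteq> 0"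
    by (auto elim!: sum.not_neutral_contains_not_neutral)
  then show "Q \<in> word_face n ` edge_words n G m"
    using perm_word_graph_words[OF _ inv_hyperoctahedral[OF \<pi>(1)]] by (auto simp: basis_chain_def split: if_splits)
qed

text \<open>The only word that \<open>\<pi>\<close> carries to \<open>w\<close> is \<open>w\<close>
  read along \<open>\<pi>\<close>, so on coefficients the inverse disappears.\<close>

lemma eulerian_action_word_face:
  assumes E: "edge_pairs G \<noteq> {}" and f: "f \<in> chain_space n G (int m - 1)" and w: "length w = m"
  shows "eulerian_action n m j f (word_face n w) = euler_op j (\<lambda>u. f (word_face n u)) w"
  unfolding eulerian_action_words[OF E f] euler_op_def w
proof (intro sum.cong refl arg_cong2[of _ _ _ _ "(*)"])
  fix \<pi> assume \<pi>: "\<pi> \<in> hyperoctahedral m"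
  let ?W = "edge_words n G m" and ?u = "perm_word w \<pi>"
  have "(\<Sum>u\<in>?W. f (word_face n u) * basis_chain (word_face n (perm_word u (inv \<pi>))) (word_face n w))
      = (\<Sum>u\<in>?W. if u = ?u then f (word_face n u) else 0)"
    by (intro sum.cong refl)
      (use perm_word_inv_iff[OF w _ \<pi>] in \<open>auto simp: basis_chain_def word_face_inj graph_words_def\<close>)
  \<comment> \<open>If the permuted word is not a word of the complex, both sides are 0, as
    \<open>f\<close> is supported on faces.\<close>
  also have "\<dots> = f (word_face n ?u)"
    using f unfolding chain_space_eq[OF E] by (auto simp: word_face_inj)
  finally show "(\<Sum>u\<in>?W. f (word_face n u) * basis_chain (word_face n (perm_word u (inv \<pi>))) (word_face n w))
      = f (word_face n (map (signed_block w) (pword m \<pi>)))" by (simp add: perm_word_def w)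
qed

section \<open>Dimensions\<close>

lemma fun_sum_apply: "(\<Sum>x\<in>A. g x) P = (\<Sum>x\<in>A. (g x P :: complex))"
  by (induction A rule: infinite_finite_induct) auto

text \<open>Linearity is assumed on \<open>V\<close> only, because \<open>linear_extension\<close>
  is not additive on functions of infinite support. Representatives of a basis modulo the kernel are
  mapped to a basis of the image.\<close>

lemma chain_rank_nullity:
  assumes V: "chain.subspace V" and F: "finite F" "V \<subseteq> chain.span F"
    and add: "\<And>f g. f \<in> V \<Longrightarrow> g \<in> V \<Longrightarrow> T (f + g) = T f + T g"
    and scale: "\<And>c f. f \<in> V \<Longrightarrow> T (chain_scale c f) = chain_scale c (T f)"
  shows "chain.dim {f \<in> V. T f = 0} + chain.dim (T ` V) = chain.dim V"
proof -
  define W where "W = {f \<in> V. T f = 0}"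
  have T0: "T 0 = 0" using scale[of 0 0] chain.subspace_0[OF V] by simp
  have W: "chain.subspace W" "W \<subseteq> V"
    unfolding W_def using V add scale T0
    by (auto intro!: chain.subspaceI intro: chain.subspace_0 chain.subspace_add chain.subspace_scale)
  obtain S where S: "chain.quotient_basis V W S" using chain.quotient_basis_exists[OF V W F] by blast
  have card: "card S + chain.dim W = chain.dim V" by (rule chain.quotient_basis_card[OF V W F S])
  have finS: "finite S" and SV: "S \<subseteq> V"
    and ex: "\<And>v. v \<in> V \<Longrightarrow> \<exists>!a. a \<in> extensional S \<and> v - (\<Sum>s\<in>S. chain_scale (a s) s) \<in> W"
    using S unfolding chain.quotient_basis_def by auto
  have sumV: "(\<Sum>s\<in>A. chain_scale (b s) s) \<in> V" if "A \<subseteq> S" for A b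
    using that SV by (intro chain.subspace_sum[OF V] chain.subspace_scale[OF V]) auto
  have Tsum: "T (\<Sum>s\<in>A. chain_scale (b s) s) = (\<Sum>s\<in>A. chain_scale (b s) (T s))" if "A \<subseteq> S" for A b
  proof -
    have "finite A" using that finS finite_subset by blast
    then show ?thesis using that
    proof (induction A rule: finite_induct)
      case (insert x A)
      have "T (chain_scale (b x) x + (\<Sum>s\<in>A. chain_scale (b s) s)) = T (chain_scale (b x) x) + T (\<Sum>s\<in>A. chain_scale (b s) s)"
        using insert.prems SV by (intro add sumV chain.subspace_scale[OF V]) auto
      moreover have "T (chain_scale (b x) x) = chain_scale (b x) (T x)" using insert.prems SV by (intro scale) auto
      moreover have "T (\<Sum>s\<in>A. chain_scale (b s) s) = (\<Sum>s\<in>A. chain_scale (b s) (T s))"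
        using insert by blast
      ultimately show ?case unfolding sum.insert[OF insert.hyps(1,2)] by (simp only:)
    qed (simp add: T0)
  qed
  have zero: "b s = 0" if b: "(\<Sum>s\<in>S. chain_scale (b s) (T s)) = 0" and s: "s \<in> S" for b s
  proof -
    have "(\<Sum>s\<in>S. chain_scale (b s) s) \<in> W"
      using b Tsum[of S b] sumV[of S b] by (simp add: W_def)
    then have "restrict b S \<in> extensional S \<and> 0 - (\<Sum>s\<in>S. chain_scale (restrict b S s) s) \<in> W"
      using chain.subspace_neg[OF W(1)] by (simp cong: sum.cong)
    moreover have "restrict (\<lambda>_. 0) S \<in> extensional S \<and> 0 - (\<Sum>s\<in>S. chain_scale (restrict (\<lambda>_. 0) S s) s) \<in> W"
      using chain.subspace_0[OF W(1)] by (simp cong: sum.cong)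
    ultimately have "restrict b S = restrict (\<lambda>_. 0) S"
      using ex[OF chain.subspace_0[OF V]] by blast
    then have "restrict b S s = restrict (\<lambda>_. 0) S s" by simp
    then show ?thesis using s by simp
  qed
  have inj: "inj_on T S"
  proof (rule inj_onI, rule ccontr)
    fix x y assume xy: "x \<in> S" "y \<in> S" "T x = T y" "x \<noteq> y"
    define b :: "chain \<Rightarrow> complex" where "b s = (if s = x then 1 else if s = y then - 1 else 0)" for s
    have "(\<Sum>s\<in>S. chain_scale (b s) (T s)) = (\<Sum>s\<in>{x, y}. chain_scale (b s) (T s))"
      using finS xy by (intro sum.mono_neutral_right) (auto simp: b_def)
    also have "\<dots> = 0" using xy by (auto simp: b_def)
    finally have "b x = 0" using zero xy(1) by blast
    then show False by (simp add: b_def)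
  qed
  have ind: "chain.independent (T ` S)"
  proof (rule chain.independent_if_scalars_zero)
    fix f x assume f: "(\<Sum>x\<in>T ` S. chain_scale (f x) x) = 0" and "x \<in> T ` S"
    then obtain s where s: "s \<in> S" "x = T s" by blast
    have "(\<Sum>s\<in>S. chain_scale (f (T s)) (T s)) = 0" using f by (simp add: sum.reindex[OF inj])
    then show "f x = 0" using zero[of "\<lambda>s. f (T s)"] s by blast
  qed (use finS in simp)
  have span: "T ` V \<subseteq> chain.span (T ` S)"
  proof clarify
    fix v assume v: "v \<in> V"
    then obtain a where a: "v - (\<Sum>s\<in>S. chain_scale (a s) s) \<in> W" using ex by blast
    have "T v = T ((v - (\<Sum>s\<in>S. chain_scale (a s) s)) + (\<Sum>s\<in>S. chain_scale (a s) s))" by simp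
    also have "\<dots> = T (v - (\<Sum>s\<in>S. chain_scale (a s) s)) + T (\<Sum>s\<in>S. chain_scale (a s) s)"
      using a sumV[of S a] by (intro add) (auto simp: W_def)
    also have "\<dots> = (\<Sum>s\<in>S. chain_scale (a s) (T s))" using a Tsum[of S a] by (simp add: W_def)
    also have "\<dots> \<in> chain.span (T ` S)" by (intro chain.span_sum chain.span_scale chain.span_base) auto
    finally show "T v \<in> chain.span (T ` S)" .
  qed
  have "chain.dim (T ` V) = card (T ` S)"
    using chain.basis_card_eq_dim[OF image_mono[OF SV] span ind] by simp
  then show ?thesis using card card_image[OF inj] by (simp add: W_def)
qed

section \<open>Finitely supported chains and the trace of a projection\<close>

definition supported :: "int set list set \<Rightarrow> chain set" where
  "supported X = {f. \<forall>P. f P \<noteq> 0 \<longrightarrow> P \<in> X}"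

lemma supported_subspace: "chain.subspace (supported X)"
  by (rule chain.subspaceI) (auto simp: supported_def chain_scale_def, metis add.right_neutral)

lemma supported_expand:
  assumes "finite X" "f \<in> supported X"
  shows "f = (\<Sum>x\<in>X. chain_scale (f x) (basis_chain x))"
proof
  fix P
  have "(\<Sum>x\<in>X. chain_scale (f x) (basis_chain x)) P = (\<Sum>x\<in>X. if P = x then f x else 0)"
    unfolding fun_sum_apply by (rule sum.cong) (auto simp: chain_scale_def basis_chain_def)
  also have "\<dots> = f P" using assms by (auto simp: supported_def)
  finally show "f P = (\<Sum>x\<in>X. chain_scale (f x) (basis_chain x)) P" by simp
qed

lemma basis_chain_supported: "x \<in> X \<Longrightarrow> basis_chain x \<in> supported X"
  by (simp add: supported_def basis_chain_def)

lemma supported_span: "finite X \<Longrightarrow> supported X \<subseteq> chain.span (basis_chain ` X)"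
proof
  fix f assume "finite X" "f \<in> supported X"
  then have "f = (\<Sum>x\<in>X. chain_scale (f x) (basis_chain x))" by (rule supported_expand)
  also have "\<dots> \<in> chain.span (basis_chain ` X)"
    by (intro chain.span_sum chain.span_scale chain.span_base) auto
  finally show "f \<in> chain.span (basis_chain ` X)" .
qed

lemma subspace_image:
  assumes V: "chain.subspace V"
    and add: "\<And>f g. f \<in> V \<Longrightarrow> g \<in> V \<Longrightarrow> T (f + g) = T f + T g"
    and scale: "\<And>c f. f \<in> V \<Longrightarrow> T (chain_scale c f) = chain_scale c (T f)"
  shows "chain.subspace (T ` V)"
proof (rule chain.subspaceI)
  have "T 0 = 0" using scale[of 0 0] chain.subspace_0[OF V] by simp
  then show "0 \<in> T ` V" using chain.subspace_0[OF V] by (metis imageI)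
  show "x + y \<in> T ` V" if xy: "x \<in> T ` V" "y \<in> T ` V" for x y
  proof -
    obtain f g where "f \<in> V" "g \<in> V" "x = T f" "y = T g" using xy by blast
    then show ?thesis using add chain.subspace_add[OF V] by (metis imageI)
  qed
  show "chain_scale c x \<in> T ` V" if x: "x \<in> T ` V" for c x
  proof -
    obtain f where "f \<in> V" "x = T f" using x by blast
    then show ?thesis using scale chain.subspace_scale[OF V] by (metis imageI)
  qed
qed

text \<open>The rank of a projection is its trace. The images of the standard basis are expanded in
  a basis \<open>B\<close> of the image; after exchanging the sums each \<open>b\<close> contributes
  its own coordinate, since \<open>T b = b\<close>.\<close>

lemma dim_idempotent_image:
  assumes X: "finite X" and map: "\<And>f. f \<in> supported X \<Longrightarrow> T f \<in> supported X"
    and add: "\<And>f g. f \<in> supported X \<Longrightarrow> g \<in> supported X \<Longrightarrow> T (f + g) = T f + T g"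
    and scale: "\<And>c f. f \<in> supported X \<Longrightarrow> T (chain_scale c f) = chain_scale c (T f)"
    and idem: "\<And>f. f \<in> supported X \<Longrightarrow> T (T f) = T f"
  shows "of_nat (chain.dim (T ` supported X)) = (\<Sum>x\<in>X. T (basis_chain x) x)"
proof -
  let ?V = "supported X"
  note V = supported_subspace[of X]
  obtain B where B: "B \<subseteq> T ` ?V" "chain.independent B" "T ` ?V \<subseteq> chain.span B" "card B = chain.dim (T ` ?V)"
    by (rule chain.basis_exists)
  have BV: "B \<subseteq> ?V" using B(1) map by blast
  have finB: "finite B"
    using chain.independent_span_bound[of "basis_chain ` X", OF _ B(2)] BV supported_span[OF X] X by auto
  have fix_B: "T b = b" if "b \<in> B" for b using that B(1) idem by auto
  have Tsum: "T (\<Sum>x\<in>A. chain_scale (c x) (basis_chain x)) = (\<Sum>x\<in>A. chain_scale (c x) (T (basis_chain x)))"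
    if "A \<subseteq> X" for A c
  proof -
    have "finite A" using that X finite_subset by blast
    then show ?thesis using that
    proof (induction A rule: finite_induct)
      case empty
      have "T 0 = 0" using scale[of 0 0] chain.subspace_0[OF V] by simp
      then show ?case unfolding sum.empty .
    next
      case (insert x A)
      have b: "basis_chain x \<in> ?V" using insert.prems by (intro basis_chain_supported) auto
      have "(\<Sum>x\<in>A. chain_scale (c x) (basis_chain x)) \<in> ?V"
        using insert.prems by (intro chain.subspace_sum[OF V] chain.subspace_scale[OF V] basis_chain_supported) auto
      then have "T (chain_scale (c x) (basis_chain x) + (\<Sum>x\<in>A. chain_scale (c x) (basis_chain x)))
          = T (chain_scale (c x) (basis_chain x)) + T (\<Sum>x\<in>A. chain_scale (c x) (basis_chain x))"
        using b by (intro add chain.subspace_scale[OF V])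
      moreover have "T (\<Sum>x\<in>A. chain_scale (c x) (basis_chain x)) = (\<Sum>x\<in>A. chain_scale (c x) (T (basis_chain x)))"
        using insert by blast
      ultimately show ?case unfolding sum.insert[OF insert.hyps(1,2)] by (simp only: scale[OF b])
    qed
  qed
  have Tspan: "T (basis_chain x) \<in> chain.span B" if "x \<in> X" for x
    using that B(3) basis_chain_supported by blast
  let ?r = "chain.representation B"
  have "(\<Sum>x\<in>X. T (basis_chain x) x) = (\<Sum>x\<in>X. \<Sum>b\<in>B. ?r (T (basis_chain x)) b * b x)"
  proof (rule sum.cong[OF refl])
    fix x assume "x \<in> X"
    then have "(\<Sum>b\<in>B. chain_scale (?r (T (basis_chain x)) b) b) = T (basis_chain x)"
      using chain.sum_representation_eq[OF B(2) Tspan finB] by simp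
    then have "T (basis_chain x) x = (\<Sum>b\<in>B. chain_scale (?r (T (basis_chain x)) b) b) x" by simp
    then show "T (basis_chain x) x = (\<Sum>b\<in>B. ?r (T (basis_chain x)) b * b x)"
      unfolding fun_sum_apply by (simp add: chain_scale_def)
  qed
  also have "\<dots> = (\<Sum>b\<in>B. \<Sum>x\<in>X. ?r (T (basis_chain x)) b * b x)" by (rule sum.swap)
  also have "\<dots> = (\<Sum>b\<in>B. 1)"
  proof (rule sum.cong[OF refl])
    fix b assume b: "b \<in> B"
    have "b = T (\<Sum>x\<in>X. chain_scale (b x) (basis_chain x))"
      using supported_expand[OF X, of b] b BV fix_B[OF b] by auto
    also have "\<dots> = (\<Sum>x\<in>X. chain_scale (b x) (T (basis_chain x)))" by (rule Tsum) simp
    finally have b_eq: "(\<Sum>x\<in>X. chain_scale (b x) (T (basis_chain x))) = b" by simp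
    have "1 = ?r b b" using chain.representation_basis[OF B(2) b] by simp
    also have "\<dots> = ?r (\<Sum>x\<in>X. chain_scale (b x) (T (basis_chain x))) b" unfolding b_eq ..
    also have "\<dots> = (\<Sum>x\<in>X. ?r (chain_scale (b x) (T (basis_chain x))) b)"
      using Tspan by (subst chain.representation_sum[OF B(2)]) (auto intro: chain.span_scale)
    also have "\<dots> = (\<Sum>x\<in>X. ?r (T (basis_chain x)) b * b x)"
      by (intro sum.cong refl) (simp add: chain.representation_scale[OF B(2) Tspan])
    finally show "(\<Sum>x\<in>X. ?r (T (basis_chain x)) b * b x) = 1" by simp
  qed
  finally show ?thesis using B(4) by simp
qed

section \<open>The Eulerian subcomplexes\<close>

text \<open>Indexed by the number \<open>m\<close> of blocks of the word instead of the degree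
  \<open>m - 1\<close>, so that the empty face has index 0.\<close>

definition graph_chains :: "nat \<Rightarrow> signed_graph \<Rightarrow> nat \<Rightarrow> chain set" where
  "graph_chains n G m = chain_space n G (int m - 1)"

definition eulerian_space :: "nat \<Rightarrow> signed_graph \<Rightarrow> nat \<Rightarrow> nat \<Rightarrow> chain set" where
  "eulerian_space n G m j = eulerian_action n m j ` graph_chains n G m"

definition eulerian_kernel :: "nat \<Rightarrow> signed_graph \<Rightarrow> nat \<Rightarrow> nat \<Rightarrow> chain set" where
  "eulerian_kernel n G m j = {f \<in> eulerian_space n G m j. boundary f = 0}"

context
  fixes n :: nat and G :: signed_graph
  assumes graph: "signed_graph_on n G" and edges: "edge_multiset G \<noteq> {#}"
begin

abbreviation "faces_of m \<equiv> word_face n ` edge_words n G m"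
abbreviation "gchains \<equiv> graph_chains n G"
abbreviation "eulerian \<equiv> eulerian_space n G"
abbreviation "eulerian_cycle \<equiv> eulerian_kernel n G"

lemma edge_pairs_ne: "edge_pairs G \<noteq> {}"
  using edge_pairs_nonempty[OF graph edges] .

lemma chains_supported: "gchains m = supported (faces_of m)"
  unfolding supported_def graph_chains_def by (rule chain_space_eq[OF edge_pairs_ne])

lemmas boundary_gchains_words = boundary_words[OF edge_pairs_ne, folded graph_chains_def]
lemmas boundary_gchains_word_face = boundary_word_face[OF edge_pairs_ne, folded graph_chains_def]
lemmas eulerian_action_gchains_words = eulerian_action_words[OF edge_pairs_ne, folded graph_chains_def]
lemmas eulerian_action_gchains_word_face = eulerian_action_word_face[OF edge_pairs_ne, folded graph_chains_def]
lemmas boundary_chains = boundary_chain_space[OF edge_pairs_ne, folded graph_chains_def]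
lemmas eulerian_action_chains = eulerian_action_chain_space[OF edge_pairs_ne, folded graph_chains_def]

lemma chains_subspace: "chain.subspace (gchains m)"
  unfolding chains_supported by (rule supported_subspace)

lemma chains_eqI:
  assumes "f \<in> gchains m" "g \<in> gchains m" "\<And>w. w \<in> edge_words n G m \<Longrightarrow> f (word_face n w) = g (word_face n w)"
  shows "f = g"
proof
  fix P
  show "f P = g P"
  proof (cases "P \<in> faces_of m")
    case False
    then have "f P = 0" "g P = 0" using assms(1,2) unfolding chains_supported supported_def by blast+
    then show ?thesis by simp
  qed (use assms(3) in auto)
qed

lemma boundary_add: "f \<in> gchains m \<Longrightarrow> g \<in> gchains m \<Longrightarrow> boundary (f + g) = boundary f + boundary g"
  using chain.subspace_add[OF chains_subspace, of f m g]
  by (intro ext) (simp add: boundary_gchains_words[where m = m] sum.distrib algebra_simps)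

lemma boundary_scale: "f \<in> gchains m \<Longrightarrow> boundary (chain_scale c f) = chain_scale c (boundary f)"
  using chain.subspace_scale[OF chains_subspace, of f m c]
  by (intro ext) (simp add: boundary_gchains_words[where m = m] sum_distrib_left chain_scale_def algebra_simps)

lemma eulerian_action_add:
  "f \<in> gchains m \<Longrightarrow> g \<in> gchains m \<Longrightarrow> eulerian_action n m j (f + g) = eulerian_action n m j f + eulerian_action n m j g"
  using chain.subspace_add[OF chains_subspace, of f m g]
  by (intro ext) (simp add: eulerian_action_gchains_words[where m = m] sum.distrib algebra_simps)

lemma eulerian_action_scale:
  "f \<in> gchains m \<Longrightarrow> eulerian_action n m j (chain_scale c f) = chain_scale c (eulerian_action n m j f)"
  using chain.subspace_scale[OF chains_subspace, of f m c]
  by (intro ext) (simp add: eulerian_action_gchains_words[where m = m] sum_distrib_left chain_scale_def algebra_simps)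

lemma boundary_chains_0: "f \<in> gchains 0 \<Longrightarrow> boundary f = 0"
  by (intro ext) (simp add: boundary_gchains_words[where m = 0])

lemma boundary_boundary:
  assumes f: "f \<in> gchains (Suc (Suc m))" shows "boundary (boundary f) = 0"
proof (rule chains_eqI[of _ m])
  show "boundary (boundary f) \<in> gchains m" using f boundary_chains by blast
  show "0 \<in> gchains m" using chain.subspace_0[OF chains_subspace] .
  fix w assume "w \<in> edge_words n G m"
  then have w: "w \<in> block_words n" by (simp add: graph_words_def)
  let ?g = "\<lambda>u. f (word_face n u)"
  have "(\<lambda>u. boundary f (word_face n u)) = (\<lambda>u. if u \<in> block_words n then word_boundary n ?g u else 0)"
  proof
    fix u
    show "boundary f (word_face n u) = (if u \<in> block_words n then word_boundary n ?g u else 0)"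
      using boundary_gchains_word_face[OF f, of u] boundary_chains[OF f]
      by (auto simp: chains_supported supported_def word_face_inj graph_words_def)
  qed
  then have "boundary (boundary f) (word_face n w)
      = word_boundary n (\<lambda>u. if u \<in> block_words n then word_boundary n ?g u else 0) w"
    using boundary_gchains_word_face[OF boundary_chains[OF f] w] by simp
  also have "\<dots> = 0"
    by (rule word_boundary_twice[OF _ w, of _ "Suc (Suc m)"])
      (use f in \<open>auto simp: chains_supported supported_def word_face_inj graph_words_def\<close>)
  finally show "boundary (boundary f) (word_face n w) = 0 (word_face n w)" by simp
qed

lemma eulerian_action_idempotent:
  assumes f: "f \<in> gchains m"
  shows "eulerian_action n m j (eulerian_action n m j f) = eulerian_action n m j f"
proof (rule chains_eqI[of _ m])
  show "eulerian_action n m j (eulerian_action n m j f) \<in> gchains m" "eulerian_action n m j f \<in> gchains m"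
    using f eulerian_action_chains by blast+
  fix w assume "w \<in> edge_words n G m"
  then have w: "length w = m" by (simp add: graph_words_def)
  have "eulerian_action n m j (eulerian_action n m j f) (word_face n w)
      = euler_op j (\<lambda>u. eulerian_action n m j f (word_face n u)) w"
    using eulerian_action_gchains_word_face[OF eulerian_action_chains[OF f] w] .
  also have "\<dots> = euler_op j (euler_op j (\<lambda>u. f (word_face n u))) w"
    by (rule euler_op_cong) (simp add: eulerian_action_gchains_word_face[OF f] w)
  also have "\<dots> = eulerian_action n m j f (word_face n w)"
    by (simp add: euler_op_orthogonal eulerian_action_gchains_word_face[OF f w])
  finally show "eulerian_action n m j (eulerian_action n m j f) (word_face n w) = eulerian_action n m j f (word_face n w)" .
qed

lemma boundary_eulerian_action:
  assumes f: "f \<in> gchains (Suc m)"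
  shows "boundary (eulerian_action n (Suc m) j f) = eulerian_action n m j (boundary f)"
proof (rule chains_eqI[of _ m])
  show "boundary (eulerian_action n (Suc m) j f) \<in> gchains m" "eulerian_action n m j (boundary f) \<in> gchains m"
    using f eulerian_action_chains boundary_chains by blast+
  fix w assume w: "w \<in> edge_words n G m"
  then have wb: "w \<in> block_words n" "length w = m" by (simp_all add: graph_words_def)
  let ?g = "\<lambda>u. f (word_face n u)"
  have "boundary (eulerian_action n (Suc m) j f) (word_face n w)
      = word_boundary n (\<lambda>u. eulerian_action n (Suc m) j f (word_face n u)) w"
    using boundary_gchains_word_face[OF eulerian_action_chains[OF f] wb(1)] .
  also have "\<dots> = word_boundary n (euler_op j ?g) w"
    by (rule word_boundary_cong) (simp add: eulerian_action_gchains_word_face[OF f] wb(2))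
  also have "\<dots> = euler_op j (word_boundary n ?g) w" by (rule word_boundary_euler_op)
  also have "\<dots> = euler_op j (\<lambda>u. boundary f (word_face n u)) w"
    \<comment> \<open>The boundary is identified with \<open>word_boundary\<close> on block words,
      and a permuted block word is again one.\<close>
    unfolding euler_op_def
  proof (intro sum.cong refl arg_cong2[of _ _ _ _ "(*)"])
    fix \<pi> assume "\<pi> \<in> hyperoctahedral (length w)"
    then have "perm_word w \<pi> \<in> block_words n"
      using perm_word_graph_words[OF w, of \<pi>] wb(2) by (simp add: graph_words_def)
    then show "word_boundary n ?g (map (signed_block w) (pword (length w) \<pi>))
        = boundary f (word_face n (map (signed_block w) (pword (length w) \<pi>)))"
      using boundary_gchains_word_face[OF f] by (simp add: perm_word_def)
  qed
  also have "\<dots> = eulerian_action n m j (boundary f) (word_face n w)"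
    using eulerian_action_gchains_word_face[OF boundary_chains[OF f] wb(2)] by simp
  finally show "boundary (eulerian_action n (Suc m) j f) (word_face n w) = eulerian_action n m j (boundary f) (word_face n w)" .
qed

lemma chains_exact:
  assumes f: "f \<in> gchains m" and cyc: "boundary f = 0" and m: "Suc m < n"
  shows "\<exists>g\<in>gchains (Suc m). boundary g = f"
proof -
  let ?g = "\<lambda>u. f (word_face n u)"
  have "\<exists>h. (\<forall>w. h w \<noteq> 0 \<longrightarrow> w \<in> edge_words n G (Suc m)) \<and> (\<forall>w\<in>block_words n. word_boundary n h w = ?g w)"
  proof (rule graph_words_exact)
    show "w \<in> edge_words n G m" if "?g w \<noteq> 0" for w
      using f that by (auto simp: chains_supported supported_def word_face_inj)
    show "word_boundary n ?g w = 0" if "w \<in> block_words n" for w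
      using boundary_gchains_word_face[OF f that] cyc by simp
  qed (use edge_pairs_props[OF graph] edge_pairs_ne m in auto)
  then obtain h where h: "\<And>w. h w \<noteq> 0 \<Longrightarrow> w \<in> edge_words n G (Suc m)"
    "\<And>w. w \<in> block_words n \<Longrightarrow> word_boundary n h w = ?g w" by blast
  \<comment> \<open>\<open>butlast\<close> strips the complementary block and recovers the word of a
    face.\<close>
  define g where "g P = (if P \<in> faces_of (Suc m) then h (butlast P) else 0)" for P
  have g: "g \<in> gchains (Suc m)" by (auto simp: chains_supported supported_def g_def)
  have gh: "(\<lambda>u. g (word_face n u)) = h"
  proof
    fix u
    show "g (word_face n u) = h u"
      using h(1)[of u] by (auto simp: g_def word_face_inj) (auto simp: word_face_def)
  qed
  have "boundary g = f"
  proof (rule chains_eqI[OF boundary_chains[OF g] f])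
    fix w assume "w \<in> edge_words n G m"
    then have "w \<in> block_words n" by (simp add: graph_words_def)
    then show "boundary g (word_face n w) = f (word_face n w)"
      using boundary_gchains_word_face[OF g] h(2) by (simp add: gh)
  qed
  then show ?thesis using g by blast
qed

section \<open>Exactness and dimensions of the Eulerian summands\<close>

lemma eulerian_subset: "eulerian m j \<subseteq> gchains m"
  unfolding eulerian_space_def using eulerian_action_chains by blast

lemma eulerian_subspace: "chain.subspace (eulerian m j)"
  unfolding eulerian_space_def by (rule subspace_image[OF chains_subspace eulerian_action_add eulerian_action_scale])

lemma eulerian_span: "eulerian m j \<subseteq> chain.span (basis_chain ` faces_of m)"
  by (rule order_trans[OF eulerian_subset]) (simp add: chains_supported supported_span)

text \<open>A filling of an Eulerian cycle may leave the summand. The idempotent brings it back and,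
  since it commutes with the boundary and fixes the cycle, the result is still a filling.\<close>

lemma eulerian_exact:
  assumes "Suc m < n"
  shows "boundary ` eulerian (Suc m) j = eulerian_cycle m j"
proof (intro equalityI subsetI)
  fix f assume "f \<in> boundary ` eulerian (Suc m) j"
  then obtain g where g: "g \<in> gchains (Suc m)" "f = boundary (eulerian_action n (Suc m) j g)"
    by (auto simp: eulerian_space_def)
  have "f = eulerian_action n m j (boundary g)" using g boundary_eulerian_action by simp
  moreover have "boundary f = 0"
  proof (cases m)
    case 0
    then show ?thesis using g boundary_chains[OF eulerian_action_chains[OF g(1)]] boundary_chains_0 by simp
  next
    case (Suc k)
    then show ?thesis using g boundary_boundary[of "eulerian_action n (Suc m) j g" k] eulerian_action_chains[OF g(1)] by simp
  qed
  ultimately show "f \<in> eulerian_cycle m j" using boundary_chains[OF g(1)] by (auto simp: eulerian_kernel_def eulerian_space_def)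
next
  fix f assume f: "f \<in> eulerian_cycle m j"
  then have fC: "f \<in> gchains m" and fE: "eulerian_action n m j f = f"
    using eulerian_action_chains eulerian_action_idempotent by (auto simp: eulerian_kernel_def eulerian_space_def)
  obtain g where g: "g \<in> gchains (Suc m)" "boundary g = f" using chains_exact[OF fC _ assms] f by (auto simp: eulerian_kernel_def)
  then have "boundary (eulerian_action n (Suc m) j g) = f" using boundary_eulerian_action fE by simp
  then show "f \<in> boundary ` eulerian (Suc m) j" using g(1) by (auto simp: eulerian_space_def)
qed

lemma dim_eulerian_cycle_0: "chain.dim (eulerian_cycle 0 j) = chain.dim (eulerian 0 j)"
proof -
  have "eulerian_cycle 0 j = eulerian 0 j" using eulerian_subset boundary_chains_0 unfolding eulerian_kernel_def by blast
  then show ?thesis by simp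
qed

text \<open>By exactness the image of the boundary is the whole space of cycles one degree
  below.\<close>

lemma dim_eulerian_cycle_Suc:
  assumes "Suc m < n"
  shows "chain.dim (eulerian_cycle (Suc m) j) + chain.dim (eulerian_cycle m j) = chain.dim (eulerian (Suc m) j)"
  unfolding eulerian_exact[OF assms, symmetric] unfolding eulerian_kernel_def
proof (rule chain_rank_nullity[OF eulerian_subspace _ eulerian_span])
  show "boundary (f + g) = boundary f + boundary g" if "f \<in> eulerian (Suc m) j" "g \<in> eulerian (Suc m) j" for f g
    using that eulerian_subset by (intro boundary_add) blast+
  show "boundary (chain_scale c f) = chain_scale c (boundary f)" if "f \<in> eulerian (Suc m) j" for c f
    using that eulerian_subset by (intro boundary_scale) blast
qed simp

text \<open>Solving the recursion upward from the empty face gives a truncated Euler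
  characteristic.\<close>

lemma dim_eulerian_cycle:
  "k < n \<Longrightarrow> int (chain.dim (eulerian_cycle k j)) = (\<Sum>m\<le>k. (- 1) ^ (k - m) * int (chain.dim (eulerian m j)))"
proof (induction k)
  case (Suc k)
  have "(\<Sum>m\<le>k. (- 1) ^ (Suc k - m) * int (chain.dim (eulerian m j)))
      = - (\<Sum>m\<le>k. (- 1) ^ (k - m) * int (chain.dim (eulerian m j)))"
    unfolding sum_negf[symmetric] by (rule sum.cong) (auto simp: Suc_diff_le)
  then show ?case using Suc dim_eulerian_cycle_Suc[of k j] by simp
qed (simp add: dim_eulerian_cycle_0)

text \<open>Signed blocks are nonempty and pairwise disjoint, so equal blocks have equal signed
  indices.\<close>

lemma perm_word_fixed:
  assumes w: "w \<in> block_words n" "length w = m" and \<pi>: "\<pi> \<in> hyperoctahedral m"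
  shows "perm_word w \<pi> = w \<longleftrightarrow> \<pi> = id"
proof
  assume fixed: "perm_word w \<pi> = w"
  have "\<pi> k = k" if k: "1 \<le> k" "k \<le> int m" for k
  proof (rule ccontr)
    assume ne: "\<pi> k \<noteq> k"
    have "signed_block w (\<pi> k) = signed_block w k"
      using signed_block_pword[OF \<pi>, of k w] fixed k w(2) by (simp add: perm_word_def)
    moreover have "1 \<le> \<bar>\<pi> k\<bar>" "\<bar>\<pi> k\<bar> \<le> int (length w)"
      using k hyperoctahedral_mem[OF \<pi>, of k] hyperoctahedral_eq_0[OF \<pi>, of k] w(2) by auto
    ultimately show False
      using block_words_signed(1)[OF w(1), of k] block_words_signed(3)[OF w(1), of "\<pi> k" k] ne k w(2) by auto
  qed
  then have "pword m \<pi> = pword m id" by (intro map_cong) auto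
  then show "\<pi> = id" using pword_bij[of m] \<pi> id_hyperoctahedral[of m] unfolding bij_betw_def inj_on_def by blast
qed (use map_signed_block_upto[of w] in \<open>simp add: perm_word_def\<close>)

lemma dim_eulerian:
  "of_nat (chain.dim (eulerian m j)) = of_nat (card (edge_words n G m)) * coeff (eulerian_poly m 0) j"
proof -
  have "of_nat (chain.dim (eulerian m j)) = (\<Sum>x\<in>faces_of m. eulerian_action n m j (basis_chain x) x)"
    unfolding chains_supported eulerian_space_def
    by (rule dim_idempotent_image)
      (use eulerian_action_chains[where n = n] eulerian_action_add eulerian_action_scale eulerian_action_idempotent
        in \<open>simp_all add: chains_supported\<close>)
  also have "\<dots> = (\<Sum>w\<in>edge_words n G m. eulerian_action n m j (basis_chain (word_face n w)) (word_face n w))"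
    by (subst sum.reindex) (auto simp: inj_on_def word_face_inj)
  also have "\<dots> = (\<Sum>w\<in>edge_words n G m. coeff (eulerian_poly m 0) j)"
  proof (rule sum.cong[OF refl])
    fix w assume w: "w \<in> edge_words n G m"
    then have wb: "w \<in> block_words n" "length w = m" by (simp_all add: graph_words_def)
    have "basis_chain (word_face n w) \<in> gchains m"
      unfolding chains_supported using w by (intro basis_chain_supported) auto
    then have "eulerian_action n m j (basis_chain (word_face n w)) (word_face n w)
        = (\<Sum>\<pi>\<in>hyperoctahedral m. eulerian_coeff m j \<pi> * basis_chain (word_face n w) (word_face n (perm_word w \<pi>)))"
      using eulerian_action_gchains_word_face[OF _ wb(2)] by (simp add: euler_op_def perm_word_def wb(2))
    also have "\<dots> = (\<Sum>\<pi>\<in>hyperoctahedral m. if \<pi> = id then eulerian_coeff m j \<pi> else 0)"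
      by (intro sum.cong refl) (auto simp: basis_chain_def word_face_inj perm_word_fixed[OF wb])
    also have "\<dots> = eulerian_coeff m j id" by simp
    also have "\<dots> = coeff (eulerian_poly m 0) j"
    proof -
      have "descents m id = 0" by (simp add: descents_def)
      then show ?thesis by (simp add: eulerian_coeff_eq)
    qed
    finally show "eulerian_action n m j (basis_chain (word_face n w)) (word_face n w) = coeff (eulerian_poly m 0) j" .
  qed
  finally show ?thesis by simp
qed

end

section \<open>Colorings\<close>

lemma card_partial:
  assumes w: "w \<in> block_words n"
  shows "k \<le> length w \<Longrightarrow> card (partial w k) = (\<Sum>i<k. card (w ! i))"
proof (induction k)
  case (Suc k)
  then have k: "k < length w" by simp
  have "finite (w ! i)" if "i < length w" for i using block_wordsD(2)[OF w that] finite_subset[OF _ finite_ground] by blast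
  then have "finite (partial w k)" "finite (w ! k)" using k by (auto simp: partial_def nth_image[symmetric])
  then show ?case using Suc k partial_disjoint[OF w k] by (simp add: partial_Suc card_Un_disjoint)
qed simp

lemma admissible_abs:
  assumes "admissible n Q" shows "inj_on abs Q" "abs ` Q \<subseteq> {1..int n}"
proof -
  show "inj_on abs Q" using assms by (auto simp: inj_on_def admissible_def abs_eq_iff)
  have "x \<in> ground n" if "x \<in> Q" for x using assms that unfolding admissible_def by blast
  then show "abs ` Q \<subseteq> {1..int n}" by (fastforce simp: ground_def)
qed

lemma card_admissible: assumes "admissible n Q" shows "card Q \<le> n"
  using card_mono[OF _ admissible_abs(2)[OF assms]] card_image[OF admissible_abs(1)[OF assms]] by simp

lemma card_partial_le: "w \<in> block_words n \<Longrightarrow> card (partial w (length w)) \<le> n"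
  using card_admissible[OF partial_admissible[of w n "length w"]] by (cases "w = []") (auto simp: Suc_le_eq)

lemma block_words_nonzero_card: "w \<in> block_words n \<Longrightarrow> i < length w \<Longrightarrow> 1 \<le> card (w ! i)"
  using block_wordsD(1,2)[of w n i] finite_subset[OF _ finite_ground] by (simp add: Suc_le_eq card_gt_0_iff)

lemma block_words_length: assumes w: "w \<in> block_words n" shows "length w \<le> n"
proof -
  have "length w = (\<Sum>i<length w. 1)" by simp
  also have "\<dots> \<le> (\<Sum>i<length w. card (w ! i))" by (rule sum_mono) (use block_words_nonzero_card[OF w] in simp)
  also have "\<dots> \<le> n" using card_partial[OF w, of "length w"] card_partial_le[OF w] by simp
  finally show ?thesis .
qed

text \<open>Blocks use pairwise different coordinates, so \<open>n\<close> blocks are singletons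
  that use all of them. The index \<open>fst e\<close> then occurs up to sign in some block, and
  collapsing puts a second element there.\<close>

lemma graph_words_top:
  assumes E: "E \<subseteq> ground n \<times> ground n" "\<And>e. e \<in> E \<Longrightarrow> fst e \<noteq> snd e"
  shows "graph_words n E n = {}"
proof (rule ccontr)
  assume "graph_words n E n \<noteq> {}"
  then obtain w e where w: "w \<in> block_words n" "length w = n" and e: "e \<in> E" "\<And>B. B \<in> set w \<Longrightarrow> collapses e B"
    by (auto simp: graph_words_def)
  have e_gr: "fst e \<in> ground n" and e_ne: "fst e \<noteq> snd e" using E e(1) by auto
  then have n: "n \<noteq> 0" by (auto simp: ground_def)
  define D where "D = partial w n"
  have adm: "admissible n D" unfolding D_def using partial_admissible[OF w(1), of n] w(2) n by simp
  have cardD: "card D = (\<Sum>i<n. card (w ! i))" using card_partial[OF w(1), of n] w(2) by (simp add: D_def)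
  have "\<bar>fst e\<bar> \<in> abs ` D"
  proof -
    have "n = (\<Sum>i<n. 1)" by simp
    also have "\<dots> \<le> card D" unfolding cardD by (rule sum_mono) (use block_words_nonzero_card[OF w(1)] w(2) in simp)
    also have "card D = card (abs ` D)"
      by (rule card_image[OF admissible_abs(1)[OF adm], symmetric])
    finally have "card {1..int n} \<le> card (abs ` D)" by simp
    then have "abs ` D = {1..int n}" using admissible_abs(2)[OF adm] by (intro card_seteq) auto
    then show ?thesis using e_gr by (auto simp: ground_def)
  qed
  then have "fst e \<in> D \<or> - fst e \<in> D" by (auto simp: abs_eq_iff)
  then obtain i where i: "i < n" "fst e \<in> w ! i \<or> - fst e \<in> w ! i" using w(2) by (auto simp: D_def partial_iff)
  have col: "collapses e (w ! i)" using e(2) i w(2) by simp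
  have fin: "finite (w ! i)" using block_wordsD(2)[OF w(1), of i] i w(2) finite_subset[OF _ finite_ground] by blast
  have "{fst e, snd e} \<subseteq> w ! i \<or> {- fst e, - snd e} \<subseteq> w ! i" using i(2) col by (auto simp: collapses_def)
  then have "2 \<le> card (w ! i)"
    using e_ne fin card_mono[of "w ! i" "{fst e, snd e}"] card_mono[of "w ! i" "{- fst e, - snd e}"] by auto
  then have "(\<Sum>i<n. 1) < (\<Sum>i<n. card (w ! i))"
    using i(1) block_words_nonzero_card[OF w(1)] w(2) by (intro sum_strict_mono_ex1) (auto intro!: bexI[of _ i])
  then show False using cardD card_admissible[OF adm] by simp
qed

section \<open>Colorings as words with a set of levels\<close>

definition color_ext :: "(nat \<Rightarrow> int) \<Rightarrow> int \<Rightarrow> int" where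
  "color_ext \<phi> z = (if z > 0 then \<phi> (nat z) else if z < 0 then - \<phi> (nat (- z)) else 0)"

definition color_levels :: "nat \<Rightarrow> (nat \<Rightarrow> int) \<Rightarrow> int set" where
  "color_levels n \<phi> = {t. 0 < t \<and> t \<in> color_ext \<phi> ` ground n}"

text \<open>Negative values are represented by the negated blocks and the value 0 by the elements of
  no signed block, so the word determines the coloring up to the choice of its levels.\<close>

definition color_word :: "nat \<Rightarrow> (nat \<Rightarrow> int) \<Rightarrow> int set list" where
  "color_word n \<phi> = map (\<lambda>t. {z \<in> ground n. color_ext \<phi> z = t}) (sorted_list_of_set (color_levels n \<phi>))"

text \<open>For a block word at most one summand is nonzero, so this is the level attached to the
  block of \<open>z\<close>, or 0 if there is none.\<close>

definition block_level :: "int set list \<Rightarrow> int list \<Rightarrow> int \<Rightarrow> int" where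
  "block_level w ts z = sum_list (map2 (\<lambda>B t. if z \<in> B then t else 0) w ts)"

definition word_coloring :: "nat \<Rightarrow> int set list \<Rightarrow> int set \<Rightarrow> nat \<Rightarrow> int" where
  "word_coloring n w T = (\<lambda>i\<in>{1..n}. block_level w (sorted_list_of_set T) (int i) - block_level w (sorted_list_of_set T) (- int i))"

definition colorings :: "nat \<Rightarrow> nat \<Rightarrow> (nat \<Rightarrow> int) set" where
  "colorings n c = ({1..n} \<rightarrow>\<^sub>E {- int c..int c})"

lemma color_ext_uminus: "color_ext \<phi> (- z) = - color_ext \<phi> z"
  by (simp add: color_ext_def)

lemma finite_color_levels [simp]: "finite (color_levels n \<phi>)"
  by (simp add: color_levels_def)

lemma color_ext_bound:
  assumes "\<phi> \<in> colorings n c" "z \<in> ground n" shows "\<bar>color_ext \<phi> z\<bar> \<le> int c"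
proof -
  have "\<bar>\<phi> i\<bar> \<le> int c" if "i \<in> {1..n}" for i
    using PiE_mem[OF assms(1)[unfolded colorings_def] that] by auto
  moreover have "z > 0 \<Longrightarrow> nat z \<in> {1..n}" "z < 0 \<Longrightarrow> nat (- z) \<in> {1..n}"
    using assms(2) by (auto simp: ground_def)
  ultimately show ?thesis by (simp add: color_ext_def)
qed

lemma color_word_block_words: "color_word n \<phi> \<in> block_words n"
  unfolding block_words_sorted
proof (intro conjI)
  let ?F = "\<lambda>t. {z \<in> ground n. color_ext \<phi> z = t}" and ?ts = "sorted_list_of_set (color_levels n \<phi>)"
  have "sorted_wrt (<) ?ts" by (rule strict_sorted_list_of_set)
  then show "sorted_wrt (\<lambda>A B. A \<inter> B = {}) (color_word n \<phi>)"
    unfolding color_word_def sorted_wrt_map by (rule sorted_wrt_mono_rel[rotated]) auto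
  have ts: "set ?ts = color_levels n \<phi>" by simp
  show "\<forall>B\<in>set (color_word n \<phi>). B \<noteq> {} \<and> B \<subseteq> ground n"
    unfolding color_word_def set_map ts by (auto simp: color_levels_def)
  show "\<forall>A\<in>set (color_word n \<phi>). \<forall>B\<in>set (color_word n \<phi>). A \<inter> neg_set B = {}"
    unfolding color_word_def set_map ts by (auto simp: color_levels_def color_ext_uminus)
qed

text \<open>Only positive values have blocks. A nonzero value is detected by the block of its
  absolute value, through one of the two halves of \<open>collapses\<close>.\<close>

lemma collapses_color_word:
  assumes e: "e \<in> ground n \<times> ground n"
  shows "(\<forall>B\<in>set (color_word n \<phi>). collapses e B) \<longleftrightarrow> color_ext \<phi> (fst e) = color_ext \<phi> (snd e)"
proof -
  obtain a b where ab: "e = (a, b)" "a \<in> ground n" "b \<in> ground n" using e by auto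
  have set: "set (color_word n \<phi>) = (\<lambda>t. {z \<in> ground n. color_ext \<phi> z = t}) ` color_levels n \<phi>"
    by (simp add: color_word_def)
  have lev: "color_ext \<phi> z \<in> color_levels n \<phi> \<longleftrightarrow> color_ext \<phi> z > 0" if "z \<in> ground n" for z
    using that by (auto simp: color_levels_def)
  have iff: "(\<forall>B\<in>set (color_word n \<phi>). collapses e B) \<longleftrightarrow> (\<forall>t\<in>color_levels n \<phi>.
      (color_ext \<phi> a = t \<longleftrightarrow> color_ext \<phi> b = t) \<and> (- color_ext \<phi> a = t \<longleftrightarrow> - color_ext \<phi> b = t))"
    unfolding set using ab by (simp add: collapses_def color_ext_uminus)
  show ?thesis
  proof
    assume L: "\<forall>B\<in>set (color_word n \<phi>). collapses e B"
    have L': "(color_ext \<phi> a = t \<longleftrightarrow> color_ext \<phi> b = t) \<and> (- color_ext \<phi> a = t \<longleftrightarrow> - color_ext \<phi> b = t)"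
      if "t \<in> color_levels n \<phi>" for t using L that unfolding iff by blast
    have "color_ext \<phi> x = color_ext \<phi> y" if "color_ext \<phi> x > 0" "(x, y) \<in> {(a, b), (b, a)}" for x y
      using L'[of "color_ext \<phi> x"] lev[of x] that ab by auto
    moreover have "color_ext \<phi> x = color_ext \<phi> y" if "color_ext \<phi> x < 0" "(x, y) \<in> {(a, b), (b, a)}" for x y
      using L'[of "- color_ext \<phi> x"] lev[of "- x"] that ab by (auto simp: color_ext_uminus)
    ultimately show "color_ext \<phi> (fst e) = color_ext \<phi> (snd e)"
      unfolding ab fst_conv snd_conv
      by (cases "color_ext \<phi> a = 0"; cases "color_ext \<phi> b = 0") (metis insertI1 insertI2 linorder_neqE_linordered_idom)+
  next
    assume "color_ext \<phi> (fst e) = color_ext \<phi> (snd e)"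
    then have "color_ext \<phi> a = color_ext \<phi> b" using ab by simp
    then show "\<forall>B\<in>set (color_word n \<phi>). collapses e B" unfolding iff by simp
  qed
qed

lemma word_coloring_color_word:
  assumes \<phi>: "\<phi> \<in> colorings n c"
  shows "word_coloring n (color_word n \<phi>) (color_levels n \<phi>) = \<phi>"
proof -
  let ?ts = "sorted_list_of_set (color_levels n \<phi>)"
  have lev: "block_level (color_word n \<phi>) ?ts z = (if color_ext \<phi> z > 0 then color_ext \<phi> z else 0)"
    if z: "z \<in> ground n" for z
  proof -
    have "block_level (color_word n \<phi>) ?ts z = sum_list (map (\<lambda>t. if color_ext \<phi> z = t then t else 0) ?ts)"
      unfolding block_level_def color_word_def zip_map1 zip_same_conv_map using z by (simp add: comp_def)
    also have "\<dots> = (\<Sum>t\<in>color_levels n \<phi>. if color_ext \<phi> z = t then t else 0)"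
      by (subst sum_list_distinct_conv_sum_set) simp_all
    also have "\<dots> = (if color_ext \<phi> z > 0 then color_ext \<phi> z else 0)"
      using z by (auto simp: color_levels_def)
    finally show ?thesis .
  qed
  show ?thesis
  proof
    fix i
    show "word_coloring n (color_word n \<phi>) (color_levels n \<phi>) i = \<phi> i"
    proof (cases "i \<in> {1..n}")
      case True
      then have "int i \<in> ground n" "color_ext \<phi> (int i) = \<phi> i" by (auto simp: ground_def color_ext_def)
      then show ?thesis using True lev[of "int i"] lev[of "- int i"]
        by (auto simp: word_coloring_def color_ext_uminus)
    next
      case False
      then show ?thesis using PiE_arb[OF \<phi>[unfolded colorings_def] False] by (auto simp: word_coloring_def)
    qed
  qed
qed

lemma color_ext_word_coloring:
  assumes w: "w \<in> block_words n" and T: "T \<subseteq> {1..int c}" "length w = card T" and z: "z \<in> ground n"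
  defines "ts \<equiv> sorted_list_of_set T"
  shows "k < length w \<Longrightarrow> z \<in> w ! k \<Longrightarrow> color_ext (word_coloring n w T) z = ts ! k"
    and "(\<And>k. k < length w \<Longrightarrow> z \<notin> w ! k) \<Longrightarrow> color_ext (word_coloring n w T) z \<le> 0"
    and "\<bar>color_ext (word_coloring n w T) z\<bar> \<le> int c"
proof -
  have finT: "finite T" using T(1) finite_subset by blast
  have len: "length ts = length w" using T(2) by (simp add: ts_def)
  have tsT: "ts ! k \<in> {1..int c}" if "k < length w" for k
    using nth_mem[of k ts] that len finT T(1) by (auto simp: ts_def)
  have ext: "color_ext (word_coloring n w T) z = block_level w ts z - block_level w ts (- z)"
    using z by (auto simp: color_ext_def word_coloring_def ts_def ground_def)
  have lev: "block_level w ts y = (\<Sum>k<length w. if y \<in> w ! k then ts ! k else 0)" for y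
    unfolding block_level_def sum_list_sum_nth using len by (intro sum.cong) (auto simp: lessThan_atLeast0)
  have lev0: "block_level w ts y = 0" if "\<And>k. k < length w \<Longrightarrow> y \<notin> w ! k" for y
    unfolding lev using that by (intro sum.neutral) auto
  have lev1: "block_level w ts y = ts ! k" if k: "k < length w" "y \<in> w ! k" for y k
  proof -
    have "y \<notin> w ! l" if "l < length w" "l \<noteq> k" for l using block_wordsD(3)[OF w k(1) that(1)] that k by auto
    then have "block_level w ts y = (\<Sum>l<length w. if l = k then ts ! l else 0)"
      unfolding lev using k by (intro sum.cong) auto
    then show ?thesis using k by simp
  qed
  have opp: "- y \<notin> w ! l" if "k < length w" "y \<in> w ! k" "l < length w" for k l y
    using block_wordsD(4)[OF w that(1,3)] that(2) by (auto simp: neg_set_iff)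
  show one: "color_ext (word_coloring n w T) z = ts ! k" if "k < length w" "z \<in> w ! k" for k
    using ext lev1[OF that] lev0[of "- z"] opp[OF that] by simp
  have two: "color_ext (word_coloring n w T) z = - ts ! k" if "k < length w" "- z \<in> w ! k" for k
    using ext lev1[OF that] lev0[of z] opp[OF that] by simp
  have zero: "color_ext (word_coloring n w T) z = 0" if "\<And>k. k < length w \<Longrightarrow> z \<notin> w ! k" "\<And>k. k < length w \<Longrightarrow> - z \<notin> w ! k"
    using ext lev0[of z] lev0[of "- z"] that by simp
  show "color_ext (word_coloring n w T) z \<le> 0" if "\<And>k. k < length w \<Longrightarrow> z \<notin> w ! k"
  proof (cases "\<exists>k<length w. - z \<in> w ! k")
    case True
    then obtain k where "k < length w" "- z \<in> w ! k" by blast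
    then show ?thesis using two tsT[of k] by auto
  qed (use zero that in auto)
  show "\<bar>color_ext (word_coloring n w T) z\<bar> \<le> int c"
  proof (cases "(\<exists>k<length w. z \<in> w ! k) \<or> (\<exists>k<length w. - z \<in> w ! k)")
    case True
    then obtain k where k: "k < length w" "z \<in> w ! k \<or> - z \<in> w ! k" by blast
    then show ?thesis using one[of k] two[of k] tsT[of k] by auto
  next
    case False
    then have "color_ext (word_coloring n w T) z = 0" by (intro zero) blast+
    then show ?thesis by simp
  qed
qed

text \<open>Levels are attached in increasing order along the word, so sorting the values returns
  the blocks in their original order.\<close>

lemma color_word_word_coloring:
  assumes w: "w \<in> block_words n" and T: "T \<subseteq> {1..int c}" "length w = card T"
  shows "color_levels n (word_coloring n w T) = T" "color_word n (word_coloring n w T) = w"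
    "word_coloring n w T \<in> colorings n c"
proof -
  define ts where "ts = sorted_list_of_set T"
  let ?\<phi> = "word_coloring n w T"
  have finT: "finite T" using T(1) finite_subset by blast
  have len: "length ts = length w" and set: "set ts = T" and dist: "distinct ts" using T(2) finT by (simp_all add: ts_def)
  have pos: "ts ! k > 0" if "k < length w" for k using nth_mem[of k ts] that len T(1) unfolding set by force
  have gr: "w ! k \<subseteq> ground n" if "k < length w" for k using block_wordsD(2)[OF w that] .
  have one: "color_ext ?\<phi> z = ts ! k" if "k < length w" "z \<in> w ! k" for z k
    using color_ext_word_coloring(1)[OF w T _ that] that gr unfolding ts_def by blast
  have neg: "color_ext ?\<phi> z \<le> 0" if "z \<in> ground n" "\<And>k. k < length w \<Longrightarrow> z \<notin> w ! k" for z
    using color_ext_word_coloring(2)[OF w T that(1)] that(2) by blast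
  have lv: "{z \<in> ground n. color_ext ?\<phi> z = ts ! k} = w ! k" if k: "k < length w" for k
  proof (intro equalityI subsetI)
    fix z assume z: "z \<in> {z \<in> ground n. color_ext ?\<phi> z = ts ! k}"
    then have "\<not> color_ext ?\<phi> z \<le> 0" using pos[OF k] by simp
    then obtain l where l: "l < length w" "z \<in> w ! l" using neg[of z] z by blast
    then have "ts ! l = ts ! k" using one z by simp
    then have "l = k" using dist l k len by (simp add: nth_eq_iff_index_eq)
    then show "z \<in> w ! k" using l by simp
  qed (use one[OF k] gr[OF k] in auto)
  show levels: "color_levels n ?\<phi> = T"
  proof (intro equalityI subsetI)
    fix t assume "t \<in> color_levels n ?\<phi>"
    then obtain z where z: "z \<in> ground n" "t = color_ext ?\<phi> z" "0 < t" by (auto simp: color_levels_def)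
    then obtain k where k: "k < length w" "z \<in> w ! k" using neg[of z] by force
    then have "t = ts ! k" using one z by simp
    then show "t \<in> T" using k len set nth_mem[of k ts] by simp
  next
    fix t assume "t \<in> T"
    then obtain k where k: "k < length w" "t = ts ! k" using set len by (metis in_set_conv_nth)
    obtain z where "z \<in> w ! k" using block_wordsD(1)[OF w k(1)] by blast
    then have "z \<in> ground n" "color_ext ?\<phi> z = t" using one[OF k(1)] gr[OF k(1)] k by auto
    then have "t \<in> color_ext ?\<phi> ` ground n" by blast
    then show "t \<in> color_levels n ?\<phi>" using pos[OF k(1)] k(2) by (simp add: color_levels_def)
  qed
  show "color_word n ?\<phi> = w"
    unfolding color_word_def levels ts_def[symmetric]
    by (rule nth_equalityI) (use len lv in simp_all)
  show "?\<phi> \<in> colorings n c"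
    unfolding colorings_def
  proof (rule PiE_I)
    fix i assume i: "i \<in> {1..n}"
    then have "int i \<in> ground n" "color_ext ?\<phi> (int i) = ?\<phi> i" by (auto simp: ground_def color_ext_def)
    then show "?\<phi> i \<in> {- int c..int c}" using color_ext_word_coloring(3)[OF w T, of "int i"] by auto
  qed (auto simp: word_coloring_def)
qed

lemma proper_colorings_eq:
  assumes "signed_graph_on n G"
  shows "proper_colorings n G c = {\<phi> \<in> colorings n c. \<forall>e\<in>edge_pairs G. color_ext \<phi> (fst e) \<noteq> color_ext \<phi> (snd e)}"
proof -
  have pos: "i \<ge> 1 \<and> j \<ge> 1" if "{i, j} \<in> pos_edges G \<or> {i, j} \<in> neg_edges G" for i j
    using assms that unfolding signed_graph_on_def by fastforce
  have half: "i \<ge> 1" if "{i} \<in># half_edges G" for i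
    using assms that unfolding signed_graph_on_def by fastforce
  have ext: "color_ext \<phi> (int i) = \<phi> i" "color_ext \<phi> (- int i) = - \<phi> i" if "i \<ge> 1" for \<phi> i
    using that by (auto simp: color_ext_def)
  have ball2: "(\<forall>x\<in>{F i j | i j. P i j}. R x) \<longleftrightarrow> (\<forall>i j. P i j \<longrightarrow> R (F i j))" for F P R by blast
  have ball1: "(\<forall>x\<in>{F i | i. P i}. R x) \<longleftrightarrow> (\<forall>i. P i \<longrightarrow> R (F i))" for F P R by blast
  have "(\<forall>e\<in>edge_pairs G. color_ext \<phi> (fst e) \<noteq> color_ext \<phi> (snd e)) \<longleftrightarrow>
      (\<forall>i j. {i, j} \<in> pos_edges G \<longrightarrow> \<phi> i \<noteq> \<phi> j) \<and> (\<forall>i j. {i, j} \<in> neg_edges G \<longrightarrow> \<phi> i \<noteq> - \<phi> j) \<and>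
      (\<forall>i. {i} \<in># half_edges G \<longrightarrow> \<phi> i \<noteq> 0)" for \<phi>
  proof -
    have "(\<forall>i j. {i, j} \<in> pos_edges G \<longrightarrow> color_ext \<phi> (int i) \<noteq> color_ext \<phi> (int j))
        \<longleftrightarrow> (\<forall>i j. {i, j} \<in> pos_edges G \<longrightarrow> \<phi> i \<noteq> \<phi> j)"
    proof (intro iff_allI imp_cong refl)
      fix i j assume "{i, j} \<in> pos_edges G"
      then show "color_ext \<phi> (int i) \<noteq> color_ext \<phi> (int j) \<longleftrightarrow> \<phi> i \<noteq> \<phi> j"
        using ext(1)[of i] ext(1)[of j] pos[of i j] by simp
    qed
    moreover have "(\<forall>i j. {i, j} \<in> neg_edges G \<longrightarrow> color_ext \<phi> (int i) \<noteq> color_ext \<phi> (- int j))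
        \<longleftrightarrow> (\<forall>i j. {i, j} \<in> neg_edges G \<longrightarrow> \<phi> i \<noteq> - \<phi> j)"
    proof (intro iff_allI imp_cong refl)
      fix i j assume "{i, j} \<in> neg_edges G"
      then show "color_ext \<phi> (int i) \<noteq> color_ext \<phi> (- int j) \<longleftrightarrow> \<phi> i \<noteq> - \<phi> j"
        using ext(1)[of i] ext(2)[of j] pos[of i j] by simp
    qed
    moreover have "(\<forall>i. {i} \<in># half_edges G \<longrightarrow> color_ext \<phi> (int i) \<noteq> color_ext \<phi> (- int i))
        \<longleftrightarrow> (\<forall>i. {i} \<in># half_edges G \<longrightarrow> \<phi> i \<noteq> 0)"
    proof (intro iff_allI imp_cong refl)
      fix i assume "{i} \<in># half_edges G"
      then show "color_ext \<phi> (int i) \<noteq> color_ext \<phi> (- int i) \<longleftrightarrow> \<phi> i \<noteq> 0"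
        using ext[of i] half[of i] by simp
    qed
    ultimately show ?thesis unfolding edge_pairs_def ball_Un ball2 ball1 fst_conv snd_conv by simp
  qed
  then show ?thesis unfolding proper_colorings_def colorings_def by simp
qed

text \<open>An improper coloring amounts to a word of the complex and the set of its positive
  levels; any subset of \<open>{1..c}\<close> of the right size can serve as levels.\<close>

lemma card_improper:
  assumes G: "signed_graph_on n G"
  shows "(2 * c + 1) ^ n = card (proper_colorings n G c) + (\<Sum>m<n. card (edge_words n G m) * (c choose m))"
proof -
  let ?E = "edge_pairs G"
  define I where "I = {\<phi> \<in> colorings n c. \<exists>e\<in>?E. color_ext \<phi> (fst e) = color_ext \<phi> (snd e)}"
  define R where "R = (\<Union>m<n. graph_words n ?E m \<times> {T. T \<subseteq> {1..int c} \<and> card T = m})"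
  have fin: "finite (colorings n c)" unfolding colorings_def by (intro finite_PiE) auto
  have "bij_betw (\<lambda>\<phi>. (color_word n \<phi>, color_levels n \<phi>)) I R"
  proof (rule bij_betw_byWitness[where f' = "\<lambda>(w, T). word_coloring n w T"])
    show "\<forall>\<phi>\<in>I. (case (color_word n \<phi>, color_levels n \<phi>) of (w, T) \<Rightarrow> word_coloring n w T) = \<phi>"
      using word_coloring_color_word by (auto simp: I_def)
    show "\<forall>p\<in>R. (\<lambda>\<phi>. (color_word n \<phi>, color_levels n \<phi>)) (case p of (w, T) \<Rightarrow> word_coloring n w T) = p"
      using color_word_word_coloring(1,2)[of _ n _ c] by (auto simp: R_def graph_words_def)
    show "(\<lambda>\<phi>. (color_word n \<phi>, color_levels n \<phi>)) ` I \<subseteq> R"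
    proof clarify
      fix \<phi> assume "\<phi> \<in> I"
      then obtain e where \<phi>: "\<phi> \<in> colorings n c" and e: "e \<in> ?E" "color_ext \<phi> (fst e) = color_ext \<phi> (snd e)" by (auto simp: I_def)
      let ?m = "card (color_levels n \<phi>)"
      have "e \<in> ground n \<times> ground n" using edge_pairs_props(1)[OF G] e(1) by blast
      then have "\<forall>B\<in>set (color_word n \<phi>). collapses e B" using collapses_color_word e(2) by blast
      then have w: "color_word n \<phi> \<in> graph_words n ?E ?m"
        using color_word_block_words[of n \<phi>] e(1) by (auto simp: graph_words_def color_word_def)
      \<comment> \<open>With \<open>n\<close> levels all blocks would be singletons, which no edge
        collapses; hence the sum ends at \<open>n - 1\<close>.\<close>
      have "?m \<noteq> n" using w graph_words_top[OF edge_pairs_props(1,3)[OF G]] by auto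
      moreover have "?m \<le> n" using block_words_length[of "color_word n \<phi>" n] w by (simp add: graph_words_def)
      moreover have "color_levels n \<phi> \<subseteq> {1..int c}"
        using color_ext_bound[OF \<phi>] by (force simp: color_levels_def)
      ultimately show "(color_word n \<phi>, color_levels n \<phi>) \<in> R" using w unfolding R_def by auto
    qed
    show "(\<lambda>(w, T). word_coloring n w T) ` R \<subseteq> I"
    proof clarify
      fix w T assume "(w, T) \<in> R"
      then have w: "w \<in> graph_words n ?E (card T)" and T: "T \<subseteq> {1..int c}" by (auto simp: R_def)
      then have wb: "w \<in> block_words n" "length w = card T" by (auto simp: graph_words_def)
      obtain e where e: "e \<in> ?E" "\<forall>B\<in>set w. collapses e B" using w by (auto simp: graph_words_def)
      note cw = color_word_word_coloring[OF wb(1) T wb(2)]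
      have "e \<in> ground n \<times> ground n" using edge_pairs_props(1)[OF G] e(1) by blast
      then have "color_ext (word_coloring n w T) (fst e) = color_ext (word_coloring n w T) (snd e)"
        using collapses_color_word[of e n "word_coloring n w T"] cw(2) e(2) by simp
      then show "word_coloring n w T \<in> I" using cw(3) e(1) by (auto simp: I_def)
    qed
  qed
  then have "card I = card R" by (rule bij_betw_same_card)
  also have "\<dots> = (\<Sum>m<n. card (graph_words n ?E m) * (c choose m))"
    unfolding R_def by (subst card_UN_disjoint) (auto simp: card_cartesian_product n_subsets)
  finally have I: "card I = (\<Sum>m<n. card (graph_words n ?E m) * (c choose m))" .
  have "colorings n c = proper_colorings n G c \<union> I" "proper_colorings n G c \<inter> I = {}"
    unfolding proper_colorings_eq[OF G] I_def by blast+
  then have "card (colorings n c) = card (proper_colorings n G c) + card I"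
    using fin by (metis card_Un_disjoint finite_Un)
  moreover have "card (colorings n c) = (2 * c + 1) ^ n"
  proof -
    have "nat (int c + 1 + int c) = 2 * c + 1" by simp
    then show ?thesis unfolding colorings_def by (simp add: card_PiE)
  qed
  ultimately show ?thesis using I by simp
qed

section \<open>The chromatic polynomial\<close>

lemma poly_odd_unique:
  fixes p q :: "real poly"
  assumes "\<And>c::nat. poly p (2 * real c + 1) = poly q (2 * real c + 1)"
  shows "p = q"
proof -
  have "range (\<lambda>c::nat. 2 * real c + 1) \<subseteq> {x. poly (p - q) x = 0}" using assms by auto
  moreover have "infinite (range (\<lambda>c::nat. 2 * real c + 1))"
    by (rule range_inj_infinite) (auto simp: inj_def)
  ultimately have "p - q = 0" using poly_roots_finite finite_subset by blast
  then show ?thesis by simp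
qed

text \<open>At \<open>- (2 c + 1)\<close> the k-th factor equals \<open>- 2 (c - (k - 1))\<close>,
  so up to constants the product is a falling factorial of \<open>c\<close>.\<close>

lemma poly_eulerian_poly_neg:
  "poly (eulerian_poly m 0) (- (2 * of_nat c + 1)) = (- 1) ^ m * of_nat (c choose m)"
proof -
  have "(\<Prod>k=1..m. - (2 * of_nat c + 1) + (- 2 * of_nat 0 + 2 * of_nat k - 1 :: complex))
      = (\<Prod>k=1..m. (- 2) * (of_nat c - of_nat (k - 1)))"
    by (rule prod.cong) (auto simp: algebra_simps of_nat_diff)
  also have "\<dots> = (- 2) ^ m * (\<Prod>k=1..m. of_nat c - of_nat (k - 1))"
    unfolding prod.distrib by simp
  also have "(\<Prod>k=1..m. of_nat c - of_nat (k - 1) :: complex) = (\<Prod>i=0..<m. of_nat c - of_nat i)"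
    by (rule prod.reindex_bij_witness[where i = Suc and j = "\<lambda>k. k - 1"]) auto
  also have "\<dots> = fact m * of_nat (c choose m)"
    by (simp add: binomial_gbinomial gbinomial_prod_rev)
  finally have prod: "(\<Prod>k=1..m. - (2 * of_nat c + 1) + (- 2 * of_nat 0 + 2 * of_nat k - 1 :: complex))
      = (- 2) ^ m * (fact m * of_nat (c choose m))" .
  have "poly (eulerian_poly m 0) (- (2 * of_nat c + 1))
      = 1 / (2 ^ m * fact m) * (\<Prod>k=1..m. - (2 * of_nat c + 1) + (- 2 * of_nat 0 + 2 * of_nat k - 1))"
    unfolding eulerian_poly_def poly_smult poly_prod
    by (intro arg_cong2[of _ _ _ _ "(*)"] refl prod.cong) simp
  also have "\<dots> = (- 1) ^ m * of_nat (c choose m)"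
    unfolding prod by (simp add: power_minus[of 2])
  finally show ?thesis .
qed

text \<open>No word of the complex has \<open>n\<close> blocks, so there are no nonzero boundaries
  in degree \<open>n - 2\<close>, and the homology is the space of cycles on words with
  \<open>k = n - 1\<close> blocks.\<close>

lemma homology_dim_eq:
  assumes G: "signed_graph_on n G" "edge_multiset G \<noteq> {#}" and n: "n = Suc k"
  shows "homology_dim n G j (int n - 2) = chain.dim (eulerian_kernel n G k j)"
proof -
  have r: "int n - 2 = int k - 1" "int n - 2 + 1 = int n - 1" using n by auto
  have cyc: "eulerian_cycles n G j (int n - 2) = eulerian_kernel n G k j"
    unfolding eulerian_cycles_def eulerian_chains_def eulerian_kernel_def eulerian_space_def graph_chains_def r(1) by simp
  have "edge_words n G n = {}" using graph_words_top[OF edge_pairs_props(1,3)[OF G(1)]] .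
  then have "chain_space n G (int n - 1) = {0}"
    unfolding chain_space_eq[OF edge_pairs_nonempty[OF G]] by (auto simp: fun_eq_iff)
  moreover have "eulerian_action n m j 0 = 0" for m
    by (simp add: eulerian_action_def linear_extension_def fun_eq_iff)
  moreover have "boundary 0 = 0" by (simp add: boundary_def linear_extension_def fun_eq_iff)
  ultimately have bd: "eulerian_boundaries n G j (int n - 2) = {0}"
    unfolding eulerian_boundaries_def eulerian_chains_def r(2) by simp
  have sub: "chain.subspace (eulerian_kernel n G k j)"
  proof -
    note V = eulerian_subspace[OF G, of k j] and sub = eulerian_subset[OF G, of k j]
    show ?thesis unfolding eulerian_kernel_def
    proof (rule chain.subspaceI)
      have "boundary (chain_scale 0 0) = chain_scale 0 (boundary 0)"
        using chain.subspace_0[OF chains_subspace[OF G]] by (rule boundary_scale[OF G])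
      then show "0 \<in> {f \<in> eulerian_space n G k j. boundary f = 0}" using chain.subspace_0[OF V] by simp
      show "f + g \<in> {f \<in> eulerian_space n G k j. boundary f = 0}"
        if "f \<in> {f \<in> eulerian_space n G k j. boundary f = 0}" "g \<in> {f \<in> eulerian_space n G k j. boundary f = 0}" for f g
      proof -
        have "boundary (f + g) = boundary f + boundary g" using that sub by (intro boundary_add[OF G]) auto
        moreover have "f + g \<in> eulerian_space n G k j" using that by (intro chain.subspace_add[OF V]) auto
        moreover have "boundary f = 0" "boundary g = 0" using that by auto
        ultimately show ?thesis by simp
      qed
      show "chain_scale c f \<in> {f \<in> eulerian_space n G k j. boundary f = 0}"
        if "f \<in> {f \<in> eulerian_space n G k j. boundary f = 0}" for c f
      proof -
        have "boundary (chain_scale c f) = chain_scale c (boundary f)" using that sub by (intro boundary_scale[OF G]) auto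
        moreover have "chain_scale c f \<in> eulerian_space n G k j" using that by (intro chain.subspace_scale[OF V]) auto
        moreover have "boundary f = 0" using that by auto
        ultimately show ?thesis by simp
      qed
    qed
  qed
  have "chain.quotient_dim (eulerian_kernel n G k j) {0} = chain.dim (eulerian_kernel n G k j) - chain.dim {0}"
  proof (rule chain.quotient_dim_eq[OF sub chain.subspace_single_0])
    show "{0} \<subseteq> eulerian_kernel n G k j" using chain.subspace_0[OF sub] by simp
    show "eulerian_kernel n G k j \<subseteq> chain.span (basis_chain ` word_face n ` edge_words n G k)"
      using eulerian_span[OF G, of k j] by (auto simp: eulerian_kernel_def)
  qed simp
  moreover have "chain.dim {0} = 0" using chain.dim_span[of "{}"] chain.span_empty chain.dim_eq_card_independent[of "{}"]
    by (simp add: chain.independent_empty)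
  ultimately show ?thesis unfolding homology_dim_def cyc bd by simp
qed

lemma homology_dim_coeff:
  assumes G: "signed_graph_on n G" "edge_multiset G \<noteq> {#}" and n: "n = Suc k"
  shows "of_nat (homology_dim n G j (int n - 2))
    = (\<Sum>m\<le>k. (- 1) ^ (k - m) * (of_nat (card (edge_words n G m)) * coeff (eulerian_poly m 0) j))"
proof -
  have "of_int (int (chain.dim (eulerian_kernel n G k j)))
      = (of_int (\<Sum>m\<le>k. (- 1) ^ (k - m) * int (chain.dim (eulerian_space n G m j))) :: complex)"
    using dim_eulerian_cycle[OF G, of k j] n by simp
  then show ?thesis unfolding homology_dim_eq[OF G n] by (simp add: dim_eulerian[OF G])
qed

text \<open>Summing over \<open>j\<close> evaluates the polynomial of each word at a negative odd
  number. Its sign \<open>(- 1) ^ m\<close> turns the alternating sum of the Euler characteristic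
  into a plain one.\<close>

lemma homology_dim_improper:
  assumes G: "signed_graph_on n G" "edge_multiset G \<noteq> {#}" and n: "n = Suc k"
  shows "(\<Sum>j\<le>n. real (homology_dim n G j (int n - 2)) * (- (2 * real c + 1)) ^ j)
    = (- 1) ^ k * real (\<Sum>m<n. card (edge_words n G m) * (c choose m))"
proof -
  let ?x = "- (2 * of_nat c + 1) :: complex" and ?N = "\<lambda>m. of_nat (card (edge_words n G m)) :: complex"
  have "(\<Sum>j\<le>n. of_nat (homology_dim n G j (int n - 2)) * ?x ^ j)
      = (\<Sum>j\<le>n. \<Sum>m\<le>k. (- 1) ^ (k - m) * ?N m * (coeff (eulerian_poly m 0) j * ?x ^ j))"
    unfolding homology_dim_coeff[OF G n] sum_distrib_right by (intro sum.cong refl) simp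
  also have "\<dots> = (\<Sum>m\<le>k. (- 1) ^ (k - m) * ?N m * (\<Sum>j\<le>n. coeff (eulerian_poly m 0) j * ?x ^ j))"
    unfolding sum_distrib_left by (rule sum.swap)
  also have "\<dots> = (\<Sum>m\<le>k. (- 1) ^ k * (?N m * of_nat (c choose m)))"
  proof (rule sum.cong[OF refl])
    fix m assume m: "m \<in> {..k}"
    have "(\<Sum>j\<le>n. coeff (eulerian_poly m 0) j * ?x ^ j) = poly (eulerian_poly m 0) ?x"
      unfolding poly_altdef using degree_eulerian_poly[of m 0] m n
      by (intro sum.mono_neutral_right) (auto simp: coeff_eq_0)
    also have "\<dots> = (- 1) ^ m * of_nat (c choose m)" by (rule poly_eulerian_poly_neg)
    finally have s: "(\<Sum>j\<le>n. coeff (eulerian_poly m 0) j * ?x ^ j) = (- 1) ^ m * of_nat (c choose m)" .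
    have "(- 1) ^ (k - m) * (- 1) ^ m = ((- 1) ^ k :: complex)" using m by (simp flip: power_add)
    then show "(- 1) ^ (k - m) * ?N m * (\<Sum>j\<le>n. coeff (eulerian_poly m 0) j * ?x ^ j)
        = (- 1) ^ k * (?N m * of_nat (c choose m))"
      unfolding s by (metis (no_types, opaque_lifting) mult.assoc mult.left_commute)
  qed
  finally have "(\<Sum>j\<le>n. of_nat (homology_dim n G j (int n - 2)) * ?x ^ j)
      = (- 1) ^ k * of_nat (\<Sum>m<n. card (edge_words n G m) * (c choose m))"
    by (simp add: n lessThan_Suc_atMost sum_distrib_left)
  \<comment> \<open>The traces are complex, but the dimensions are natural numbers, so the identity
    descends to the reals.\<close>
  then have "complex_of_real (\<Sum>j\<le>n. real (homology_dim n G j (int n - 2)) * (- (2 * real c + 1)) ^ j)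
      = complex_of_real ((- 1) ^ k * real (\<Sum>m<n. card (edge_words n G m) * (c choose m)))"
    by simp
  then show ?thesis by (simp only: of_real_eq_iff)
qed

theorem theorem5p2:
  fixes n :: nat and G :: signed_graph
  assumes "signed_graph_on n G" and "edge_multiset G \<noteq> {#}"
  shows "\<exists>c :: nat \<Rightarrow> real.
    chromatic_poly n G = monom 1 n + (\<Sum>j<n. monom ((- 1) ^ (n - j) * c j) j) \<and> c n = 0 \<and>
    (\<forall>j\<le>n. real (homology_dim n G j (int n - 2)) = c j) \<and>
    (\<forall>x::real.
      (- 1) ^ n * (poly (chromatic_poly n G) (- x) - (- x) ^ n) = (\<Sum>j\<le>n. c j * x ^ j) \<and>
      (\<Sum>j\<le>n. c j * x ^ j) = (\<Sum>j\<le>n. real (homology_dim n G j (int n - 2)) * x ^ j))"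
proof -
  have "edge_pairs G \<noteq> {}" "edge_pairs G \<subseteq> ground n \<times> ground n"
    using edge_pairs_nonempty[OF assms] edge_pairs_props(1)[OF assms(1)] by auto
  then have "n \<noteq> 0" by (auto simp: ground_def)
  then obtain k where n: "n = Suc k" by (cases n) auto
  \<comment> \<open>The coefficients are defined as the dimensions; \<open>p\<close> is afterwards
    recognised as the chromatic polynomial by its values.\<close>
  define c where "c j = real (homology_dim n G j (int n - 2))" for j
  define p where "p = monom 1 n + (\<Sum>j<n. monom ((- 1) ^ (n - j) * c j) j)"
  \<comment> \<open>Cycles in this degree involve words of at most \<open>k\<close> blocks, and the
    polynomial of a word with \<open>m\<close> blocks has degree at most \<open>m\<close>.\<close>
  have cn: "c n = 0"
  proof -
    have "coeff (eulerian_poly m 0) n = 0" if "m \<le> k" for m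
      using degree_eulerian_poly[of m 0] that n by (intro coeff_eq_0) simp
    then have "(of_nat (homology_dim n G n (int n - 2)) :: complex) = 0"
      unfolding homology_dim_coeff[OF assms n] by simp
    then show ?thesis by (simp add: c_def)
  qed
  have p: "(- 1) ^ n * (poly p (- x) - (- x) ^ n) = (\<Sum>j\<le>n. c j * x ^ j)" for x
  proof -
    have "(- 1) ^ n * (poly p (- x) - (- x) ^ n) = (\<Sum>j<n. (- 1) ^ n * ((- 1) ^ (n - j) * c j * (- x) ^ j))"
      by (simp add: p_def poly_sum poly_monom sum_distrib_left)
    also have "\<dots> = (\<Sum>j<n. c j * x ^ j)"
    proof (rule sum.cong[OF refl])
      fix j assume "j \<in> {..<n}"
      then have "(- 1) ^ n * ((- 1) ^ (n - j) * (- 1) ^ j) = (1 :: real)"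
        by (simp flip: power_add mult_2)
      then show "(- 1) ^ n * ((- 1) ^ (n - j) * c j * (- x) ^ j) = c j * x ^ j"
        unfolding power_minus[of x] by (metis (no_types, opaque_lifting) mult.assoc mult.left_commute mult_1)
    qed
    also have "\<dots> = (\<Sum>j\<le>n. c j * x ^ j)" by (simp add: cn flip: lessThan_Suc_atMost)
    finally show ?thesis .
  qed
  \<comment> \<open>The value is the number of all colorings minus the number of improper
    ones.\<close>
  have val: "poly p (2 * real a + 1) = real (card (proper_colorings n G a))" for a :: nat
  proof -
    let ?S = "\<Sum>m<n. card (edge_words n G m) * (a choose m)"
    have "(- 1) ^ n * (poly p (2 * real a + 1) - (2 * real a + 1) ^ n) = (- 1) ^ k * real ?S"
      using p[of "- (2 * real a + 1)"] homology_dim_improper[OF assms n, of a] by (simp only: c_def minus_minus)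
    \<comment> \<open>\<open>(- 1) ^ n\<close> and \<open>(- 1) ^ k\<close> are opposite, which
      turns the sum over words into a subtraction.\<close>
    then have "(- 1) ^ k * (poly p (2 * real a + 1) - (2 * real a + 1) ^ n + real ?S) = 0"
      by (simp add: n algebra_simps)
    then have "poly p (2 * real a + 1) = (2 * real a + 1) ^ n - real ?S" by simp
    moreover have "(2 * real a + 1) ^ n = real ((2 * a + 1) ^ n)" by (simp add: add.commute)
    moreover have "real ((2 * a + 1) ^ n) = real (card (proper_colorings n G a)) + real ?S"
      using card_improper[OF assms(1), of a] by (simp only: of_nat_add)
    ultimately show ?thesis by linarith
  qed
  \<comment> \<open>The definite description needs uniqueness as well, which holds because a
    polynomial is determined by its values at the odd numbers.\<close>
  have "chromatic_poly n G = p"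
    unfolding chromatic_poly_def
  proof (rule the_equality)
    show "\<forall>a::nat. poly p (2 * real a + 1) = real (card (proper_colorings n G a))" using val by blast
    show "q = p" if "\<forall>a::nat. poly q (2 * real a + 1) = real (card (proper_colorings n G a))" for q
      using that val by (intro poly_odd_unique) simp
  qed
  then show ?thesis using p cn by (intro exI[of _ c]) (simp add: p_def c_def)
qed

end
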